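(* Let $\sigma=\mu/\nu$ and $\tau=\rho/\kappa$ be any skew shapes (with $\mu,\nu,\rho,\kappa$ partitions). For every natural number $m\ge 1$ and every $l\in\{0,1,\dots,m\}$, the sequence of plethysm coefficients \[ \mathsf{A}_{l,m}(\sigma,\tau)=\Big(a^{\sigma^{l,m}\{j\}}_{\tau^{l,m}[j],(m)}\Big)_{j\in\mathbb{N}} \] is eventually constant.
   Context: For partitions $\alpha,\beta$, $\alpha+\beta:=(\alpha_1+\beta_1,\alpha_2+\beta_2,\dots)$ and $\alpha\sqcup\beta$ is the partition obtained by concatenating the parts of $\alpha$ and $\beta$ and reordering into weakly decreasing order; $(a^b)$ denotes the partition with $b$ parts equal to $a$, and $(j)$ the one-part partition. For $m\in\mathbb{N}$, $l\in\{0,\dots,m\}$, a partition $\alpha$ and $j\in\mathbb{N}_0$, define $\alpha^{l,m}\{j\}:=(\alpha+(lj))\sqcup((m-l)^j)$ and $\alpha^{l,m}[j]:=\alpha+(j)$ if $m+l$ is even, $\alpha^{l,m}[j]:=\alpha\sqcup(1^j)$ if $m+l$ is odd. For a skew shape $\sigma=\mu/\nu$ (given by partitions $\mu,\nu$), set $\sigma^{l,m}\{j\}:=(\mu^{l,m}\{j\})/\nu$ and $\sigma^{l,m}[j]:=(\mu^{l,m}[j])/\nu$. Let $s_\lambda$ be the Schur function, $\circ$ plethysm, $\langle\cdot,\cdot\rangle$ the Hall inner product, and $c^\nu_{\lambda,\mu}$ the Littlewood–Richardson coefficients ($s_\lambda s_\mu=\sum_\nu c^\nu_{\lambda,\mu}s_\nu$).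 The skew Schur function is $s_{\nu/\lambda}:=\sum_\mu c^\nu_{\lambda,\mu}s_\mu$, and for partitions $\alpha,\beta,\lambda,\mu,\nu$ the plethysm coefficient is $a^{\nu/\lambda}_{\alpha/\beta,\mu}:=\langle s_{\alpha/\beta}\circ s_\mu, s_{\nu/\lambda}\rangle$ (for a partition $\nu$, $\nu$ is identified with $\nu/\emptyset$). A sequence stabilises (is eventually constant) if it is constant from some index on. *)

theory Defs
  imports Complex_Main "HOL-Library.Multiset"
begin

section \<open>Partitions and skew shapes\<close>

definition is_partition :: "nat list \<Rightarrow> bool" where
  "is_partition \<alpha> \<longleftrightarrow> sorted_wrt (\<ge>) \<alpha> \<and> 0 \<notin> set \<alpha>"

text \<open>The pair \<open>(\<mu>, \<nu>)\<close> stands for \<open>\<mu>/\<nu>\<close>; containment of \<open>\<nu>\<close> in \<open>\<mu>\<close> is not required.\<close>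

type_synonym skew_shape = "nat list \<times> nat list"

text \<open>\<open>(a\<^sup>b)\<close>; there are no zero parts, so \<open>(0\<^sup>b)\<close> is the empty partition.\<close>

definition rect :: "nat \<Rightarrow> nat \<Rightarrow> nat list" where
  "rect a b = (if a = 0 then [] else replicate b a)"

abbreviation one_part :: "nat \<Rightarrow> nat list" where
  "one_part a \<equiv> rect a 1"

definition part :: "nat list \<Rightarrow> nat \<Rightarrow> nat" where
  "part \<alpha> i = (if i < length \<alpha> then \<alpha> ! i else 0)"

definition partition_add :: "nat list \<Rightarrow> nat list \<Rightarrow> nat list" where
  "partition_add \<alpha> \<beta> = map (\<lambda>i. part \<alpha> i + part \<beta> i) [0..<max (length \<alpha>) (length \<beta>)]"

definition partition_join :: "nat list \<Rightarrow> nat list \<Rightarrow> nat list" where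
  "partition_join \<alpha> \<beta> = rev (sort (\<alpha> @ \<beta>))"

text \<open>\<open>curly l m j \<alpha>\<close> is \<open>\<alpha>\<close> with superscript \<open>l,m\<close> followed by \<open>j\<close> in curly brackets, and
  \<open>square l m j \<alpha>\<close> the analogue with square brackets. Both assume \<open>l \<le> m\<close>.\<close>

definition curly :: "nat \<Rightarrow> nat \<Rightarrow> nat \<Rightarrow> nat list \<Rightarrow> nat list" where
  "curly l m j \<alpha> = partition_join (partition_add \<alpha> (one_part (l * j))) (rect (m - l) j)"

definition square :: "nat \<Rightarrow> nat \<Rightarrow> nat \<Rightarrow> nat list \<Rightarrow> nat list" where
  "square l m j \<alpha> =
     (if even (m + l) then partition_add \<alpha> (one_part j) else partition_join \<alpha> (rect 1 j))"

definition skew_curly :: "nat \<Rightarrow> nat \<Rightarrow> nat \<Rightarrow> skew_shape \<Rightarrow> skew_shape" where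
  "skew_curly l m j \<sigma> = (curly l m j (fst \<sigma>), snd \<sigma>)"

definition skew_square :: "nat \<Rightarrow> nat \<Rightarrow> nat \<Rightarrow> skew_shape \<Rightarrow> skew_shape" where
  "skew_square l m j \<sigma> = (square l m j (fst \<sigma>), snd \<sigma>)"


section \<open>Power series in countably many variables\<close>

text \<open>Formal power series over the rationals in \<open>x\<^sub>0, x\<^sub>1, x\<^sub>2, \<dots>\<close>. A monomial is the multiset of
  the indices of its variables, and a series is the family of its coefficients. The ring of
  symmetric functions is the rational span of the Schur functions defined below.\<close>

typedef pser = "UNIV :: (nat multiset \<Rightarrow> rat) set"
  morphisms coeff Pser ..

setup_lifting type_definition_pser

lemma pser_eqI: "(\<And>A. coeff f A = coeff g A) \<Longrightarrow> f = g"
  by (metis coeff_inject ext)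

lemma finite_mset_splits: "finite {(B, C). B + C = (A :: nat multiset)}"
proof -
  have "{B. B \<subseteq># A} \<subseteq> mset ` {xs. set xs \<subseteq> set_mset A \<and> length xs \<le> size A}"
  proof
    fix B assume "B \<in> {B. B \<subseteq># A}"
    then have B: "B \<subseteq># A" by simp
    obtain xs where xs: "mset xs = B" using ex_mset by blast
    have "set xs \<subseteq> set_mset A" using B xs set_mset_mono by (metis set_mset_mset)
    moreover have "length xs \<le> size A" using B xs size_mset_mono by (metis size_mset)
    ultimately show "B \<in> mset ` {xs. set xs \<subseteq> set_mset A \<and> length xs \<le> size A}"
      using xs by blast
  qed
  moreover have "finite {xs. set xs \<subseteq> set_mset A \<and> length xs \<le> size A}"
    by (rule finite_lists_length_le) simp
  ultimately have "finite {B. B \<subseteq># A}" by (meson finite_imageI finite_subset)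
  moreover have "{(B, C). B + C = A} \<subseteq> {B. B \<subseteq># A} \<times> {B. B \<subseteq># A}" by auto
  ultimately show ?thesis by (meson finite_SigmaI finite_subset)
qed

instantiation pser :: comm_ring_1
begin

lift_definition zero_pser :: pser is "\<lambda>_. 0" .
lift_definition one_pser :: pser is "\<lambda>A. if A = {#} then 1 else 0" .
lift_definition plus_pser :: "pser \<Rightarrow> pser \<Rightarrow> pser" is "\<lambda>f g A. f A + g A" .
lift_definition minus_pser :: "pser \<Rightarrow> pser \<Rightarrow> pser" is "\<lambda>f g A. f A - g A" .
lift_definition uminus_pser :: "pser \<Rightarrow> pser" is "\<lambda>f A. - f A" .
lift_definition times_pser :: "pser \<Rightarrow> pser \<Rightarrow> pser" is
  "\<lambda>f g A. \<Sum>(B, C) | B + C = A. f B * g C" .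

instance
proof
  fix f g h :: pser
  show "f * g * h = f * (g * h)"
  proof (rule pser_eqI)
    fix A
    have "coeff (f * g * h) A =
        (\<Sum>(B, C) | B + C = A. \<Sum>(D, E) | D + E = B. coeff f D * coeff g E * coeff h C)"
      by (simp add: times_pser.rep_eq sum_distrib_right case_prod_unfold)
    also have "\<dots> = (\<Sum>((B, C), D, E) \<in> (SIGMA p:{(B, C). B + C = A}. {(D, E). D + E = fst p}).
        coeff f D * coeff g E * coeff h C)"
      by (subst sum.Sigma[symmetric])
        (use finite_mset_splits in \<open>auto simp: case_prod_unfold\<close>)
    also have "\<dots> = (\<Sum>((B, C), D, E) \<in> (SIGMA p:{(B, C). B + C = A}. {(D, E). D + E = snd p}).
        coeff f B * (coeff g D * coeff h E))"
      by (rule sum.reindex_bij_witness[where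
            i = "\<lambda>((B, C), D, E). ((B + D, E), B, D)" and
            j = "\<lambda>((B, C), D, E). ((D, E + C), E, C)"]) (auto simp: algebra_simps)
    also have "\<dots> =
        (\<Sum>(B, C) | B + C = A. \<Sum>(D, E) | D + E = C. coeff f B * (coeff g D * coeff h E))"
      by (subst sum.Sigma[symmetric])
        (use finite_mset_splits in \<open>auto simp: case_prod_unfold\<close>)
    also have "\<dots> = coeff (f * (g * h)) A"
      by (simp add: times_pser.rep_eq sum_distrib_left case_prod_unfold)
    finally show "coeff (f * g * h) A = coeff (f * (g * h)) A" .
  qed
  show "f * g = g * f"
  proof (rule pser_eqI)
    fix A show "coeff (f * g) A = coeff (g * f) A"
      unfolding times_pser.rep_eq
      by (rule sum.reindex_bij_witness[where i = prod.swap and j = prod.swap])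
        (auto simp: algebra_simps)
  qed
  show "1 * f = f"
  proof (rule pser_eqI)
    fix A
    have "coeff (1 * f) A =
        (\<Sum>p \<in> {(B, C). B + C = A}. if p = ({#}, A) then coeff f A else 0)"
      unfolding times_pser.rep_eq one_pser.rep_eq by (rule sum.cong) (auto split: if_splits)
    also have "\<dots> = coeff f A" by (simp add: sum.delta finite_mset_splits)
    finally show "coeff (1 * f) A = coeff f A" .
  qed
  show "(f + g) * h = f * h + g * h"
    by (rule pser_eqI)
      (simp add: times_pser.rep_eq plus_pser.rep_eq case_prod_unfold distrib_right sum.distrib)
  show "(0 :: pser) \<noteq> 1"
    by (metis one_pser.rep_eq zero_pser.rep_eq zero_neq_one)
qed (transfer; auto simp: algebra_simps)+

end

lift_definition pscale :: "rat \<Rightarrow> pser \<Rightarrow> pser" is "\<lambda>c f A. c * f A" .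

global_interpretation pser: vector_space pscale
  by unfold_locales (transfer; auto simp: algebra_simps)+


section \<open>Schur functions and the Hall inner product\<close>

text \<open>A tableau is the list of its rows. The entry \<open>i\<close> corresponds to the variable \<open>x\<^sub>i\<close>, so entries
  start at \<open>0\<close>.\<close>

definition semistandard :: "nat list \<Rightarrow> nat list list \<Rightarrow> bool" where
  "semistandard \<alpha> T \<longleftrightarrow>
     map length T = \<alpha> \<and>
     (\<forall>row \<in> set T. sorted row) \<and>
     (\<forall>i k. Suc i < length T \<and> k < length (T ! Suc i) \<longrightarrow> T ! i ! k < T ! Suc i ! k)"

definition schur :: "nat list \<Rightarrow> pser" where
  "schur \<alpha> = Pser (\<lambda>A. of_nat (card {T. semistandard \<alpha> T \<and> mset (concat T) = A}))"

definition schur_basis :: "pser set" where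
  "schur_basis = schur ` {\<alpha>. is_partition \<alpha>}"

definition schur_coeff :: "pser \<Rightarrow> nat list \<Rightarrow> rat" where
  "schur_coeff f \<alpha> = pser.representation schur_basis f (schur \<alpha>)"

text \<open>The bilinear form on symmetric functions for which the Schur functions are orthonormal.\<close>

definition hall :: "pser \<Rightarrow> pser \<Rightarrow> rat" where
  "hall f g =
     (\<Sum>\<alpha> | is_partition \<alpha> \<and> schur_coeff f \<alpha> \<noteq> 0. schur_coeff f \<alpha> * schur_coeff g \<alpha>)"

definition lr_coeff :: "nat list \<Rightarrow> nat list \<Rightarrow> nat list \<Rightarrow> rat" where
  "lr_coeff \<nu> \<alpha> \<beta> = schur_coeff (schur \<alpha> * schur \<beta>) \<nu>"

text \<open>The degree condition only makes the sum finite: all other coefficients vanish.\<close>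

definition skew_schur :: "skew_shape \<Rightarrow> pser" where
  "skew_schur \<sigma> = (case \<sigma> of (\<nu>, \<alpha>) \<Rightarrow>
     \<Sum>\<beta> | is_partition \<beta> \<and> sum_list \<alpha> + sum_list \<beta> = sum_list \<nu>.
       pscale (lr_coeff \<nu> \<alpha> \<beta>) (schur \<beta>))"


section \<open>Plethysm\<close>

text \<open>\<open>adams k g\<close> is \<open>g(x\<^sub>0\<^sup>k, x\<^sub>1\<^sup>k, \<dots>)\<close>, for \<open>k \<ge> 1\<close>. Its coefficient at a monomial is a sum over
  the \<open>k\<close>-th roots of that monomial, of which there is at most one.\<close>

definition adams :: "nat \<Rightarrow> pser \<Rightarrow> pser" where
  "adams k g = Pser (\<lambda>A. \<Sum>B | repeat_mset k B = A. coeff g B)"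

definition power_sum :: "nat \<Rightarrow> pser" where
  "power_sum k = Pser (\<lambda>A. if \<exists>i. A = replicate_mset k i then 1 else 0)"

definition power_sums :: "nat list \<Rightarrow> pser" where
  "power_sums \<alpha> = (\<Prod>k\<leftarrow>\<alpha>. power_sum k)"

definition power_sum_basis :: "pser set" where
  "power_sum_basis = power_sums ` {\<alpha>. is_partition \<alpha>}"

definition power_sum_coeff :: "pser \<Rightarrow> nat list \<Rightarrow> rat" where
  "power_sum_coeff f \<alpha> = pser.representation power_sum_basis f (power_sums \<alpha>)"

text \<open>For fixed \<open>g\<close>, the plethysm \<open>f \<circ> g\<close> is the algebra homomorphism in \<open>f\<close> that sends the power
  sum \<open>p\<^sub>k\<close> to \<open>g(x\<^sub>0\<^sup>k, x\<^sub>1\<^sup>k, \<dots>)\<close>.\<close>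

definition plethysm :: "pser \<Rightarrow> pser \<Rightarrow> pser" where
  "plethysm f g =
     (\<Sum>\<alpha> | is_partition \<alpha> \<and> power_sum_coeff f \<alpha> \<noteq> 0.
        pscale (power_sum_coeff f \<alpha>) (\<Prod>k\<leftarrow>\<alpha>. adams k g))"

text \<open>\<open>plethysm_coeff \<tau> \<mu> \<sigma>\<close> is the plethysm coefficient with lower indices \<open>\<tau>, \<mu>\<close> and upper
  index \<open>\<sigma>\<close>.\<close>

definition plethysm_coeff :: "skew_shape \<Rightarrow> nat list \<Rightarrow> skew_shape \<Rightarrow> rat" where
  "plethysm_coeff \<tau> \<mu> \<sigma> = hall (plethysm (skew_schur \<tau>) (schur \<mu>)) (skew_schur \<sigma>)"

end

theory Submission
  imports Defs "HOL-Combinatorics.Transposition"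
begin

text \<open>
  The Schur coefficient of a symmetric function \<open>f\<close> at \<open>\<alpha>\<close> is the coefficient of
  \<open>x\<^sup>\<alpha>\<^sup>+\<^sup>\<delta>\<close> in \<open>a\<^sub>\<delta> f\<close>, where \<open>a\<^sub>\<delta>\<close> is the Vandermonde product. Expanding
  \<open>s\<^bsub>\<tau>[j]\<^esub>\<close> accordingly reduces the claim to Schur coefficients at \<open>\<mu>{j}\<close> of
  \<open>(h\<^sub>j\<^sub>+\<^sub>a \<circ> h\<^sub>m) g\<close> (or of \<open>(e\<^sub>j\<^sub>+\<^sub>a \<circ> h\<^sub>m) g\<close>, depending on the parity of \<open>m + l\<close>) with \<open>g\<close> fixed.
  Removing one column of \<open>\<mu>{j}\<close> expresses such a coefficient by skewing with elementary symmetric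
  functions, and only finitely many terms survive, uniformly in \<open>j\<close>. Skewing by \<open>e\<^sub>c\<close> extracts the
  coefficient of \<open>z\<^sup>c\<close> for a fermionic variable \<open>z\<close>. After \<open>k = m - l\<close> columns, what remains is a
  coefficient of the evaluation of the plethysm at \<open>k\<close> fermionic variables
  \<open>z\<^sub>1, \<dots>, z\<^sub>k\<close> and bosonic variables \<open>x, y\<^sub>1, y\<^sub>2, \<dots>\<close>, which counts multisets of monomials of
  degree \<open>m\<close> in which no monomial of one parity is repeated. The choice of \<open>h\<close> or \<open>e\<close> is
  such that \<open>z\<^sub>1 \<cdots> z\<^sub>k x\<^sup>l\<close> may be repeated. When \<open>j\<close> is large, every multiset that is counted contains
  this monomial, and removing it is a bijection to the multisets counted for \<open>j - 1\<close>.
\<close>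

section \<open>Coefficients of power series\<close>

text \<open>The column removal is uniform in \<open>j\<close> for a degree reason:
  \<open>omega\<close> makes all variables fermionic, so a letter of the plethysm contains each
  variable at most once, and a word of \<open>j + a\<close> letters has degree at most
  \<open>j + a\<close> in each. The removed column has length \<open>j\<close> plus a constant, so
  its alternating expansion is confined to a window of constant width. \<open>good\<close> couples
  this bound with stability; it survives multiplication by a fixed symmetric function, and skewing
  by an elementary one trades a column for a fermionic variable. The repeatable monomial has degree
  \<open>k + l = m\<close> and sign (-1)^k, and \<open>m + l\<close> has the parity of
  \<open>k\<close>: hence the two cases of \<open>square\<close>. Inner shapes are harmless, since
  skewing is adjoint to multiplication, and a fixed factor of bounded degree only mixes finitely
  many shifts of a coefficient sequence. As \<open>hall\<close> and \<open>plethysm\<close> are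
  given by coordinates, the Schur functions and the power sums have to be shown to be bases. Column
  statements come from row statements through \<open>omega\<close>, whose effect on Schur
  coefficients is found by comparing the two Pieri rules.\<close>

declare zero_pser.rep_eq [simp] one_pser.rep_eq [simp] plus_pser.rep_eq [simp]
  minus_pser.rep_eq [simp] uminus_pser.rep_eq [simp] pscale.rep_eq [simp]

lemma coeff_Pser [simp]: "coeff (Pser \<phi>) = \<phi>"
  by (simp add: Pser_inverse)

lemma coeff_sum [simp]: "coeff (sum f S) A = (\<Sum>x\<in>S. coeff (f x) A)"
  by (induction S rule: infinite_finite_induct) auto

lemma finite_submultisets [simp]: "finite {B. B \<subseteq># (A :: nat multiset)}"
proof -
  have "{B. B \<subseteq># A} = fst ` {(B, C). B + C = A}"
    by (auto simp: image_iff subset_mset.le_iff_add)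
  then show ?thesis by (simp add: finite_mset_splits)
qed

lemma sum_splits:
  "(\<Sum>(B, C) | B + C = (A :: nat multiset). f B C) = (\<Sum>B | B \<subseteq># A. f B (A - B))"
  by (rule sum.reindex_bij_witness[where i = "\<lambda>B. (B, A - B)" and j = fst]) auto

lemma coeff_mult: "coeff (f * g) A = (\<Sum>B | B \<subseteq># A. coeff f B * coeff g (A - B))"
  by (simp add: times_pser.rep_eq sum_splits)

lemma coeff_mult': "coeff (f * g) A = (\<Sum>B | B \<subseteq># A. coeff f (A - B) * coeff g B)"
  by (subst mult.commute) (simp add: coeff_mult mult.commute[of "coeff g _"])

lemma pscale_mult_left [simp]: "pscale c f * g = pscale c (f * g)"
  by (rule pser_eqI) (simp add: coeff_mult sum_distrib_left mult.assoc)

lemma pscale_mult_right [simp]: "f * pscale c g = pscale c (f * g)"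
  by (metis mult.commute pscale_mult_left)

lemma pscale_sum: "pscale c (sum f S) = (\<Sum>x\<in>S. pscale c (f x))"
  by (rule pser_eqI) (simp add: sum_distrib_left)

definition X :: "nat \<Rightarrow> pser" where
  "X i = Pser (\<lambda>A. if A = {#i#} then 1 else 0)"

lemma coeff_X: "coeff (X i) A = (if A = {#i#} then 1 else 0)"
  by (simp add: X_def)

lemma coeff_X_mult: "coeff (X i * f) A = (if i \<in># A then coeff f (A - {#i#}) else 0)"
proof -
  have "coeff (X i * f) A = (\<Sum>B | B \<subseteq># A. if B = {#i#} then coeff f (A - {#i#}) else 0)"
    unfolding coeff_mult by (rule sum.cong) (auto simp: coeff_X)
  also have "\<dots> = (if i \<in># A then coeff f (A - {#i#}) else 0)"
    by (simp add: sum.delta')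
  finally show ?thesis .
qed

section \<open>Homogeneous series and series of bounded degree\<close>

definition homogeneous :: "nat \<Rightarrow> pser \<Rightarrow> bool" where
  "homogeneous d f \<longleftrightarrow> (\<forall>A. coeff f A \<noteq> 0 \<longrightarrow> size A = d)"

definition bounded_by :: "nat \<Rightarrow> pser \<Rightarrow> bool" where
  "bounded_by d f \<longleftrightarrow> (\<forall>A. coeff f A \<noteq> 0 \<longrightarrow> size A \<le> d)"

lemma coeff_mult_nonzeroE:
  assumes "coeff (f * g) A \<noteq> 0"
  obtains B C where "A = B + C" "coeff f B \<noteq> 0" "coeff g C \<noteq> 0"
proof -
  from assms obtain B where "B \<subseteq># A" "coeff f B * coeff g (A - B) \<noteq> 0"
    unfolding coeff_mult by (metis (mono_tags, lifting) mem_Collect_eq sum.neutral)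
  then show ?thesis by (intro that[of B "A - B"]) auto
qed

lemma homogeneous_mult:
  "homogeneous d f \<Longrightarrow> homogeneous e g \<Longrightarrow> homogeneous (d + e) (f * g)"
  unfolding homogeneous_def by (metis coeff_mult_nonzeroE size_union)

lemma homogeneous_one: "homogeneous 0 1"
  by (simp add: homogeneous_def)

lemma homogeneous_prod:
  "(\<And>x. x \<in> S \<Longrightarrow> homogeneous (d x) (f x)) \<Longrightarrow> homogeneous (sum d S) (prod f S)"
  by (induction S rule: infinite_finite_induct) (auto intro: homogeneous_mult homogeneous_one)

lemma bounded_by_mult: "bounded_by d f \<Longrightarrow> bounded_by e g \<Longrightarrow> bounded_by (d + e) (f * g)"
  unfolding bounded_by_def by (metis coeff_mult_nonzeroE size_union add_mono)

lemma homogeneous_bounded_by: "homogeneous d f \<Longrightarrow> bounded_by d f"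
  by (auto simp: homogeneous_def bounded_by_def)

lemma bounded_by_mono: "bounded_by d f \<Longrightarrow> d \<le> e \<Longrightarrow> bounded_by e f"
  by (force simp: bounded_by_def)

lemma count_image_mset_inj:
  assumes "inj f" shows "count (image_mset f A) (f x) = count A x"
proof (induction A)
  case (add a A)
  then show ?case using assms by (auto dest: injD)
qed simp

section \<open>Symmetric functions\<close>

text \<open>Coefficients are pulled back, so the variable with index \<open>i\<close> goes to the
  one with index \<open>inv \<pi> i\<close>.\<close>

definition pact :: "(nat \<Rightarrow> nat) \<Rightarrow> pser \<Rightarrow> pser" where
  "pact \<pi> f = Pser (\<lambda>A. coeff f (image_mset \<pi> A))"

lemma coeff_pact [simp]: "coeff (pact \<pi> f) A = coeff f (image_mset \<pi> A)"
  by (simp add: pact_def)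

lemma image_mset_inv [simp]:
  assumes "bij \<pi>"
  shows "image_mset \<pi> (image_mset (inv \<pi>) A) = A" "image_mset (inv \<pi>) (image_mset \<pi> A) = A"
  using assms by (auto simp: multiset.map_comp o_def bij_is_surj surj_f_inv_f bij_is_inj)

lemma pact_mult:
  assumes "bij \<pi>" shows "pact \<pi> (f * g) = pact \<pi> f * pact \<pi> g"
proof (rule pser_eqI)
  fix A
  have inj: "inj \<pi>" using assms by (rule bij_is_inj)
  show "coeff (pact \<pi> (f * g)) A = coeff (pact \<pi> f * pact \<pi> g) A"
    unfolding coeff_pact coeff_mult
  proof (rule sum.reindex_bij_witness[where i = "image_mset \<pi>" and j = "image_mset (inv \<pi>)"])
    fix B assume "B \<in> {B. B \<subseteq># image_mset \<pi> A}"
    then have "image_mset (inv \<pi>) B \<subseteq># image_mset (inv \<pi>) (image_mset \<pi> A)"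
      by (intro image_mset_subseteq_mono) simp
    then show "image_mset (inv \<pi>) B \<in> {B. B \<subseteq># A}" using assms by simp
    then show "coeff f (image_mset \<pi> (image_mset (inv \<pi>) B)) *
          coeff g (image_mset \<pi> (A - image_mset (inv \<pi>) B)) =
          coeff f B * coeff g (image_mset \<pi> A - B)"
      using assms by (simp add: image_mset_Diff)
  qed (use assms in \<open>auto intro: image_mset_subseteq_mono\<close>)
qed

lemma pact_one [simp]: "pact \<pi> 1 = 1"
  by (rule pser_eqI) simp

lemma pact_diff: "pact \<pi> (f - g) = pact \<pi> f - pact \<pi> g"
  by (rule pser_eqI) simp

lemma pact_prod: "bij \<pi> \<Longrightarrow> pact \<pi> (prod f S) = (\<Prod>x\<in>S. pact \<pi> (f x))"
  by (induction S rule: infinite_finite_induct) (auto simp: pact_mult)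

definition symf :: "pser \<Rightarrow> bool" where
  "symf f \<longleftrightarrow> (\<forall>\<pi>. bij \<pi> \<longrightarrow> pact \<pi> f = f)"

lemma symf_coeff: "symf f \<Longrightarrow> bij \<pi> \<Longrightarrow> coeff f (image_mset \<pi> A) = coeff f A"
  unfolding symf_def by (metis coeff_pact)

lemma symfI: "(\<And>\<pi> A. bij \<pi> \<Longrightarrow> coeff f (image_mset \<pi> A) = coeff f A) \<Longrightarrow> symf f"
  unfolding symf_def by (auto intro: pser_eqI)

text \<open>The degree bound excludes infinite sums such as the sum of all complete symmetric
  functions. Closure properties are easy to check in this description without a basis;
  \<open>Sym_expansion\<close> and \<open>Sym_eq_span\<close> relate it to the two bases.\<close>

definition Sym :: "pser set" where
  "Sym = {f. symf f \<and> (\<exists>d. bounded_by d f)}"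

lemma SymI: "symf f \<Longrightarrow> bounded_by d f \<Longrightarrow> f \<in> Sym"
  by (auto simp: Sym_def)

lemma Sym_symf: "f \<in> Sym \<Longrightarrow> symf f"
  by (auto simp: Sym_def)

lemma Sym_boundedE: assumes "f \<in> Sym" obtains d where "bounded_by d f"
  using assms by (auto simp: Sym_def)

lemma symf_mult: "symf f \<Longrightarrow> symf g \<Longrightarrow> symf (f * g)"
  unfolding symf_def by (simp add: pact_mult)

lemma Sym_mult [intro]: "f \<in> Sym \<Longrightarrow> g \<in> Sym \<Longrightarrow> f * g \<in> Sym"
  unfolding Sym_def using symf_mult bounded_by_mult by blast

lemma Sym_one [simp, intro]: "1 \<in> Sym"
  by (rule SymI[of _ 0]) (auto simp: bounded_by_def intro!: symfI)

lemma Sym_zero [simp, intro]: "0 \<in> Sym"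
  by (rule SymI[of _ 0]) (auto simp: bounded_by_def intro!: symfI)

lemma Sym_add [intro]:
  assumes "f \<in> Sym" "g \<in> Sym" shows "f + g \<in> Sym"
proof -
  obtain d e where "bounded_by d f" "bounded_by e g" using assms by (meson Sym_boundedE)
  then have "bounded_by (max d e) (f + g)"
    unfolding bounded_by_def by (metis add_0 le_max_iff_disj plus_pser.rep_eq)
  then show ?thesis
    using assms by (intro SymI) (auto intro!: symfI simp: symf_coeff Sym_symf)
qed

lemma Sym_pscale [intro]:
  assumes "f \<in> Sym" shows "pscale c f \<in> Sym"
proof -
  obtain d where "bounded_by d f" using assms by (meson Sym_boundedE)
  then have "bounded_by d (pscale c f)" by (auto simp: bounded_by_def)
  then show ?thesis
    using assms by (intro SymI) (auto intro!: symfI simp: symf_coeff Sym_symf)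
qed

lemma Sym_uminus [intro]: "f \<in> Sym \<Longrightarrow> - f \<in> Sym"
  using Sym_pscale[of f "-1"] by simp

lemma Sym_diff [intro]: "f \<in> Sym \<Longrightarrow> g \<in> Sym \<Longrightarrow> f - g \<in> Sym"
  using Sym_add[of f "- g"] by auto

lemma Sym_sum [intro]: "(\<And>x. x \<in> S \<Longrightarrow> f x \<in> Sym) \<Longrightarrow> sum f S \<in> Sym"
  by (induction S rule: infinite_finite_induct) auto

lemma Sym_prod [intro]: "(\<And>x. x \<in> S \<Longrightarrow> f x \<in> Sym) \<Longrightarrow> prod f S \<in> Sym"
  by (induction S rule: infinite_finite_induct) auto

lemma Sym_prod_list [intro]: "(\<And>x. x \<in> set xs \<Longrightarrow> f x \<in> Sym) \<Longrightarrow> (\<Prod>x\<leftarrow>xs. f x) \<in> Sym"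
  by (induction xs) auto

section \<open>Extracting a power of the first variable\<close>

text \<open>On exponent sequences this is Cons: the exponent \<open>c\<close> in front, those of
  \<open>A\<close> moved up by one index.\<close>

definition mcons :: "nat \<Rightarrow> nat multiset \<Rightarrow> nat multiset" where
  "mcons c A = replicate_mset c 0 + image_mset Suc A"

lemma count_mcons_0 [simp]: "count (mcons c A) 0 = c"
proof -
  have "count (image_mset Suc A) 0 = 0" by (induction A) auto
  then show ?thesis by (simp add: mcons_def)
qed

lemma count_mcons_Suc [simp]: "count (mcons c A) (Suc i) = count A i"
  by (simp add: mcons_def count_image_mset_inj)

lemma mcons_eqI: "count B 0 = c \<Longrightarrow> (\<And>i. count B (Suc i) = count A i) \<Longrightarrow> mcons c A = B"
  by (rule multiset_eqI) (metis count_mcons_0 count_mcons_Suc not0_implies_Suc)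

lemma size_mcons [simp]: "size (mcons c A) = c + size A"
  by (simp add: mcons_def)

lemma mcons_inj [simp]: "mcons a A = mcons b B \<longleftrightarrow> a = b \<and> A = B"
  by (metis count_mcons_0 count_mcons_Suc multiset_eqI)

lemma mcons_subset [simp]: "mcons a A \<subseteq># mcons b B \<longleftrightarrow> a \<le> b \<and> A \<subseteq># B"
  unfolding subseteq_mset_def by (metis count_mcons_0 count_mcons_Suc not0_implies_Suc)

lemma mcons_diff [simp]: "mcons a A - mcons b B = mcons (a - b) (A - B)"
  by (rule sym, rule mcons_eqI) auto

lemma mconsE: obtains c A where "B = mcons c A"
proof
  show "B = mcons (count B 0) (image_mset (\<lambda>i. i - 1) (filter_mset (\<lambda>i. i \<noteq> 0) B))"
  proof (induction B)
    case (add x B)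
    then show ?case by (cases x) (auto simp: mcons_def)
  qed (simp add: mcons_def)
qed

lemma mcons_eq_empty [simp]: "mcons c A = {#} \<longleftrightarrow> c = 0 \<and> A = {#}"
  by (auto simp: mcons_def)

lemma submultisets_mcons:
  "{B. B \<subseteq># mcons c A} = (\<lambda>(a, B). mcons a B) ` ({..c} \<times> {B. B \<subseteq># A})"
proof (intro set_eqI iffI)
  fix B assume "B \<in> {B. B \<subseteq># mcons c A}"
  then show "B \<in> (\<lambda>(a, B). mcons a B) ` ({..c} \<times> {B. B \<subseteq># A})"
    by (cases B rule: mconsE) (auto simp: image_iff)
qed auto

text \<open>On symmetric functions, this is the adjoint of the multiplication by \<open>h\<^sub>c\<close>.\<close>

definition hperp :: "nat \<Rightarrow> pser \<Rightarrow> pser" where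
  "hperp c f = Pser (\<lambda>A. coeff f (mcons c A))"

lemma coeff_hperp [simp]: "coeff (hperp c f) A = coeff f (mcons c A)"
  by (simp add: hperp_def)

text \<open>\<open>hperp c\<close> reads off the coefficient of the c-th power of \<open>x_0\<close>
  as a series in the remaining variables, so this is the Cauchy product in
  \<open>x_0\<close>.\<close>

lemma hperp_mult: "hperp c (f * g) = (\<Sum>a\<le>c. hperp a f * hperp (c - a) g)"
proof (rule pser_eqI)
  fix A
  have "inj_on (\<lambda>(a, B). mcons a B) ({..c} \<times> {B. B \<subseteq># A})" by (auto simp: inj_on_def)
  then have "coeff (hperp c (f * g)) A =
      (\<Sum>(a, B)\<in>{..c} \<times> {B. B \<subseteq># A}. coeff f (mcons a B) * coeff g (mcons c A - mcons a B))"
    by (simp add: coeff_mult submultisets_mcons sum.reindex case_prod_unfold)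
  also have "\<dots> = (\<Sum>a\<le>c. coeff (hperp a f * hperp (c - a) g) A)"
    by (simp add: sum.cartesian_product[symmetric] coeff_mult)
  finally show "coeff (hperp c (f * g)) A = coeff (\<Sum>a\<le>c. hperp a f * hperp (c - a) g) A"
    by simp
qed

lemma hperp_add: "hperp c (f + g) = hperp c f + hperp c g"
  by (rule pser_eqI) simp

lemma hperp_diff: "hperp c (f - g) = hperp c f - hperp c g"
  by (rule pser_eqI) simp

lemma hperp_pscale: "hperp c (pscale a f) = pscale a (hperp c f)"
  by (rule pser_eqI) simp

lemma hperp_one: "hperp c 1 = (if c = 0 then 1 else 0)"
  by (rule pser_eqI) simp

lemma hperp_zero [simp]: "hperp c 0 = 0"
  by (rule pser_eqI) simp

text \<open>A permutation of the remaining variables extends to one that fixes the first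
  variable.\<close>

lemma hperp_Sym [intro]:
  assumes "f \<in> Sym" shows "hperp c f \<in> Sym"
proof -
  obtain d where "bounded_by d f" using assms by (meson Sym_boundedE)
  then have "bounded_by d (hperp c f)" unfolding bounded_by_def by fastforce
  moreover have "symf (hperp c f)"
  proof (rule symfI)
    fix \<pi> :: "nat \<Rightarrow> nat" and A assume \<pi>: "bij \<pi>"
    define \<pi>' where "\<pi>' = (\<lambda>i. case i of 0 \<Rightarrow> 0 | Suc j \<Rightarrow> Suc (\<pi> j))"
    have "bij \<pi>'"
    proof (rule o_bij)
      show "(\<lambda>i. case i of 0 \<Rightarrow> 0 | Suc j \<Rightarrow> Suc (inv \<pi> j)) \<circ> \<pi>' = id"
        using \<pi> by (auto simp: \<pi>'_def fun_eq_iff bij_is_inj split: nat.splits)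
      show "\<pi>' \<circ> (\<lambda>i. case i of 0 \<Rightarrow> 0 | Suc j \<Rightarrow> Suc (inv \<pi> j)) = id"
        using \<pi> by (auto simp: \<pi>'_def fun_eq_iff bij_is_surj surj_f_inv_f split: nat.splits)
    qed
    moreover have "image_mset \<pi>' (mcons c A) = mcons c (image_mset \<pi> A)"
      by (simp add: mcons_def \<pi>'_def multiset.map_comp o_def)
    ultimately show "coeff (hperp c f) (image_mset \<pi> A) = coeff (hperp c f) A"
      using symf_coeff[OF Sym_symf[OF assms], of \<pi>' "mcons c A"] by simp
  qed
  ultimately show ?thesis by (rule SymI[rotated])
qed

section \<open>Coefficient extraction with the Vandermonde product\<close>

definition vdm :: "nat \<Rightarrow> pser" where
  "vdm N = (\<Prod>(i, j) \<in> {(i, j). i < j \<and> j < N}. X i - X j)"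

definition mon :: "nat \<Rightarrow> (nat \<Rightarrow> nat) \<Rightarrow> nat multiset" where
  "mon N \<alpha> = (\<Sum>i<N. replicate_mset (\<alpha> i) i)"

definition staircase :: "nat \<Rightarrow> nat multiset" where
  "staircase N = mon N (\<lambda>i. N - Suc i)"

abbreviation shifted :: "nat \<Rightarrow> (nat \<Rightarrow> nat) \<Rightarrow> nat multiset" where
  "shifted N \<alpha> \<equiv> mon N \<alpha> + staircase N"

text \<open>The coefficient of the Schur function of \<open>\<alpha>\<close> in \<open>f\<close>, provided that \<open>f\<close> is symmetric and
  \<open>\<alpha>\<close> has at most \<open>N\<close> parts.\<close>

definition alt :: "nat \<Rightarrow> (nat \<Rightarrow> nat) \<Rightarrow> pser \<Rightarrow> rat" where
  "alt N \<alpha> f = coeff (vdm N * f) (shifted N \<alpha>)"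

lemma count_mon [simp]: "count (mon N \<alpha>) j = (if j < N then \<alpha> j else 0)"
  by (simp add: mon_def count_sum)

lemma size_mon: "size (mon N \<alpha>) = (\<Sum>i<N. \<alpha> i)"
  by (simp add: mon_def)

lemma count_staircase [simp]: "count (staircase N) j = N - Suc j"
  by (simp add: staircase_def)

lemma finite_pairs [simp]: "finite {(i, j). i < j \<and> j < (N :: nat)}"
  by (rule finite_subset[of _ "{..<N} \<times> {..<N}"]) auto

lemma alt_pscale: "alt N \<alpha> (pscale c f) = c * alt N \<alpha> f"
  by (simp add: alt_def)

lemma alt_sum: "alt N \<alpha> (sum f S) = (\<Sum>x\<in>S. alt N \<alpha> (f x))"
  by (simp add: alt_def sum_distrib_left)

lemma alt_diff: "alt N \<alpha> (f - g) = alt N \<alpha> f - alt N \<alpha> g"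
  by (simp add: alt_def right_diff_distrib)

subsection \<open>Antisymmetry\<close>

lemma pact_X:
  assumes "bij \<pi>" shows "pact \<pi> (X i) = X (inv \<pi> i)"
proof (rule pser_eqI)
  fix A
  have "image_mset \<pi> A = {#i#} \<longleftrightarrow> A = {#inv \<pi> i#}"
  proof
    assume "image_mset \<pi> A = {#i#}"
    then have "image_mset (inv \<pi>) (image_mset \<pi> A) = {#inv \<pi> i#}" by simp
    then show "A = {#inv \<pi> i#}" using assms by simp
  qed (use assms in \<open>simp add: bij_is_surj surj_f_inv_f\<close>)
  then show "coeff (pact \<pi> (X i)) A = coeff (X (inv \<pi> i)) A"
    by (simp add: coeff_X)
qed

text \<open>The adjacent transposition permutes the factors other than
  \<open>X r - X (Suc r)\<close>, keeping their index pairs increasing; that single factor changes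
  sign.\<close>

lemma pact_vdm:
  assumes "Suc r < N" shows "pact (transpose r (Suc r)) (vdm N) = - vdm N"
proof -
  define \<sigma> where "\<sigma> = transpose r (Suc r)"
  define P where "P = {(i, j). i < j \<and> j < N} - {(r, Suc r)}"
  have fin: "finite P" by (simp add: P_def)
  have split: "{(i, j). i < j \<and> j < N} = insert (r, Suc r) P"
    using assms by (auto simp: P_def)
  have \<sigma>: "bij \<sigma>" "inv \<sigma> = \<sigma>" by (simp_all add: \<sigma>_def)
  have \<sigma>\<sigma>: "\<sigma> (\<sigma> i) = i" for i by (simp add: \<sigma>_def)
  have mapP: "(\<sigma> i, \<sigma> j) \<in> P" if "(i, j) \<in> P" for i j
    using that assms unfolding P_def \<sigma>_def transpose_def by (auto split: if_splits)
  have P: "(\<Prod>(i, j)\<in>P. X (\<sigma> i) - X (\<sigma> j)) = (\<Prod>(i, j)\<in>P. X i - X j)"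
    by (rule prod.reindex_bij_witness[where i = "map_prod \<sigma> \<sigma>" and j = "map_prod \<sigma> \<sigma>"])
      (use mapP \<sigma>\<sigma> in \<open>auto\<close>)
  have "pact \<sigma> (vdm N) = (\<Prod>(i, j)\<in>insert (r, Suc r) P. X (\<sigma> i) - X (\<sigma> j))"
    unfolding vdm_def split using \<sigma> by (simp add: pact_prod pact_diff pact_X case_prod_unfold)
  also have "\<dots> = (X (Suc r) - X r) * (\<Prod>(i, j)\<in>P. X i - X j)"
    using fin by (subst prod.insert) (simp_all add: P, simp_all add: P_def \<sigma>_def)
  also have "\<dots> = - vdm N"
    unfolding vdm_def split using fin by (subst prod.insert) (auto simp: P_def algebra_simps)
  finally show ?thesis by (simp add: \<sigma>_def)
qed

lemma coeff_vdm_swap: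
  assumes "Suc r < N" "symf f"
  shows "coeff (vdm N * f) (image_mset (transpose r (Suc r)) A) = - coeff (vdm N * f) A"
proof -
  have "pact (transpose r (Suc r)) (vdm N * f) = - (vdm N * f)"
    using assms by (simp add: pact_mult pact_vdm symf_def)
  then show ?thesis by (metis coeff_pact uminus_pser.rep_eq)
qed

subsection \<open>The leading term\<close>

text \<open>Monomials are compared by \<open>\<Sum>i \<cdot> a\<^sub>i\<close>, which decreases strictly when exponents are moved to
  variables of smaller index.\<close>

definition leading :: "pser \<Rightarrow> nat multiset \<Rightarrow> bool" where
  "leading f A \<longleftrightarrow> coeff f A = 1 \<and> (\<forall>B. coeff f B \<noteq> 0 \<longrightarrow> B = A \<or> sum_mset A < sum_mset B)"

lemma leading_mult:
  assumes "leading f A" "leading g B" shows "leading (f * g) (A + B)"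
proof -
  have eq: "C = A \<and> D = B" if "C + D = A + B" "coeff f C \<noteq> 0" "coeff g D \<noteq> 0" for C D
  proof -
    have "sum_mset C + sum_mset D = sum_mset A + sum_mset B" using that(1) by (metis sum_mset.union)
    then show ?thesis using assms that unfolding leading_def by fastforce
  qed
  have "coeff (f * g) (A + B) =
      (\<Sum>C | C \<subseteq># A + B. if C = A then coeff f A * coeff g B else 0)"
    unfolding coeff_mult
  proof (rule sum.cong)
    fix C assume "C \<in> {C. C \<subseteq># A + B}"
    then show "coeff f C * coeff g (A + B - C) = (if C = A then coeff f A * coeff g B else 0)"
      using eq[of C "A + B - C"] by auto
  qed simp
  also have "\<dots> = 1" using assms by (simp add: leading_def)
  finally have "coeff (f * g) (A + B) = 1" .
  moreover have "C = A + B \<or> sum_mset (A + B) < sum_mset C" if "coeff (f * g) C \<noteq> 0" for C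
    using that
  proof (rule coeff_mult_nonzeroE)
    fix D E assume "C = D + E" "coeff f D \<noteq> 0" "coeff g E \<noteq> 0"
    then show ?thesis using assms unfolding leading_def by fastforce
  qed
  ultimately show ?thesis by (simp add: leading_def)
qed

lemma leading_prod:
  "finite S \<Longrightarrow> (\<And>x. x \<in> S \<Longrightarrow> leading (f x) (A x)) \<Longrightarrow> leading (prod f S) (sum A S)"
proof (induction S rule: finite_induct)
  case (insert x S)
  then show ?case by (simp add: leading_mult)
qed (simp add: leading_def)

text \<open>The factor \<open>X i - X j\<close> with \<open>i < j\<close> has leading monomial
  \<open>X i\<close>, and \<open>i\<close> is the smaller index of \<open>N - Suc i\<close>
  pairs.\<close>

lemma leading_vdm: "leading (vdm N) (staircase N)"
proof -
  have "leading (vdm N) (\<Sum>(i, j) \<in> {(i, j). i < j \<and> j < N}. {#i#})"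
    unfolding vdm_def by (rule leading_prod) (auto simp: leading_def coeff_X split: if_splits)
  moreover have "(\<Sum>(i, j) \<in> {(i, j). i < j \<and> j < N}. {#i#}) = staircase N"
  proof (rule multiset_eqI)
    fix k
    have "count (\<Sum>(i, j) \<in> {(i, j). i < j \<and> j < N}. {#i#}) k =
        (\<Sum>p\<in>{(i, j). i < j \<and> j < N}. if fst p = k then 1 else 0)"
      by (auto simp: count_sum case_prod_unfold intro!: sum.cong)
    also have "\<dots> = card {p \<in> {(i, j). i < j \<and> j < N}. fst p = k}"
      by (simp add: sum.inter_filter[symmetric])
    also have "{p \<in> {(i, j). i < j \<and> j < N}. fst p = k} = Pair k ` {k<..<N}"
      by auto
    finally show "count (\<Sum>(i, j) \<in> {(i, j). i < j \<and> j < N}. {#i#}) k = count (staircase N) k"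
      by (simp add: card_image inj_on_def)
  qed
  ultimately show ?thesis by simp
qed

lemma homogeneous_vdm: "homogeneous (size (staircase N)) (vdm N)"
proof -
  have h: "homogeneous (\<Sum>p\<in>{(i, j). i < j \<and> j < N}. 1) (vdm N)"
    unfolding vdm_def
    by (rule homogeneous_prod) (auto simp: homogeneous_def coeff_X split: if_splits)
  \<comment> \<open>The staircase occurs with a nonzero coefficient, which identifies the number of
    pairs with its size without counting.\<close>
  moreover have "coeff (vdm N) (staircase N) \<noteq> 0" using leading_vdm[of N] by (simp add: leading_def)
  ultimately show ?thesis unfolding homogeneous_def by metis
qed

subsection \<open>The Pieri rules\<close>

text \<open>The complete symmetric function at an alphabet whose variables selected by
  \<open>\<epsilon>\<close> are fermionic, as \<open>Phi_csym\<close> confirms.\<close>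

definition hsym :: "(nat \<Rightarrow> bool) \<Rightarrow> nat \<Rightarrow> pser" where
  "hsym \<epsilon> n = Pser (\<lambda>A. if size A = n \<and> (\<forall>i. \<epsilon> i \<longrightarrow> count A i \<le> 1) then 1 else 0)"

text \<open>For a constant sign these are the complete (\<open>b = False\<close>) and the elementary (\<open>b = True\<close>)
  symmetric functions.\<close>

abbreviation csym :: "bool \<Rightarrow> nat \<Rightarrow> pser" where
  "csym b \<equiv> hsym (\<lambda>_. b)"

lemma coeff_hsym:
  "coeff (hsym \<epsilon> n) A = (if size A = n \<and> (\<forall>i. \<epsilon> i \<longrightarrow> count A i \<le> 1) then 1 else 0)"
  by (simp add: hsym_def)

lemma hsym_0 [simp]: "hsym \<epsilon> 0 = 1"
  by (rule pser_eqI) (auto simp: coeff_hsym)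

lemma homogeneous_hsym: "homogeneous n (hsym \<epsilon> n)"
  by (simp add: homogeneous_def coeff_hsym)

lemma csym_Sym [simp, intro]: "csym b n \<in> Sym"
proof (rule SymI)
  show "symf (csym b n)"
  proof (rule symfI)
    fix \<pi> :: "nat \<Rightarrow> nat" and A assume \<pi>: "bij \<pi>"
    have "(\<forall>i. count (image_mset \<pi> A) i \<le> 1) \<longleftrightarrow> (\<forall>i. count A i \<le> 1)"
      using \<pi> by (metis bij_is_inj bij_is_surj count_image_mset_inj surj_f_inv_f)
    then show "coeff (csym b n) (image_mset \<pi> A) = coeff (csym b n) A"
      by (auto simp: coeff_hsym)
  qed
qed (rule homogeneous_bounded_by[OF homogeneous_hsym])

definition decreasing :: "(nat \<Rightarrow> nat) \<Rightarrow> bool" where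
  "decreasing \<alpha> \<longleftrightarrow> (\<forall>i. \<alpha> (Suc i) \<le> \<alpha> i)"

definition par :: "nat \<Rightarrow> (nat \<Rightarrow> nat) \<Rightarrow> bool" where
  "par N \<alpha> \<longleftrightarrow> decreasing \<alpha> \<and> (\<forall>i\<ge>N. \<alpha> i = 0)"

text \<open>Cells of the diagram are counted, rather than parts added, so that invariance under
  conjugation is a swap of coordinates.\<close>

definition weight :: "(nat \<Rightarrow> nat) \<Rightarrow> nat" where
  "weight \<alpha> = card {(i, j). j < \<alpha> i}"

text \<open>The \<mu> for which \<alpha>/\<mu> is a horizontal strip of size \<open>c\<close>.
  Interlacing makes \<mu> decreasing; for vertical strips this is demanded separately.\<close>

definition hstrip :: "(nat \<Rightarrow> nat) \<Rightarrow> nat \<Rightarrow> (nat \<Rightarrow> nat) set" where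
  "hstrip \<alpha> c = {\<mu>. (\<forall>i. \<alpha> (Suc i) \<le> \<mu> i \<and> \<mu> i \<le> \<alpha> i) \<and> weight \<mu> + c = weight \<alpha>}"

definition vstrip :: "(nat \<Rightarrow> nat) \<Rightarrow> nat \<Rightarrow> (nat \<Rightarrow> nat) set" where
  "vstrip \<alpha> c =
     {\<mu>. decreasing \<mu> \<and> (\<forall>i. \<mu> i \<le> \<alpha> i \<and> \<alpha> i \<le> Suc (\<mu> i)) \<and> weight \<mu> + c = weight \<alpha>}"

lemma weight_eq: assumes "\<forall>i\<ge>N. \<alpha> i = 0" shows "weight \<alpha> = (\<Sum>i<N. \<alpha> i)"
proof -
  have "{(i, j). j < \<alpha> i} = Sigma {..<N} (\<lambda>i. {..<\<alpha> i})"
    using assms by (auto simp: not_less[symmetric])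
  then show ?thesis by (simp add: weight_def)
qed

lemma size_shifted: "\<forall>i\<ge>N. \<alpha> i = 0 \<Longrightarrow> size (shifted N \<alpha>) = weight \<alpha> + size (staircase N)"
  by (simp add: size_mon weight_eq)

lemma hstrip_par: "par N \<alpha> \<Longrightarrow> \<mu> \<in> hstrip \<alpha> c \<Longrightarrow> par N \<mu>"
  unfolding par_def hstrip_def decreasing_def
  by simp (metis le_trans le_zero_eq)

lemma vstrip_par: "par N \<alpha> \<Longrightarrow> \<mu> \<in> vstrip \<alpha> c \<Longrightarrow> par N \<mu>"
  unfolding par_def vstrip_def
  by simp (metis le_zero_eq)

text \<open>Sign-reversing involution. Fixed points are allowed, since there
  \<open>g x = - g x\<close> forces \<open>g x = 0\<close>.\<close>

lemma sum_swap_zero: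
  fixes g :: "'a \<Rightarrow> rat"
  assumes "\<And>x. x \<in> S \<Longrightarrow> s x \<in> S \<and> s (s x) = x \<and> g (s x) = - g x"
  shows "sum g S = 0"
proof -
  have "sum g S = (\<Sum>x\<in>S. g (s x))"
    by (rule sum.reindex_bij_witness[where i = s and j = s]) (use assms in auto)
  also have "\<dots> = - sum g S" using assms by (simp add: sum_negf)
  finally show ?thesis by simp
qed

lemma image_mset_transpose_self [simp]:
  "image_mset (transpose a b) (image_mset (transpose a b) A) = A"
  by (simp add: multiset.map_comp)

lemma count_image_transpose: "count (image_mset (transpose a b) A) i = count A (transpose a b i)"
  using count_image_mset_inj[of "transpose a b" A "transpose a b i"] by simp

text \<open>The terms \<open>\<nu>\<close> with \<open>\<nu>\<^sub>r \<le> E\<^sub>r\<^sub>+\<^sub>1\<close> cancel in pairs under swapping the entries \<open>r\<close> and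
  \<open>r + 1\<close>.\<close>

lemma sum_box:
  fixes g :: "nat multiset \<Rightarrow> rat"
  assumes anti: "\<And>r \<nu>. Suc r < N \<Longrightarrow> g (image_mset (transpose r (Suc r)) \<nu>) = - g \<nu>"
    and E: "\<And>i. Suc i < N \<Longrightarrow> count E (Suc i) < count E i" and "r < N"
  shows "(\<Sum>\<nu> | \<nu> \<subseteq># E \<and> size \<nu> + c = size E. g \<nu>) =
    (\<Sum>\<nu> | \<nu> \<subseteq># E \<and> size \<nu> + c = size E \<and> (\<forall>i<r. count E (Suc i) < count \<nu> i). g \<nu>)"
  using \<open>r < N\<close>
proof (induction r)
  case (Suc r)
  let ?B = "\<lambda>r. {\<nu>. \<nu> \<subseteq># E \<and> size \<nu> + c = size E \<and> (\<forall>i<r. count E (Suc i) < count \<nu> i)}"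
  let ?S = "?B r \<inter> {\<nu>. count \<nu> r \<le> count E (Suc r)}"
  have "finite (?B r)" by (rule finite_subset[OF _ finite_submultisets[of E]]) auto
  moreover have "?B r = ?B (Suc r) \<union> ?S" by (auto simp: less_Suc_eq)
  moreover have "?B (Suc r) \<inter> ?S = {}" by auto
  ultimately have "sum g (?B r) = sum g (?B (Suc r)) + sum g ?S"
    by (metis (no_types, lifting) finite_Un sum.union_disjoint)
  moreover have "sum g ?S = 0"
  proof (rule sum_swap_zero[where s = "image_mset (transpose r (Suc r))"])
    fix \<nu> assume \<nu>: "\<nu> \<in> ?S"
    \<comment> \<open>Both exchanged entries are at most \<open>count E (Suc r)\<close>, which is
      less than \<open>count E r\<close>, so the swap stays in the box.\<close>
    have "image_mset (transpose r (Suc r)) \<nu> \<subseteq># E"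
      unfolding subseteq_mset_def
    proof
      fix i
      have "count \<nu> j \<le> count E j" for j using \<nu> by (simp add: subseteq_mset_def)
      moreover have "count E (Suc r) < count E r" using Suc.prems by (rule E)
      ultimately show "count (image_mset (transpose r (Suc r)) \<nu>) i \<le> count E i"
        using \<nu> le_trans[of "count \<nu> (Suc r)" "count E (Suc r)" "count E r"]
        unfolding count_image_transpose transpose_def by auto
    qed
    moreover have "count (image_mset (transpose r (Suc r)) \<nu>) i = count \<nu> i" if "i < r" for i
      using that unfolding count_image_transpose transpose_def by auto
    moreover have "count (image_mset (transpose r (Suc r)) \<nu>) r \<le> count E (Suc r)"
      using \<nu> unfolding count_image_transpose by (simp add: subseteq_mset_def)
    ultimately show "image_mset (transpose r (Suc r)) \<nu> \<in> ?S \<and>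
        image_mset (transpose r (Suc r)) (image_mset (transpose r (Suc r)) \<nu>) = \<nu> \<and>
        g (image_mset (transpose r (Suc r)) \<nu>) = - g \<nu>"
      using \<nu> anti[OF Suc.prems] by auto
  qed
  ultimately show ?case using Suc by simp
qed simp

lemma unshift:
  assumes "\<And>i. i \<ge> N \<Longrightarrow> count \<nu> i = 0" "\<And>i. i < N \<Longrightarrow> N - Suc i \<le> count \<nu> i"
  obtains \<mu> where "\<nu> = shifted N \<mu>" "\<forall>i\<ge>N. \<mu> i = 0"
proof
  show "\<nu> = shifted N (\<lambda>i. if i < N then count \<nu> i - (N - Suc i) else 0)"
  proof (rule multiset_eqI)
    fix i show "count \<nu> i = count (shifted N (\<lambda>i. if i < N then count \<nu> i - (N - Suc i) else 0)) i"
      using assms[of i] by (cases "i < N") simp_all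
  qed
qed simp

lemma shifted_inj:
  assumes "shifted N \<alpha> = shifted N \<mu>" "\<forall>i\<ge>N. \<alpha> i = 0" "\<forall>i\<ge>N. \<mu> i = 0" shows "\<alpha> = \<mu>"
proof
  fix i show "\<alpha> i = \<mu> i"
    using assms(2,3) arg_cong[OF assms(1), of "\<lambda>A. count A i"]
    by (cases "i < N") (simp_all del: add_right_cancel)
qed

lemma coeff_csym_mult:
  "coeff (csym b c * f) E =
    (\<Sum>\<nu> | \<nu> \<subseteq># E \<and> size \<nu> + c = size E \<and> (b \<longrightarrow> (\<forall>i. count E i \<le> Suc (count \<nu> i))). coeff f \<nu>)"
proof -
  have "coeff (csym b c * f) E = (\<Sum>\<nu> | \<nu> \<subseteq># E.
      if size \<nu> + c = size E \<and> (b \<longrightarrow> (\<forall>i. count E i \<le> Suc (count \<nu> i))) then coeff f \<nu> else 0)"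
    unfolding coeff_mult'
  proof (rule sum.cong)
    fix \<nu> assume \<nu>: "\<nu> \<in> {\<nu>. \<nu> \<subseteq># E}"
    then have "size \<nu> \<le> size E" by (simp add: size_mset_mono)
    then have "size (E - \<nu>) = c \<longleftrightarrow> size \<nu> + c = size E"
      using \<nu> by (simp add: size_Diff_submset) linarith
    moreover have "(\<forall>i. b \<longrightarrow> count (E - \<nu>) i \<le> 1) \<longleftrightarrow> (b \<longrightarrow> (\<forall>i. count E i \<le> Suc (count \<nu> i)))"
      by (simp add: le_diff_conv)
    ultimately show "coeff (csym b c) (E - \<nu>) * coeff f \<nu> =
        (if size \<nu> + c = size E \<and> (b \<longrightarrow> (\<forall>i. count E i \<le> Suc (count \<nu> i))) then coeff f \<nu> else 0)"
      by (cases b) (simp_all add: coeff_hsym)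
  qed simp
  also have "\<dots> = (\<Sum>\<nu> | \<nu> \<subseteq># E \<and> size \<nu> + c = size E \<and>
      (b \<longrightarrow> (\<forall>i. count E i \<le> Suc (count \<nu> i))). coeff f \<nu>)"
    by (rule sum.mono_neutral_cong_right) auto
  finally show ?thesis .
qed

lemma par_antimono: "par N \<alpha> \<Longrightarrow> i \<le> j \<Longrightarrow> \<alpha> j \<le> \<alpha> i"
  unfolding par_def decreasing_def by (metis lift_Suc_antimono_le)

lemma shifted_decreasing:
  "par N \<alpha> \<Longrightarrow> Suc i < N \<Longrightarrow> count (shifted N \<alpha>) (Suc i) < count (shifted N \<alpha>) i"
  using par_antimono[of N \<alpha> i "Suc i"] by auto

text \<open>Pieri rule in adjoint form. Expanding h_c lowers the exponents of \<alpha> + \<delta> in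
  all ways by \<open>c\<close> in total. As the product with the Vandermonde is antisymmetric,
  \<open>sum_box\<close> leaves only exponents that exceed the next entry of \<alpha> + \<delta>;
  after subtracting \<delta> this is interlacing.\<close>

lemma alt_h_mult:
  assumes f: "symf f" and \<alpha>: "par N \<alpha>"
  shows "alt N \<alpha> (csym False c * f) = (\<Sum>\<mu>\<in>hstrip \<alpha> c. alt N \<mu> f)"
proof -
  let ?E = "shifted N \<alpha>"
  let ?g = "\<lambda>\<nu>. coeff (vdm N * f) \<nu>"
  let ?B = "{\<nu>. \<nu> \<subseteq># ?E \<and> size \<nu> + c = size ?E \<and> (\<forall>i<N - 1. count ?E (Suc i) < count \<nu> i)}"
  have z: "\<forall>i\<ge>N. \<alpha> i = 0" using \<alpha> by (simp add: par_def)
  have "alt N \<alpha> (csym False c * f) = (\<Sum>\<nu> | \<nu> \<subseteq># ?E \<and> size \<nu> + c = size ?E. ?g \<nu>)"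
    unfolding alt_def mult.left_commute[of "vdm N"] coeff_csym_mult by simp
  also have "\<dots> = sum ?g ?B"
  proof (cases "N = 0")
    case False
    show ?thesis
      by (rule sum_box[where N = N])
        (use f False shifted_decreasing[OF \<alpha>] in \<open>auto simp: coeff_vdm_swap simp del: count_union\<close>)
  qed simp
  also have "\<dots> = (\<Sum>\<mu>\<in>hstrip \<alpha> c. alt N \<mu> f)"
    unfolding alt_def
  proof (rule sum.reindex_bij_betw[symmetric, of "shifted N" "hstrip \<alpha> c" ?B ?g])
    show "bij_betw (shifted N) (hstrip \<alpha> c) ?B"
    proof (rule bij_betwI')
      fix \<mu> \<mu>' assume "\<mu> \<in> hstrip \<alpha> c" "\<mu>' \<in> hstrip \<alpha> c"
      then show "(shifted N \<mu> = shifted N \<mu>') = (\<mu> = \<mu>')"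
        using shifted_inj hstrip_par[OF \<alpha>] unfolding par_def by blast
    next
      fix \<mu> assume \<mu>: "\<mu> \<in> hstrip \<alpha> c"
      then have z': "\<forall>i\<ge>N. \<mu> i = 0" using hstrip_par[OF \<alpha>] by (simp add: par_def)
      have "count ?E (Suc i) < count (shifted N \<mu>) i" if "i < N - 1" for i
      proof -
        have "\<alpha> (Suc i) \<le> \<mu> i" using \<mu> by (simp add: hstrip_def)
        moreover have "Suc i < N" using that by simp
        ultimately show ?thesis by simp
      qed
      moreover have "shifted N \<mu> \<subseteq># ?E"
        using \<mu> by (auto simp: subseteq_mset_def hstrip_def)
      moreover have "size (shifted N \<mu>) + c = size ?E"
        using \<mu> unfolding size_shifted[OF z] size_shifted[OF z'] by (simp add: hstrip_def)
      ultimately show "shifted N \<mu> \<in> ?B" by blast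
    next
      fix \<nu> assume \<nu>: "\<nu> \<in> ?B"
      have le: "count \<nu> i \<le> count ?E i" for i using \<nu> by (simp add: subseteq_mset_def del: count_union)
      have "\<forall>i<N - 1. count ?E (Suc i) < count \<nu> i" using \<nu> by blast
      then have int: "count ?E (Suc i) < count \<nu> i" if "Suc i < N" for i
        using that by (metis less_diff_conv add.commute plus_1_eq_Suc)
      obtain \<mu> where \<mu>: "\<nu> = shifted N \<mu>" "\<forall>i\<ge>N. \<mu> i = 0"
      proof (rule unshift)
        show "count \<nu> i = 0" if "i \<ge> N" for i using le[of i] that by simp
        show "N - Suc i \<le> count \<nu> i" if "i < N" for i
          using int[of i] that by (cases "Suc i < N") auto
      qed blast
      have "\<alpha> (Suc i) \<le> \<mu> i \<and> \<mu> i \<le> \<alpha> i" for i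
      proof -
        have "\<mu> i \<le> \<alpha> i" using le[of i] \<mu> by (cases "i < N") auto
        moreover have "\<alpha> (Suc i) \<le> \<mu> i"
          using int[of i] \<mu>(1) z by (cases "Suc i < N") auto
        ultimately show ?thesis by simp
      qed
      moreover have "weight \<mu> + c = weight \<alpha>"
        using \<nu> unfolding \<mu>(1) mem_Collect_eq size_shifted[OF z] size_shifted[OF \<mu>(2)] by simp
      ultimately show "\<exists>\<mu>\<in>hstrip \<alpha> c. \<nu> = shifted N \<mu>" using \<mu>(1) by (auto simp: hstrip_def)
    qed
  qed
  finally show ?thesis .
qed

text \<open>Each entry is lowered by at most one, so a sequence that fails to be strictly decreasing
  has two equal neighbours, and its coefficient vanishes by antisymmetry. Unlike in
  \<open>alt_h_mult\<close>, different terms do not have to cancel.\<close>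

lemma alt_e_mult:
  assumes f: "symf f" and \<alpha>: "par N \<alpha>"
  shows "alt N \<alpha> (csym True c * f) = (\<Sum>\<mu>\<in>vstrip \<alpha> c. alt N \<mu> f)"
proof -
  let ?E = "shifted N \<alpha>"
  let ?g = "\<lambda>\<nu>. coeff (vdm N * f) \<nu>"
  let ?B = "{\<nu>. \<nu> \<subseteq># ?E \<and> size \<nu> + c = size ?E \<and> (\<forall>i. count ?E i \<le> Suc (count \<nu> i))}"
  let ?C = "{\<nu> \<in> ?B. \<forall>i. Suc i < N \<longrightarrow> count \<nu> (Suc i) < count \<nu> i}"
  have z: "\<forall>i\<ge>N. \<alpha> i = 0" using \<alpha> by (simp add: par_def)
  have "alt N \<alpha> (csym True c * f) = sum ?g ?B"
    unfolding alt_def mult.left_commute[of "vdm N"] coeff_csym_mult by simp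
  also have "\<dots> = sum ?g ?C"
  proof (rule sum.mono_neutral_right)
    show "finite ?B" by (rule finite_subset[OF _ finite_submultisets[of ?E]]) auto
    show "\<forall>\<nu>\<in>?B - ?C. ?g \<nu> = 0"
    proof
      fix \<nu> assume \<nu>: "\<nu> \<in> ?B - ?C"
      then obtain i where i: "Suc i < N" "count \<nu> i \<le> count \<nu> (Suc i)" by auto
      have "count ?E i \<le> Suc (count \<nu> i)" "count \<nu> (Suc i) \<le> count ?E (Suc i)"
        using \<nu> by (auto simp: subseteq_mset_def simp del: count_union)
      then have eq: "count \<nu> i = count \<nu> (Suc i)"
        using i shifted_decreasing[OF \<alpha> i(1)] by linarith
      have "image_mset (transpose i (Suc i)) \<nu> = \<nu>"
        by (rule multiset_eqI) (auto simp: count_image_transpose transpose_def eq)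
      then show "?g \<nu> = 0" using coeff_vdm_swap[OF i(1) f, of \<nu>] by simp
    qed
  qed auto
  also have "\<dots> = (\<Sum>\<mu>\<in>vstrip \<alpha> c. alt N \<mu> f)"
    unfolding alt_def
  proof (rule sum.reindex_bij_betw[symmetric, of "shifted N" "vstrip \<alpha> c" ?C ?g])
    show "bij_betw (shifted N) (vstrip \<alpha> c) ?C"
    proof (rule bij_betwI')
      fix \<mu> \<mu>' assume "\<mu> \<in> vstrip \<alpha> c" "\<mu>' \<in> vstrip \<alpha> c"
      then show "(shifted N \<mu> = shifted N \<mu>') = (\<mu> = \<mu>')"
        using shifted_inj vstrip_par[OF \<alpha>] unfolding par_def by blast
    next
      fix \<mu> assume \<mu>: "\<mu> \<in> vstrip \<alpha> c"
      then have z': "\<forall>i\<ge>N. \<mu> i = 0" using vstrip_par[OF \<alpha>] by (simp add: par_def)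
      have "count (shifted N \<mu>) (Suc i) < count (shifted N \<mu>) i" if "Suc i < N" for i
        using that vstrip_par[OF \<alpha> \<mu>] by (intro shifted_decreasing)
      moreover have "shifted N \<mu> \<subseteq># ?E"
        using \<mu> by (auto simp: subseteq_mset_def vstrip_def)
      moreover have "count ?E i \<le> Suc (count (shifted N \<mu>) i)" for i
        using \<mu> by (auto simp: vstrip_def)
      moreover have "size (shifted N \<mu>) + c = size ?E"
        using \<mu> unfolding size_shifted[OF z] size_shifted[OF z'] by (simp add: vstrip_def)
      ultimately show "shifted N \<mu> \<in> ?C" by blast
    next
      fix \<nu> assume \<nu>: "\<nu> \<in> ?C"
      have le: "count \<nu> i \<le> count ?E i" "count ?E i \<le> Suc (count \<nu> i)" for i
        using \<nu> by (auto simp: subseteq_mset_def simp del: count_union)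
      have dec: "count \<nu> (Suc i) < count \<nu> i" if "Suc i < N" for i using \<nu> that by simp
      \<comment> \<open>A strictly decreasing sequence of length \<open>N\<close> lies above the
        staircase, so \<delta> can be subtracted.\<close>
      have st: "N - Suc i \<le> count \<nu> i" if "i < N" for i
        using that
      proof (induction "N - Suc i" arbitrary: i)
        case (Suc k)
        then have "N - Suc (Suc i) \<le> count \<nu> (Suc i)" "Suc i < N" by auto
        then show ?case using dec[of i] by linarith
      qed simp
      obtain \<mu> where \<mu>: "\<nu> = shifted N \<mu>" "\<forall>i\<ge>N. \<mu> i = 0"
      proof (rule unshift)
        show "count \<nu> i = 0" if "i \<ge> N" for i using le(1)[of i] that by simp
      qed (use st in blast)+
      have "\<mu> i \<le> \<alpha> i \<and> \<alpha> i \<le> Suc (\<mu> i)" for i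
        using le[of i] \<mu> z by (cases "i < N") auto
      moreover have "decreasing \<mu>"
        unfolding decreasing_def
      proof
        fix i show "\<mu> (Suc i) \<le> \<mu> i" using dec[of i] \<mu> by (cases "Suc i < N") auto
      qed
      moreover have "weight \<mu> + c = weight \<alpha>"
        using \<nu> unfolding \<mu>(1) mem_Collect_eq size_shifted[OF z] size_shifted[OF \<mu>(2)] by simp
      ultimately show "\<exists>\<mu>\<in>vstrip \<alpha> c. \<nu> = shifted N \<mu>" using \<mu>(1) by (auto simp: vstrip_def)
    qed
  qed
  finally show ?thesis .
qed

lemma alt_one:
  assumes "par N \<alpha>" shows "alt N \<alpha> 1 = (if weight \<alpha> = 0 then 1 else 0)"
proof -
  have z: "\<forall>i\<ge>N. \<alpha> i = 0" using assms by (simp add: par_def)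
  show ?thesis
  proof (cases "weight \<alpha> = 0")
    case True
    then have "mon N \<alpha> = {#}" using weight_eq[OF z] by (simp add: size_mon flip: size_eq_0_iff_empty)
    then show ?thesis using True leading_vdm[of N] by (simp add: alt_def leading_def)
  next
    case False
    then show ?thesis
      using homogeneous_vdm[of N] size_shifted[OF z] unfolding alt_def homogeneous_def by force
  qed
qed

section \<open>Schur functions as coefficient extractions\<close>

text \<open>The product \<open>h\<^sub>\<alpha>\<close> or \<open>e\<^sub>\<alpha>\<close>, where \<open>\<alpha>\<close> consists of the multiplicities of \<open>A\<close>.\<close>

definition csprod :: "bool \<Rightarrow> nat multiset \<Rightarrow> pser" where
  "csprod b A = (\<Prod>i\<in>set_mset A. csym b (count A i))"

lemma csprod_empty [simp]: "csprod b {#} = 1"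
  by (simp add: csprod_def)

lemma csprod_add_replicate:
  assumes "n \<notin># A" shows "csprod b (A + replicate_mset c n) = csym b c * csprod b A"
proof (cases "c = 0")
  case False
  have "csprod b (A + replicate_mset c n) =
      (\<Prod>i\<in>insert n (set_mset A). csym b (count (A + replicate_mset c n) i))"
    using False by (simp add: csprod_def)
  also have "\<dots> = csym b c * (\<Prod>i\<in>set_mset A. csym b (count (A + replicate_mset c n) i))"
    using assms by (subst prod.insert) (auto simp: not_in_iff)
  also have "(\<Prod>i\<in>set_mset A. csym b (count (A + replicate_mset c n) i)) = csprod b A"
    unfolding csprod_def by (rule prod.cong) (use assms in auto)
  finally show ?thesis .
qed simp

lemma csprod_Sym [simp, intro]: "csprod b A \<in> Sym"
  unfolding csprod_def by (intro Sym_prod) simp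

lemma csprod_symf [simp, intro]: "symf (csprod b A)"
  by (simp add: Sym_symf)

lemma csprod_image:
  assumes "bij \<pi>" shows "csprod b (image_mset \<pi> A) = csprod b A"
proof -
  have "inj \<pi>" using assms by (rule bij_is_inj)
  then show ?thesis unfolding csprod_def
    by (simp add: prod.reindex inj_on_subset count_image_mset_inj)
qed

lemma part_map [simp]:
  assumes "par N \<alpha>" shows "part (map \<alpha> [0..<N]) = \<alpha>"
  using assms by (auto simp: part_def par_def fun_eq_iff)

lemma finite_hstrip:
  assumes "par N \<alpha>" shows "finite (hstrip \<alpha> c)"
proof (rule inj_on_finite[of "mon N" _ "{B. B \<subseteq># mon N \<alpha>}"])
  show "inj_on (mon N) (hstrip \<alpha> c)"
    by (rule inj_onI, rule shifted_inj[of N])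
      (use hstrip_par[OF assms] in \<open>auto simp: par_def\<close>)
  show "mon N ` hstrip \<alpha> c \<subseteq> {B. B \<subseteq># mon N \<alpha>}"
    by (auto simp: subseteq_mset_def hstrip_def)
qed simp

section \<open>Branching rule for semistandard tableaux\<close>

definition tableaux :: "nat list \<Rightarrow> nat multiset \<Rightarrow> nat list list set" where
  "tableaux s A = {T. semistandard s T \<and> mset (concat T) = A}"

lemma coeff_schur: "coeff (schur s) A = of_nat (card (tableaux s A))"
  by (simp add: schur_def tableaux_def)

lemma semistandard_length: "semistandard s T \<Longrightarrow> length T = length s"
  unfolding semistandard_def by (metis length_map)

lemma semistandard_row_length: "semistandard s T \<Longrightarrow> i < length s \<Longrightarrow> length (T ! i) = s ! i"
  unfolding semistandard_def by (metis length_map nth_map)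

lemma mset_concat_nth: "mset (concat T) = (\<Sum>i<length T. mset (T ! i))"
  by (induction T) (simp_all add: sum.lessThan_Suc_shift del: sum.lessThan_Suc)

lemma size_tableau: "T \<in> tableaux s A \<Longrightarrow> size A = sum_list s"
  unfolding tableaux_def semistandard_def by (auto simp: length_concat)

lemma finite_tableaux [simp]: "finite (tableaux s A)"
proof (rule finite_subset)
  let ?R = "{xs. set xs \<subseteq> set_mset A \<and> length xs \<le> size A}"
  show "tableaux s A \<subseteq> {T. set T \<subseteq> ?R \<and> length T \<le> length s}"
  proof
    fix T assume T: "T \<in> tableaux s A"
    then have A: "mset (concat T) = A" by (simp add: tableaux_def)
    have "xs \<in> ?R" if "xs \<in> set T" for xs
    proof -
      obtain us vs where "T = us @ xs # vs" using \<open>xs \<in> set T\<close> by (meson split_list)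
      then show ?thesis using A by auto
    qed
    then show "T \<in> {T. set T \<subseteq> ?R \<and> length T \<le> length s}"
      using T semistandard_length[of s T] by (auto simp: tableaux_def)
  qed
  have "finite ?R" by (rule finite_lists_length_le) simp
  then show "finite {T. set T \<subseteq> ?R \<and> length T \<le> length s}" by (rule finite_lists_length_le)
qed

lemma sorted_split_last:
  assumes "sorted xs" "\<forall>x\<in>set xs. x \<le> (n :: nat)"
  shows "xs = filter (\<lambda>x. x < n) xs @ replicate (length xs - length (filter (\<lambda>x. x < n) xs)) n"
  using assms
proof (induction xs)
  case (Cons x xs)
  show ?case
  proof (cases "x < n")
    case True
    then show ?thesis using Cons by simp
  next
    case False
    then have x: "x = n" using Cons.prems by simp
    then have "\<forall>y\<in>set xs. y = n" using Cons.prems by (auto intro: antisym)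
    then have "filter (\<lambda>x. x < n) xs = []" "xs = replicate (length xs) n"
      by (auto simp: filter_empty_conv replicate_length_same)
    then show ?thesis using x by simp
  qed
qed simp

text \<open>Inverse to deleting all entries equal to the largest value \<open>n\<close>.\<close>

definition extend_tableau :: "nat \<Rightarrow> nat list \<Rightarrow> nat list list \<Rightarrow> nat list list" where
  "extend_tableau n s T = map (\<lambda>i. T ! i @ replicate (s ! i - length (T ! i)) n) [0..<length s]"

lemma extend_tableau_in:
  assumes \<alpha>: "par N \<alpha>" and \<mu>: "\<mu> \<in> hstrip \<alpha> c" and T: "T \<in> tableaux (map \<mu> [0..<N]) A"
    and A: "set_mset A \<subseteq> {..<n}"
  shows "extend_tableau n (map \<alpha> [0..<N]) T \<in> tableaux (map \<alpha> [0..<N]) (A + replicate_mset c n)"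
proof -
  have ss: "semistandard (map \<mu> [0..<N]) T" and cT: "mset (concat T) = A"
    using T by (auto simp: tableaux_def)
  have lenT: "length T = N" using semistandard_length[OF ss] by simp
  have rl: "length (T ! i) = \<mu> i" if "i < N" for i
    using semistandard_row_length[OF ss, of i] that by simp
  have le: "\<mu> i \<le> \<alpha> i" "\<alpha> (Suc i) \<le> \<mu> i" for i using \<mu> by (auto simp: hstrip_def)
  define T' where "T' = extend_tableau n (map \<alpha> [0..<N]) T"
  have T'i: "T' ! i = T ! i @ replicate (\<alpha> i - \<mu> i) n" if "i < N" for i
    using that rl by (simp add: T'_def extend_tableau_def)
  have lenT': "length T' = N" by (simp add: T'_def extend_tableau_def)
  have "set (concat T) = set_mset A" by (metis cT set_mset_mset)
  then have small: "x < n" if "i < N" "x \<in> set (T ! i)" for i x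
    using that lenT A by (metis UN_I lessThan_iff nth_mem set_concat subsetD)
  have "semistandard (map \<alpha> [0..<N]) T'"
    unfolding semistandard_def
  proof (intro conjI ballI allI impI)
    show "map length T' = map \<alpha> [0..<N]"
      by (rule nth_equalityI) (auto simp: lenT' T'i rl le)
    show "sorted row" if "row \<in> set T'" for row
    proof -
      obtain i where i: "i < N" "row = T' ! i" using \<open>row \<in> set T'\<close> lenT' by (metis in_set_conv_nth)
      have "sorted (T ! i)" using ss i lenT by (simp add: semistandard_def)
      then show ?thesis using i T'i small[OF i(1)]
        by (auto simp: sorted_append less_imp_le)
    qed
    fix i k assume ik: "Suc i < length T' \<and> k < length (T' ! Suc i)"
    then have i: "Suc i < N" "i < N" by (simp_all add: lenT')
    have k: "k < \<alpha> (Suc i)" using ik i T'i[of "Suc i"] rl[of "Suc i"] le(1)[of "Suc i"] by simp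
    \<comment> \<open>By interlacing, the cell above any cell of row \<open>Suc i\<close> belongs to
      \<mu>, so two copies of \<open>n\<close> never share a column.\<close>
    then have k': "k < \<mu> i" using le(2)[of i] by simp
    then have 1: "T' ! i ! k = T ! i ! k" using i T'i[of i] rl[of i] by (simp add: nth_append)
    show "T' ! i ! k < T' ! Suc i ! k"
    proof (cases "k < \<mu> (Suc i)")
      case True
      then have "T ! i ! k < T ! Suc i ! k"
        using ss i lenT rl[of "Suc i"] by (simp add: semistandard_def)
      then show ?thesis using 1 True i T'i[of "Suc i"] rl[of "Suc i"] by (simp add: nth_append)
    next
      case False
      then have "T' ! Suc i ! k = n" using k i T'i[of "Suc i"] rl[of "Suc i"] by (simp add: nth_append)
      then show ?thesis using 1 small[of i "T ! i ! k"] k' i rl[of i] by simp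
    qed
  qed
  moreover have "mset (concat T') = A + replicate_mset c n"
  proof -
    have "mset (concat T') = (\<Sum>i<N. mset (T ! i)) + (\<Sum>i<N. replicate_mset (\<alpha> i - \<mu> i) n)"
      by (simp add: mset_concat_nth lenT' T'i sum.distrib)
    also have "(\<Sum>i<N. mset (T ! i)) = A" using cT by (simp add: mset_concat_nth lenT)
    also have "(\<Sum>i<N. replicate_mset (\<alpha> i - \<mu> i) n) = replicate_mset c n"
    proof -
      have "(\<Sum>i<N. replicate_mset (\<alpha> i - \<mu> i) n) = replicate_mset (\<Sum>i<N. \<alpha> i - \<mu> i) n"
        by (rule multiset_eqI) (simp add: count_sum)
      moreover have "(\<Sum>i<N. \<alpha> i - \<mu> i) + (\<Sum>i<N. \<mu> i) = (\<Sum>i<N. \<alpha> i)"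
        by (simp add: sum.distrib[symmetric] le)
      moreover have "(\<Sum>i<N. \<mu> i) + c = (\<Sum>i<N. \<alpha> i)"
        using \<mu> \<alpha> hstrip_par[OF \<alpha> \<mu>] weight_eq[of N \<mu>] weight_eq[of N \<alpha>]
        by (simp add: hstrip_def par_def)
      ultimately show ?thesis by (metis add.commute add_left_cancel)
    qed
    finally show ?thesis .
  qed
  ultimately show ?thesis by (simp add: tableaux_def T'_def)
qed

lemma extend_tableau_surj:
  assumes \<alpha>: "par N \<alpha>" and T: "T \<in> tableaux (map \<alpha> [0..<N]) (A + replicate_mset c n)"
    and A: "set_mset A \<subseteq> {..<n}"
  obtains \<mu> T' where "\<mu> \<in> hstrip \<alpha> c" "T' \<in> tableaux (map \<mu> [0..<N]) A"
    "T = extend_tableau n (map \<alpha> [0..<N]) T'"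
proof -
  have ss: "semistandard (map \<alpha> [0..<N]) T" and cT: "mset (concat T) = A + replicate_mset c n"
    using T by (auto simp: tableaux_def)
  have lenT: "length T = N" using semistandard_length[OF ss] by simp
  have rl: "length (T ! i) = \<alpha> i" if "i < N" for i
    using semistandard_row_length[OF ss, of i] that by simp
  define T' where "T' = map (filter (\<lambda>x. x < n)) T"
  define \<mu> where "\<mu> = part (map length T')"
  have lenT': "length T' = N" by (simp add: T'_def lenT)
  have rl': "length (T' ! i) = \<mu> i" if "i < N" for i
    using that by (simp add: \<mu>_def part_def lenT')
  have \<mu>0: "\<mu> i = 0" if "i \<ge> N" for i using that by (simp add: \<mu>_def part_def lenT')
  have \<alpha>0: "\<alpha> i = 0" if "i \<ge> N" for i using that \<alpha> by (simp add: par_def)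
  have "set (concat T) \<subseteq> {..n}"
    using arg_cong[OF cT, of set_mset] A by (force split: if_splits)
  then have small: "\<forall>x\<in>set (T ! i). x \<le> n" if "i < N" for i
    using that lenT nth_mem[of i T] by (metis UN_I atMost_iff set_concat subsetD)
  have Ti: "T ! i = T' ! i @ replicate (\<alpha> i - \<mu> i) n" if "i < N" for i
    using sorted_split_last[of "T ! i" n] small that ss rl[OF that] rl'[OF that] lenT
    by (simp add: T'_def semistandard_def)
  have le: "\<mu> i \<le> \<alpha> i" for i
    using rl[of i] rl'[of i] \<mu>0[of i] Ti[of i] by (cases "i < N") auto
  \<comment> \<open>Otherwise the cell in column \<open>\<mu> i\<close> of row \<open>i\<close>
    holds the largest value \<open>n\<close>, and the entry below it would have to exceed
    \<open>n\<close>.\<close>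
  have int: "\<alpha> (Suc i) \<le> \<mu> i" for i
  proof (rule ccontr)
    assume "\<not> \<alpha> (Suc i) \<le> \<mu> i"
    then have k: "\<mu> i < \<alpha> (Suc i)" by simp
    then have i: "Suc i < N" using \<alpha>0[of "Suc i"] not_less[of "Suc i" N] by auto
    then have i: "Suc i < N" "i < N" by auto
    have "\<alpha> (Suc i) \<le> \<alpha> i" using \<alpha> by (simp add: par_def decreasing_def)
    then have "T ! i ! \<mu> i = n" using k i Ti[of i] rl'[of i] by (simp add: nth_append)
    moreover have "T ! i ! \<mu> i < T ! Suc i ! \<mu> i"
      using ss i k rl[of "Suc i"] lenT by (simp add: semistandard_def)
    moreover have "T ! Suc i ! \<mu> i \<le> n"
      using small[of "Suc i"] i k rl[of "Suc i"] by simp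
    ultimately show False by simp
  qed
  have cT': "mset (concat T') = A"
  proof -
    have "mset (concat T') = filter_mset (\<lambda>x. x < n) (mset (concat T))"
      unfolding T'_def by (simp add: filter_concat[symmetric])
    also have "\<dots> = A"
    proof (rule multiset_eqI)
      fix x
      have "count A x = 0" if "\<not> x < n" using A that unfolding count_eq_zero_iff by blast
      then show "count (filter_mset (\<lambda>x. x < n) (mset (concat T))) x = count A x"
        by (auto simp: cT)
    qed
    finally show ?thesis .
  qed
  have "semistandard (map \<mu> [0..<N]) T'"
    unfolding semistandard_def
  proof (intro conjI ballI allI impI)
    show "map length T' = map \<mu> [0..<N]"
      by (rule nth_equalityI) (auto simp: lenT' rl')
    show "sorted row" if "row \<in> set T'" for row
      using that ss by (auto simp: T'_def semistandard_def intro: sorted_wrt_filter)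
    fix i k assume ik: "Suc i < length T' \<and> k < length (T' ! Suc i)"
    then have i: "Suc i < N" "i < N" and k: "k < \<mu> (Suc i)" by (auto simp: lenT' rl')
    then have "T ! i ! k < T ! Suc i ! k"
      using ss rl[of "Suc i"] le[of "Suc i"] lenT by (simp add: semistandard_def)
    moreover have "k < \<mu> i" using k le[of "Suc i"] int[of i] by simp
    ultimately show "T' ! i ! k < T' ! Suc i ! k"
      using i k Ti[of i] Ti[of "Suc i"] rl'[of i] rl'[of "Suc i"] by (simp add: nth_append)
  qed
  then have T': "T' \<in> tableaux (map \<mu> [0..<N]) A" using cT' by (simp add: tableaux_def)
  have "weight \<mu> + c = weight \<alpha>"
    using size_tableau[OF T'] size_tableau[OF T] \<mu>0 \<alpha>0 weight_eq[of N \<mu>] weight_eq[of N \<alpha>]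
    by (simp add: sum_list_sum_nth atLeast0LessThan)
  then have "\<mu> \<in> hstrip \<alpha> c" using le int by (simp add: hstrip_def)
  moreover have "T = extend_tableau n (map \<alpha> [0..<N]) T'"
    by (rule nth_equalityI) (auto simp: extend_tableau_def lenT Ti rl')
  ultimately show ?thesis using T' that by blast
qed

text \<open>Deleting the largest entry removes a horizontal strip, and any horizontal strip can be
  filled with it. The recursion has the form of \<open>alt_h_mult\<close>.\<close>

lemma card_tableaux_rec:
  assumes \<alpha>: "par N \<alpha>" and A: "set_mset A \<subseteq> {..<n}"
  shows "card (tableaux (map \<alpha> [0..<N]) (A + replicate_mset c n)) =
    (\<Sum>\<mu>\<in>hstrip \<alpha> c. card (tableaux (map \<mu> [0..<N]) A))"
proof -
  let ?S = "SIGMA \<mu>:hstrip \<alpha> c. tableaux (map \<mu> [0..<N]) A"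
  let ?F = "\<lambda>(\<mu> :: nat \<Rightarrow> nat, T). extend_tableau n (map \<alpha> [0..<N]) T"
  have "bij_betw ?F ?S (tableaux (map \<alpha> [0..<N]) (A + replicate_mset c n))"
  proof (rule bij_betwI')
    fix x y assume "x \<in> ?S" "y \<in> ?S"
    then obtain \<mu> T \<nu> U where xy: "x = (\<mu>, T)" "y = (\<nu>, U)"
      and \<mu>: "\<mu> \<in> hstrip \<alpha> c" and T: "T \<in> tableaux (map \<mu> [0..<N]) A"
      and \<nu>: "\<nu> \<in> hstrip \<alpha> c" and U: "U \<in> tableaux (map \<nu> [0..<N]) A" by auto
    have rows: "map (filter (\<lambda>x. x < n)) (extend_tableau n (map \<alpha> [0..<N]) V) = V"
      if "V \<in> tableaux s A" "length s = N" for V s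
    proof (rule nth_equalityI)
      have len: "length V = N" using that semistandard_length[of s V] by (simp add: tableaux_def)
      then show "length (map (filter (\<lambda>x. x < n)) (extend_tableau n (map \<alpha> [0..<N]) V)) = length V"
        by (simp add: extend_tableau_def)
      fix i assume i: "i < length (map (filter (\<lambda>x. x < n)) (extend_tableau n (map \<alpha> [0..<N]) V))"
      then have "i < N" by (simp add: extend_tableau_def)
      moreover have "x < n" if "x \<in> set (V ! i)" for x
      proof -
        have "V ! i \<in> set V" using len \<open>i < N\<close> by simp
        then have "x \<in># mset (concat V)" using that unfolding set_mset_mset set_concat by (rule UN_I)
        moreover have "mset (concat V) = A" using \<open>V \<in> tableaux s A\<close> by (simp add: tableaux_def)
        ultimately have "x \<in># A" by (simp only:)
        then show ?thesis using A by blast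
      qed
      ultimately show "map (filter (\<lambda>x. x < n)) (extend_tableau n (map \<alpha> [0..<N]) V) ! i = V ! i"
        by (simp add: extend_tableau_def)
    qed
    show "(?F x = ?F y) = (x = y)"
    proof
      assume "?F x = ?F y"
      then have "extend_tableau n (map \<alpha> [0..<N]) T = extend_tableau n (map \<alpha> [0..<N]) U"
        by (simp add: xy)
      moreover have "map (filter (\<lambda>x. x < n)) (extend_tableau n (map \<alpha> [0..<N]) T) = T"
        by (rule rows[OF T]) simp
      moreover have "map (filter (\<lambda>x. x < n)) (extend_tableau n (map \<alpha> [0..<N]) U) = U"
        by (rule rows[OF U]) simp
      ultimately have TU: "T = U" by metis
      have "map \<mu> [0..<N] = map \<nu> [0..<N]"
        using T U unfolding TU tableaux_def semistandard_def mem_Collect_eq by metis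
      then have "\<mu> = \<nu>"
        using part_map[OF hstrip_par[OF \<alpha> \<mu>]] part_map[OF hstrip_par[OF \<alpha> \<nu>]] by metis
      then show "x = y" using TU xy by simp
    qed simp
  next
    fix x assume "x \<in> ?S"
    then obtain \<mu> T where "x = (\<mu>, T)" "\<mu> \<in> hstrip \<alpha> c" "T \<in> tableaux (map \<mu> [0..<N]) A"
      by blast
    then show "?F x \<in> tableaux (map \<alpha> [0..<N]) (A + replicate_mset c n)"
      using extend_tableau_in[OF \<alpha> _ _ A] by simp
  next
    fix T assume T: "T \<in> tableaux (map \<alpha> [0..<N]) (A + replicate_mset c n)"
    obtain \<mu> T' where "\<mu> \<in> hstrip \<alpha> c" "T' \<in> tableaux (map \<mu> [0..<N]) A"
      "T = extend_tableau n (map \<alpha> [0..<N]) T'"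
      by (rule extend_tableau_surj[OF \<alpha> T A])
    then show "\<exists>x\<in>?S. T = ?F x" by (intro bexI[of _ "(\<mu>, T')"]) simp_all
  qed
  then have "card ?S = card (tableaux (map \<alpha> [0..<N]) (A + replicate_mset c n))"
    by (rule bij_betw_same_card)
  then show ?thesis using finite_hstrip[OF \<alpha>] by simp
qed

lemma card_tableaux_empty:
  assumes "par N \<alpha>"
  shows "card (tableaux (map \<alpha> [0..<N]) {#}) = (if weight \<alpha> = 0 then 1 else 0)"
proof -
  have z: "\<forall>i\<ge>N. \<alpha> i = 0" using assms by (simp add: par_def)
  show ?thesis
  proof (cases "weight \<alpha> = 0")
    case True
    then have \<alpha>: "map \<alpha> [0..<N] = replicate N 0"
      unfolding weight_eq[OF z] by (intro nth_equalityI) auto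
    have "tableaux (map \<alpha> [0..<N]) {#} = {replicate N []}"
    proof
      show "tableaux (map \<alpha> [0..<N]) {#} \<subseteq> {replicate N []}"
      proof
        fix T assume "T \<in> tableaux (map \<alpha> [0..<N]) {#}"
        then have T: "semistandard (replicate N 0) T" by (simp add: tableaux_def \<alpha>)
        have "T = replicate N []"
          by (rule nth_equalityI)
            (use semistandard_length[OF T] semistandard_row_length[OF T] in auto)
        then show "T \<in> {replicate N []}" by simp
      qed
      show "{replicate N []} \<subseteq> tableaux (map \<alpha> [0..<N]) {#}"
        unfolding \<alpha> by (auto simp: tableaux_def semistandard_def concat_replicate_trivial)
    qed
    then show ?thesis using True by simp
  next
    case False
    have "tableaux (map \<alpha> [0..<N]) {#} = {}"
      using size_tableau[of _ "map \<alpha> [0..<N]" "{#}"] False weight_eq[OF z]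
      by (force simp: sum_list_sum_nth atLeast0LessThan)
    then show ?thesis using False by simp
  qed
qed

text \<open>Both sides are Kostka numbers: the Pieri rule on the left and the branching rule on the
  right are the same recursion over the largest variable index, with the same value at the empty
  monomial.\<close>

lemma alt_csprod_bounded:
  assumes "par N \<alpha>" "set_mset A \<subseteq> {..<n}"
  shows "alt N \<alpha> (csprod False A) = coeff (schur (map \<alpha> [0..<N])) A"
  using assms
proof (induction n arbitrary: A \<alpha>)
  case 0
  then show ?case by (simp add: alt_one coeff_schur card_tableaux_empty)
next
  case (Suc n)
  define c where "c = count A n"
  define A' where "A' = filter_mset (\<lambda>i. i \<noteq> n) A"
  have A: "A = A' + replicate_mset c n"
    by (rule multiset_eqI) (simp add: A'_def c_def)
  have A': "set_mset A' \<subseteq> {..<n}" using Suc.prems by (auto simp: A'_def)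
  have "n \<notin># A'" by (simp add: A'_def)
  then have "alt N \<alpha> (csprod False A) = (\<Sum>\<mu>\<in>hstrip \<alpha> c. alt N \<mu> (csprod False A'))"
    unfolding A using Suc.prems by (simp add: csprod_add_replicate alt_h_mult)
  also have "\<dots> = (\<Sum>\<mu>\<in>hstrip \<alpha> c. coeff (schur (map \<mu> [0..<N])) A')"
    using Suc hstrip_par A' by (intro sum.cong refl) blast
  also have "\<dots> = coeff (schur (map \<alpha> [0..<N])) A"
    unfolding A coeff_schur card_tableaux_rec[OF Suc.prems(1) A'] by simp
  finally show ?case .
qed

lemma alt_csprod:
  assumes "par N \<alpha>"
  shows "alt N \<alpha> (csprod False A) = coeff (schur (map \<alpha> [0..<N])) A"
proof -
  have "set_mset A \<subseteq> {..<Suc (\<Sum>i\<in>#A. i)}"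
    using sum_mset.remove by (fastforce simp: less_Suc_eq_le)
  then show ?thesis by (rule alt_csprod_bounded[OF assms])
qed

lemma partition_par:
  assumes "is_partition \<alpha>" shows "par (length \<alpha>) (part \<alpha>)"
  using assms unfolding par_def decreasing_def is_partition_def part_def
  by (auto simp: sorted_wrt_iff_nth_less)

lemma map_part [simp]: "map (part \<alpha>) [0..<length \<alpha>] = \<alpha>"
  by (rule nth_equalityI) (simp_all add: part_def)

lemma alt_csprod_partition:
  "is_partition \<alpha> \<Longrightarrow> alt (length \<alpha>) (part \<alpha>) (csprod False A) = coeff (schur \<alpha>) A"
  using alt_csprod[OF partition_par, of \<alpha> A] by simp

lemma homogeneous_schur: "homogeneous (sum_list \<alpha>) (schur \<alpha>)"
  unfolding homogeneous_def coeff_schur using size_tableau by (fastforce simp: card_gt_0_iff)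

text \<open>Coefficients of Schur functions are extractions from h_A, and h_A depends only on the
  multiset of exponents in \<open>A\<close>; this replaces an involution on tableaux.\<close>

lemma schur_Sym [simp, intro]:
  assumes "is_partition \<alpha>" shows "schur \<alpha> \<in> Sym"
proof (rule SymI)
  show "symf (schur \<alpha>)"
    by (rule symfI) (simp add: alt_csprod_partition[OF assms, symmetric] csprod_image)
qed (rule homogeneous_bounded_by[OF homogeneous_schur])

section \<open>Orthonormality of the Schur functions\<close>

subsection \<open>Matrices with prescribed row and column sums\<close>

text \<open>A matrix is encoded as the multiset of its positions, with multiplicities as entries.\<close>

definition matrices :: "bool \<Rightarrow> nat multiset \<Rightarrow> nat multiset \<Rightarrow> (nat \<times> nat) multiset set" where
  "matrices b A C =
     {R. image_mset fst R = A \<and> image_mset snd R = C \<and> (b \<longrightarrow> (\<forall>p. count R p \<le> 1))}"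

lemma finite_matrices [simp]: "finite (matrices b A C)"
proof (rule finite_subset)
  let ?L = "{xs. set xs \<subseteq> set_mset A \<times> set_mset C \<and> length xs \<le> size A}"
  show "matrices b A C \<subseteq> mset ` ?L"
  proof
    fix R assume R: "R \<in> matrices b A C"
    obtain xs where xs: "mset xs = R" using ex_mset by blast
    have "set xs \<subseteq> set_mset A \<times> set_mset C"
    proof
      fix p assume "p \<in> set xs"
      then have "p \<in># R" using xs by auto
      then show "p \<in> set_mset A \<times> set_mset C" using R by (force simp: matrices_def mem_Times_iff)
    qed
    moreover have "length xs \<le> size A" using R xs by (auto simp: matrices_def)
    ultimately show "R \<in> mset ` ?L" using xs by blast
  qed
  have "finite ?L" by (rule finite_lists_length_le) simp
  then show "finite (mset ` ?L)" by simp
qed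

lemma card_matrices_swap: "card (matrices b A C) = card (matrices b C A)"
proof (rule bij_betw_same_card, rule bij_betw_byWitness)
  have inj: "inj (prod.swap :: nat \<times> nat \<Rightarrow> nat \<times> nat)" by simp
  have "count (image_mset prod.swap R) p = count R (prod.swap p)" for R :: "(nat \<times> nat) multiset" and p
    using count_image_mset_inj[OF inj, of R "prod.swap p"] by simp
  then show "image_mset prod.swap ` matrices b A C \<subseteq> matrices b C A"
    "image_mset prod.swap ` matrices b C A \<subseteq> matrices b A C"
    by (auto simp: matrices_def multiset.map_comp fst_swap snd_swap o_def)
qed (simp_all add: multiset.map_comp)

text \<open>Row \<open>n\<close> is split off; \<open>B\<close> lists its column indices.\<close>

lemma card_matrices_rec:
  assumes n: "n \<notin># A"
  shows "card (matrices b (A + replicate_mset c n) C) =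
    (\<Sum>B | B \<subseteq># C \<and> size B = c \<and> (b \<longrightarrow> (\<forall>i. count B i \<le> 1)). card (matrices b A (C - B)))"
proof -
  let ?I = "{B. B \<subseteq># C \<and> size B = c \<and> (b \<longrightarrow> (\<forall>i. count B i \<le> 1))}"
  let ?F = "\<lambda>(B, R). R + image_mset (Pair n) B"
  have fin: "finite ?I" by (rule finite_subset[OF _ finite_submultisets[of C]]) auto
  have row: "count R (n, j) = 0" if "R \<in> matrices b A D" for R D j
  proof (rule ccontr)
    assume "count R (n, j) \<noteq> 0"
    then have "n \<in># image_mset fst R" by force
    moreover have "image_mset fst R = A" using that unfolding matrices_def by blast
    ultimately show False using n by (simp only:)
  qed
  have cn: "count (image_mset (Pair n) B) (n, j) = count B j" for B :: "nat multiset" and j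
    by (rule count_image_mset_inj) (simp add: inj_on_def)
  have cn': "count (image_mset (Pair n) B) (i, j) = 0" if "i \<noteq> n" for B :: "nat multiset" and i j
    using that by (induction B) auto
  have "bij_betw ?F (SIGMA B:?I. matrices b A (C - B)) (matrices b (A + replicate_mset c n) C)"
  proof (rule bij_betwI')
    fix x y assume "x \<in> (SIGMA B:?I. matrices b A (C - B))" "y \<in> (SIGMA B:?I. matrices b A (C - B))"
    then obtain B R D S where xy: "x = (B, R)" "y = (D, S)"
      and R: "R \<in> matrices b A (C - B)" and S: "S \<in> matrices b A (C - D)" by auto
    show "(?F x = ?F y) = (x = y)"
    proof
      assume eq: "?F x = ?F y"
      have "count B j = count D j" for j
        using arg_cong[OF eq, of "\<lambda>Q. count Q (n, j)"] by (simp add: xy row[OF R] row[OF S] cn)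
      then have "B = D" by (rule multiset_eqI)
      then show "x = y" using eq by (simp add: xy)
    qed simp
  next
    fix x assume "x \<in> (SIGMA B:?I. matrices b A (C - B))"
    then obtain B R where x: "x = (B, R)" and B: "B \<in> ?I" and R: "R \<in> matrices b A (C - B)" by auto
    have "image_mset fst (R + image_mset (Pair n) B) = A + replicate_mset c n"
      using R B by (simp add: matrices_def multiset.map_comp o_def image_mset_const_eq)
    moreover have "image_mset snd (R + image_mset (Pair n) B) = C"
      using R B by (simp add: matrices_def multiset.map_comp o_def)
    moreover have "count (R + image_mset (Pair n) B) p \<le> 1" if b for p
    proof (cases "fst p = n")
      case True
      then show ?thesis using that B row[OF R, of "snd p"] cn[of B "snd p"] by (cases p) auto
    next
      case False
      then show ?thesis using that R cn'[of "fst p" B "snd p"] by (cases p) (auto simp: matrices_def)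
    qed
    ultimately show "?F x \<in> matrices b (A + replicate_mset c n) C"
      by (simp add: matrices_def x)
  next
    fix Q assume Q: "Q \<in> matrices b (A + replicate_mset c n) C"
    define Q1 where "Q1 = filter_mset (\<lambda>p. fst p = n) Q"
    define R where "R = filter_mset (\<lambda>p. fst p \<noteq> n) Q"
    define B where "B = image_mset snd Q1"
    have "image_mset (Pair n) B = image_mset (\<lambda>p. p) Q1"
      unfolding B_def multiset.map_comp by (rule image_mset_cong) (auto simp: Q1_def)
    then have Q1: "Q1 = image_mset (Pair n) B" by simp
    have QR: "Q = R + image_mset (Pair n) B" unfolding Q1[symmetric] Q1_def R_def
      by (rule multiset_eqI) simp
    have fstR: "image_mset fst R = filter_mset (\<lambda>i. i \<noteq> n) (image_mset fst Q)"
      unfolding R_def by (simp add: filter_mset_image_mset)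
    have "filter_mset (\<lambda>i. i \<noteq> n) (A + replicate_mset c n) = A"
      by (rule multiset_eqI) (use n in \<open>auto simp: count_eq_zero_iff\<close>)
    then have "image_mset fst R = A"
      using Q unfolding fstR by (simp add: matrices_def)
    moreover have "size B = c"
    proof -
      have "size A + c = size Q" using Q by (simp add: matrices_def) (metis size_image_mset size_union size_replicate_mset)
      moreover have "size Q = size R + size B" by (simp add: QR)
      moreover have "size R = size A" using \<open>image_mset fst R = A\<close> by (metis size_image_mset)
      ultimately show ?thesis by simp
    qed
    moreover have CB: "C = image_mset snd R + B"
      using Q QR by (simp add: matrices_def multiset.map_comp o_def)
    moreover have "count R p \<le> 1" "count B i \<le> 1" if b for p i
    proof -
      have Q': "count Q p \<le> 1" for p using Q that unfolding matrices_def by blast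
      show "count R p \<le> 1" using Q'[of p] by (simp add: R_def)
      show "count B i \<le> 1" using Q'[of "(n, i)"] cn[of B i] by (simp add: QR)
    qed
    ultimately have "(B, R) \<in> (SIGMA B:?I. matrices b A (C - B))"
      by (auto simp: matrices_def)
    then show "\<exists>x\<in>SIGMA B:?I. matrices b A (C - B). Q = ?F x"
      using QR by (intro bexI[of _ "(B, R)"]) simp_all
  qed
  then have "card (SIGMA B:?I. matrices b A (C - B)) = card (matrices b (A + replicate_mset c n) C)"
    by (rule bij_betw_same_card)
  then show ?thesis using fin by simp
qed

text \<open>Each factor supplies one row of the matrix: row sums are the exponents in
  \<open>A\<close>, column sums those in \<open>C\<close>, and elementary factors bound the entries
  by one.\<close>

lemma coeff_csprod_bounded:
  "set_mset A \<subseteq> {..<n} \<Longrightarrow> coeff (csprod b A) C = of_nat (card (matrices b A C))"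
proof (induction n arbitrary: A C)
  case 0
  then have "A = {#}" by simp
  moreover have "matrices b {#} C = (if C = {#} then {{#}} else {})" by (auto simp: matrices_def)
  ultimately show ?case by simp
next
  case (Suc n)
  define c where "c = count A n"
  define A' where "A' = filter_mset (\<lambda>i. i \<noteq> n) A"
  have A: "A = A' + replicate_mset c n"
    by (rule multiset_eqI) (simp add: A'_def c_def)
  have A': "set_mset A' \<subseteq> {..<n}" using Suc.prems by (auto simp: A'_def)
  have n: "n \<notin># A'" by (simp add: A'_def)
  have "coeff (csprod b A) C = (\<Sum>B | B \<subseteq># C. coeff (csym b c) B * of_nat (card (matrices b A' (C - B))))"
    unfolding A csprod_add_replicate[OF n] coeff_mult Suc.IH[OF A'] ..
  also have "\<dots> = (\<Sum>B | B \<subseteq># C \<and> size B = c \<and> (b \<longrightarrow> (\<forall>i. count B i \<le> 1)).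
      of_nat (card (matrices b A' (C - B))))"
    by (rule sum.mono_neutral_cong_right) (auto simp: coeff_hsym)
  also have "\<dots> = of_nat (card (matrices b A C))"
    unfolding A card_matrices_rec[OF n] by simp
  finally show ?case .
qed

lemma coeff_csprod: "coeff (csprod b A) C = of_nat (card (matrices b A C))"
proof -
  have "set_mset A \<subseteq> {..<Suc (\<Sum>i\<in>#A. i)}"
    using sum_mset.remove by (fastforce simp: less_Suc_eq_le)
  then show ?thesis by (rule coeff_csprod_bounded)
qed

lemma coeff_csprod_commute: "coeff (csprod b A) C = coeff (csprod b C) A"
  by (simp add: coeff_csprod card_matrices_swap)

text \<open>The symmetry \<open>coeff_csprod_commute\<close> turns a formula that extracts each
  coefficient of \<open>f\<close> from h_A (or e_A) into an expansion of \<open>f\<close> itself in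
  such products.\<close>

lemma csprod_expansion:
  assumes "\<And>A. coeff f A = coeff (g * csprod b A) E"
  shows "f = (\<Sum>B | B \<subseteq># E. pscale (coeff g B) (csprod b (E - B)))"
  by (rule pser_eqI) (simp add: assms coeff_mult coeff_csprod_commute[of b _ "E - _"])

subsection \<open>Schur functions\<close>

text \<open>Exactly as many variables as parts; \<open>sc_eq_alt\<close> later allows any larger
  number.\<close>

definition sc :: "pser \<Rightarrow> nat list \<Rightarrow> rat" where
  "sc f \<alpha> = alt (length \<alpha>) (part \<alpha>) f"

lemma sc_diff: "sc (f - g) \<alpha> = sc f \<alpha> - sc g \<alpha>"
  by (simp add: sc_def alt_diff)

lemma sc_pscale: "sc (pscale c f) \<alpha> = c * sc f \<alpha>"
  by (simp add: sc_def alt_pscale)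

lemma sc_sum: "sc (sum f S) \<alpha> = (\<Sum>x\<in>S. sc (f x) \<alpha>)"
  by (simp add: sc_def alt_sum)

abbreviation plist :: "nat list \<Rightarrow> nat multiset" where
  "plist \<alpha> \<equiv> mon (length \<alpha>) (part \<alpha>)"

text \<open>The Jacobi-Trudi determinant, kept as a sum over the monomials of the Vandermonde
  product.\<close>

lemma jacobi_trudi:
  assumes "is_partition \<alpha>"
  shows "schur \<alpha> = (\<Sum>B | B \<subseteq># shifted (length \<alpha>) (part \<alpha>).
    pscale (coeff (vdm (length \<alpha>)) B) (csprod False (shifted (length \<alpha>) (part \<alpha>) - B)))"
  by (rule csprod_expansion) (simp add: alt_csprod_partition[OF assms, symmetric] alt_def)

text \<open>By \<open>jacobi_trudi\<close>, both sides are the same sum over two Vandermonde products. The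
  coefficients are triangular, so this symmetry makes them diagonal.\<close>

lemma sc_schur_commute:
  assumes \<alpha>: "is_partition \<alpha>" and \<beta>: "is_partition \<beta>"
  shows "sc (schur \<beta>) \<alpha> = sc (schur \<alpha>) \<beta>"
proof -
  let ?E = "shifted (length \<alpha>) (part \<alpha>)"
  have "sc (schur \<beta>) \<alpha> = (\<Sum>B | B \<subseteq># ?E. coeff (vdm (length \<alpha>)) B * coeff (schur \<beta>) (?E - B))"
    by (simp add: sc_def alt_def coeff_mult)
  also have "\<dots> = (\<Sum>B | B \<subseteq># ?E. coeff (vdm (length \<alpha>)) B * sc (csprod False (?E - B)) \<beta>)"
    by (simp add: alt_csprod_partition[OF \<beta>, symmetric] sc_def)
  also have "\<dots> = sc (schur \<alpha>) \<beta>"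
    unfolding jacobi_trudi[OF \<alpha>] by (simp add: sc_sum sc_pscale)
  finally show ?thesis .
qed

lemma sum_mset_lower:
  assumes "\<forall>x\<in>#M. (i :: nat) \<le> x"
  shows "i * size M \<le> sum_mset M" "sum_mset M = i * size M \<Longrightarrow> M = replicate_mset (size M) i"
proof -
  have "i * size M \<le> sum_mset M \<and> (sum_mset M = i * size M \<longrightarrow> M = replicate_mset (size M) i)"
    using assms by (induction M) auto
  then show "i * size M \<le> sum_mset M"
    "sum_mset M = i * size M \<Longrightarrow> M = replicate_mset (size M) i" by auto
qed

lemma sum_mset_sum: "sum_mset (\<Sum>i<N. f i) = (\<Sum>i<N. sum_mset (f i))" for f :: "nat \<Rightarrow> nat multiset"
  by (induction N) auto

lemma tableau_entry_ge:
  assumes T: "semistandard \<alpha> T" and \<alpha>: "is_partition \<alpha>"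
  shows "i < length \<alpha> \<Longrightarrow> k < \<alpha> ! i \<Longrightarrow> i \<le> T ! i ! k"
proof (induction i)
  case (Suc i)
  have "\<alpha> ! Suc i \<le> \<alpha> ! i"
    using \<alpha> Suc.prems by (auto simp: is_partition_def sorted_wrt_iff_nth_less)
  then have "i \<le> T ! i ! k" using Suc by simp
  moreover have "T ! i ! k < T ! Suc i ! k"
    using T Suc.prems semistandard_length[OF T] semistandard_row_length[OF T, of "Suc i"]
    by (simp add: semistandard_def)
  ultimately show ?case by simp
qed simp

lemma sum_mset_mon: "sum_mset (mon N \<alpha>) = (\<Sum>i<N. i * \<alpha> i)"
  by (induction N) (simp_all add: mon_def)

text \<open>Columns increase strictly, so row \<open>i\<close> has entries at least
  \<open>i\<close>. The sum of all entries is least for the tableau whose row \<open>i\<close> is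
  constantly \<open>i\<close>, and only for it.\<close>

lemma leading_schur:
  assumes \<alpha>: "is_partition \<alpha>"
  shows "leading (schur \<alpha>) (plist \<alpha>)"
proof -
  let ?N = "length \<alpha>"
  let ?T = "map (\<lambda>i. replicate (\<alpha> ! i) i) [0..<?N]"
  have ineq: "sum_mset (plist \<alpha>) \<le> sum_mset A \<and> (sum_mset A = sum_mset (plist \<alpha>) \<longrightarrow> T = ?T)"
    if T: "T \<in> tableaux \<alpha> A" for T A
  proof -
    have ss: "semistandard \<alpha> T" and A: "mset (concat T) = A" using T by (auto simp: tableaux_def)
    have len: "length T = ?N" by (rule semistandard_length[OF ss])
    have row: "length (T ! i) = \<alpha> ! i" if "i < ?N" for i by (rule semistandard_row_length[OF ss that])
    have ge: "\<forall>x\<in>#mset (T ! i). i \<le> x" if "i < ?N" for i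
      using tableau_entry_ge[OF ss \<alpha> that] row[OF that] by (auto simp: in_set_conv_nth)
    have low: "i * \<alpha> ! i \<le> sum_mset (mset (T ! i))" if "i < ?N" for i
      using sum_mset_lower(1)[OF ge[OF that]] row[OF that] by simp
    have sA: "sum_mset A = (\<Sum>i<?N. sum_mset (mset (T ! i)))"
      unfolding A[symmetric] mset_concat_nth len by (rule sum_mset_sum)
    have sp: "sum_mset (plist \<alpha>) = (\<Sum>i<?N. i * \<alpha> ! i)"
      unfolding sum_mset_mon by (simp add: part_def)
    have "T = ?T" if eq: "sum_mset A = sum_mset (plist \<alpha>)"
    proof (rule nth_equalityI)
      fix i assume "i < length T"
      then have i: "i < ?N" by (simp add: len)
      have "sum_mset (mset (T ! i)) = i * \<alpha> ! i"
      proof (rule ccontr)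
        assume "sum_mset (mset (T ! i)) \<noteq> i * \<alpha> ! i"
        then have "i * \<alpha> ! i < sum_mset (mset (T ! i))" using low[OF i] by simp
        then have "(\<Sum>i<?N. i * \<alpha> ! i) < (\<Sum>i<?N. sum_mset (mset (T ! i)))"
          by (intro sum_strict_mono_ex1) (use low i in auto)
        then show False using eq sA sp by simp
      qed
      then have "mset (T ! i) = replicate_mset (\<alpha> ! i) i"
        using sum_mset_lower(2)[OF ge[OF i]] row[OF i] by simp
      then have "set (T ! i) \<subseteq> {i}"
        by (metis set_mset_mset set_mset_replicate_mset_subset empty_subsetI subset_refl)
      then have "T ! i = replicate (\<alpha> ! i) i"
        using row[OF i] by (metis replicate_length_same singletonD subsetD)
      then show "T ! i = ?T ! i" using i by simp
    qed (simp add: len)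
    moreover have "sum_mset (plist \<alpha>) \<le> sum_mset A"
      unfolding sA sp by (rule sum_mono) (use low in simp)
    ultimately show ?thesis by blast
  qed
  have "mset (concat ?T) = plist \<alpha>"
    by (simp add: mset_concat_nth mon_def part_def)
  moreover have "semistandard \<alpha> ?T"
  proof -
    have "?T ! i ! k < ?T ! Suc i ! k" if "Suc i < ?N" "k < \<alpha> ! Suc i" for i k
    proof -
      have "\<alpha> ! Suc i \<le> \<alpha> ! i"
        using \<alpha> that by (auto simp: is_partition_def sorted_wrt_iff_nth_less)
      then show ?thesis using that by simp
    qed
    then show ?thesis by (auto simp: semistandard_def intro!: nth_equalityI)
  qed
  ultimately have T: "?T \<in> tableaux \<alpha> (plist \<alpha>)" by (simp add: tableaux_def)
  then have "tableaux \<alpha> (plist \<alpha>) = {?T}" using ineq by blast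
  then have "coeff (schur \<alpha>) (plist \<alpha>) = 1" by (simp add: coeff_schur)
  moreover have "B = plist \<alpha> \<or> sum_mset (plist \<alpha>) < sum_mset B" if "coeff (schur \<alpha>) B \<noteq> 0" for B
  proof -
    from that obtain T' where T': "T' \<in> tableaux \<alpha> B"
      unfolding coeff_schur by (metis card.empty equals0I of_nat_0)
    show ?thesis
    proof (cases "sum_mset B = sum_mset (plist \<alpha>)")
      case True
      then have "T' = ?T" using ineq[OF T'] by simp
      then show ?thesis using T' T by (simp add: tableaux_def)
    next
      case False
      then show ?thesis using ineq[OF T'] by simp
    qed
  qed
  ultimately show ?thesis by (simp add: leading_def)
qed

lemma part_inj:
  assumes "is_partition \<alpha>" "is_partition \<beta>" "part \<alpha> = part \<beta>" shows "\<alpha> = \<beta>"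
proof -
  have "i < length \<gamma> \<longleftrightarrow> part \<gamma> i \<noteq> 0" if "is_partition \<gamma>" for \<gamma> i
    using that unfolding is_partition_def part_def by (metis nth_mem)
  then have "i < length \<alpha> \<longleftrightarrow> i < length \<beta>" for i using assms by simp
  then have "length \<alpha> = length \<beta>" by (metis linorder_neqE_nat order_less_irrefl)
  then show ?thesis
    using map_part[of \<alpha>] map_part[of \<beta>] assms(3) by metis
qed

lemma plist_inj:
  assumes "is_partition \<alpha>" "is_partition \<beta>" "plist \<alpha> = plist \<beta>" shows "\<alpha> = \<beta>"
proof (rule part_inj[OF assms(1,2)], rule ext)
  fix i show "part \<alpha> i = part \<beta> i"
    using arg_cong[OF assms(3), of "\<lambda>A. count A i"] by (simp add: part_def split: if_splits)
qed

lemma sc_schur: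
  assumes \<alpha>: "is_partition \<alpha>" and \<beta>: "is_partition \<beta>"
  shows "sc (schur \<beta>) \<alpha> = (if \<alpha> = \<beta> then 1 else 0)"
proof -
  have L: "leading (vdm N * schur \<gamma>) (staircase N + plist \<gamma>)" if "is_partition \<gamma>" for N \<gamma>
    by (rule leading_mult[OF leading_vdm leading_schur[OF that]])
  have tri: "plist \<gamma> = plist \<delta> \<or> sum_mset (plist \<delta>) < sum_mset (plist \<gamma>)"
    if "is_partition \<gamma>" "is_partition \<delta>" "sc (schur \<delta>) \<gamma> \<noteq> 0" for \<gamma> \<delta>
  proof -
    have "staircase (length \<gamma>) + plist \<gamma> = staircase (length \<gamma>) + plist \<delta> \<or>
        sum_mset (staircase (length \<gamma>) + plist \<delta>) < sum_mset (staircase (length \<gamma>) + plist \<gamma>)"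
      using that(3) L[OF that(2), of "length \<gamma>"]
      unfolding sc_def alt_def leading_def add.commute[of "plist \<gamma>"] by blast
    then show ?thesis by simp
  qed
  show ?thesis
  proof (cases "\<alpha> = \<beta>")
    case True
    then show ?thesis using L[OF \<alpha>, of "length \<alpha>"]
      by (simp add: sc_def alt_def leading_def add.commute)
  next
    case False
    then have "plist \<alpha> \<noteq> plist \<beta>" using plist_inj \<alpha> \<beta> by blast
    then have "sc (schur \<beta>) \<alpha> = 0"
      using tri[OF \<alpha> \<beta>] tri[OF \<beta> \<alpha>] sc_schur_commute[OF \<alpha> \<beta>]
      by (metis order.asym)
    then show ?thesis using False by simp
  qed
qed

lemma sum_mset_transpose_less:
  assumes "count A i < count A (Suc i)"
  shows "sum_mset (image_mset (transpose i (Suc i)) A) < sum_mset A"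
proof -
  define B where "B = filter_mset (\<lambda>j. j \<noteq> i \<and> j \<noteq> Suc i) A"
  have A: "A = B + replicate_mset (count A i) i + replicate_mset (count A (Suc i)) (Suc i)"
    by (rule multiset_eqI) (simp add: B_def)
  have "image_mset (transpose i (Suc i)) B = image_mset (\<lambda>j. j) B"
    by (rule image_mset_cong) (auto simp: B_def transpose_def)
  then have "image_mset (transpose i (Suc i)) A =
      B + replicate_mset (count A i) (Suc i) + replicate_mset (count A (Suc i)) i"
    by (subst A) simp
  moreover have "sum_mset A = sum_mset B + count A i * i + count A (Suc i) * Suc i"
    by (subst A) simp
  ultimately show ?thesis using assms by (simp add: algebra_simps)
qed

text \<open>A monomial of least weight in \<open>f\<close> is dominant, and only the leading term of the Vandermonde
  product contributes to the corresponding Schur coefficient.\<close>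

lemma symf_zeroI:
  assumes f: "symf f" and zero: "\<And>\<alpha>. is_partition \<alpha> \<Longrightarrow> sc f \<alpha> = 0"
  shows "f = 0"
proof (rule ccontr)
  assume "f \<noteq> 0"
  then obtain A0 where "coeff f A0 \<noteq> 0" using pser_eqI[of f 0] by auto
  then obtain A where A: "coeff f A \<noteq> 0"
    and min: "\<And>B. coeff f B \<noteq> 0 \<Longrightarrow> sum_mset A \<le> sum_mset B"
    using ex_has_least_nat[of "\<lambda>A. coeff f A \<noteq> 0" A0 sum_mset] by blast
  have dec: "count A (Suc i) \<le> count A i" for i
  proof (rule ccontr)
    assume "\<not> count A (Suc i) \<le> count A i"
    then have "sum_mset (image_mset (transpose i (Suc i)) A) < sum_mset A"
      by (intro sum_mset_transpose_less) simp
    moreover have "coeff f (image_mset (transpose i (Suc i)) A) \<noteq> 0"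
      using A f by (simp add: symf_coeff)
    ultimately show False using min leD by blast
  qed
  have anti: "count A j \<le> count A i" if "i \<le> j" for i j
    using dec that by (rule lift_Suc_antimono_le)
  define N where "N = (LEAST n. count A n = 0)"
  have ex: "\<exists>n. count A n = 0" by (metis ex_new_if_finite finite_set_mset infinite_UNIV_nat not_in_iff)
  have N0: "count A N = 0" unfolding N_def using ex by (rule LeastI_ex)
  have pos: "count A i \<noteq> 0" if "i < N" for i using that not_less_Least unfolding N_def by blast
  have zero': "count A i = 0" if "N \<le> i" for i using anti[OF that] N0 by simp
  define \<alpha> where "\<alpha> = map (count A) [0..<N]"
  have \<alpha>: "is_partition \<alpha>"
    unfolding is_partition_def
  proof
    show "sorted_wrt (\<ge>) \<alpha>" using anti by (simp add: \<alpha>_def sorted_wrt_iff_nth_less)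
    show "0 \<notin> set \<alpha>"
    proof
      assume "0 \<in> set \<alpha>"
      then obtain i where "i < N" "count A i = 0" by (force simp: \<alpha>_def)
      then show False using pos by blast
    qed
  qed
  have plist: "plist \<alpha> = A"
    by (rule multiset_eqI) (use zero' in \<open>auto simp: \<alpha>_def part_def\<close>)
  have len: "length \<alpha> = N" by (simp add: \<alpha>_def)
  let ?E = "A + staircase N"
  have "sc f \<alpha> = (\<Sum>B | B \<subseteq># ?E. coeff (vdm N) B * coeff f (?E - B))"
    unfolding sc_def alt_def coeff_mult plist unfolding len[symmetric] plist ..
  also have "\<dots> = (\<Sum>B | B \<subseteq># ?E. if B = staircase N then coeff f A else 0)"
  proof (rule sum.cong)
    fix B assume "B \<in> {B. B \<subseteq># ?E}"
    then have "sum_mset B + sum_mset (?E - B) = sum_mset A + sum_mset (staircase N)"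
      by (metis mem_Collect_eq subset_mset.add_diff_inverse sum_mset.union)
    \<comment> \<open>A monomial of the Vandermonde product other than the staircase is heavier, so
      its complement is lighter than \<open>A\<close>, where \<open>f\<close> vanishes by
      minimality.\<close>
    then have "coeff (vdm N) B = 0 \<or> coeff f (?E - B) = 0" if "B \<noteq> staircase N"
      using that leading_vdm[of N] min[of "?E - B"] unfolding leading_def by fastforce
    then show "coeff (vdm N) B * coeff f (?E - B) = (if B = staircase N then coeff f A else 0)"
      using leading_vdm[of N] by (auto simp: leading_def)
  qed simp
  also have "\<dots> = coeff f A" by simp
  finally show False using zero[OF \<alpha>] A by simp
qed

section \<open>The Schur functions as a basis\<close>

definition partitions_le :: "nat \<Rightarrow> nat list set" where
  "partitions_le d = {\<alpha>. is_partition \<alpha> \<and> sum_list \<alpha> \<le> d}"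

lemma length_partition: "is_partition \<alpha> \<Longrightarrow> length \<alpha> \<le> sum_list \<alpha>"
  unfolding is_partition_def by (induction \<alpha>) (auto simp: Suc_le_eq)

lemma finite_partitions_le [simp]: "finite (partitions_le d)"
proof (rule finite_subset)
  show "partitions_le d \<subseteq> {xs. set xs \<subseteq> {..d} \<and> length xs \<le> d}"
    unfolding partitions_le_def using length_partition member_le_sum_list by fastforce
  show "finite {xs. set xs \<subseteq> {..d} \<and> length xs \<le> d}" by (rule finite_lists_length_le) simp
qed

lemma sum_list_part: "sum_list \<alpha> = (\<Sum>i<length \<alpha>. part \<alpha> i)"
  by (simp add: sum_list_sum_nth atLeast0LessThan part_def)

lemma sc_eq_0:
  assumes "bounded_by d f" "d < sum_list \<alpha>" shows "sc f \<alpha> = 0"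
proof (rule ccontr)
  assume "sc f \<alpha> \<noteq> 0"
  then have "size (shifted (length \<alpha>) (part \<alpha>)) \<le> size (staircase (length \<alpha>)) + d"
    using bounded_by_mult[OF homogeneous_bounded_by[OF homogeneous_vdm] assms(1)]
    unfolding sc_def alt_def bounded_by_def by blast
  then show False using assms(2) by (simp add: size_mon sum_list_part)
qed

text \<open>By orthonormality the difference of both sides has no Schur coefficients, and
  \<open>symf_zeroI\<close> applies.\<close>

lemma Sym_expansion:
  assumes "f \<in> Sym" "bounded_by d f"
  shows "f = (\<Sum>\<alpha>\<in>partitions_le d. pscale (sc f \<alpha>) (schur \<alpha>))"
proof -
  have "f - (\<Sum>\<alpha>\<in>partitions_le d. pscale (sc f \<alpha>) (schur \<alpha>)) = 0"
  proof (rule symf_zeroI)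
    show "symf (f - (\<Sum>\<alpha>\<in>partitions_le d. pscale (sc f \<alpha>) (schur \<alpha>)))"
      using assms(1) by (intro Sym_symf Sym_diff Sym_sum Sym_pscale) (auto simp: partitions_le_def)
    fix \<beta> assume \<beta>: "is_partition \<beta>"
    have "sc (\<Sum>\<alpha>\<in>partitions_le d. pscale (sc f \<alpha>) (schur \<alpha>)) \<beta> =
        (\<Sum>\<alpha>\<in>partitions_le d. if \<beta> = \<alpha> then sc f \<beta> else 0)"
      unfolding sc_sum sc_pscale
      by (rule sum.cong) (auto simp: sc_schur \<beta> partitions_le_def)
    also have "\<dots> = sc f \<beta>"
    proof -
      have "\<beta> \<in> partitions_le d \<longleftrightarrow> sum_list \<beta> \<le> d" using \<beta> by (simp add: partitions_le_def)
      then show ?thesis using sc_eq_0[OF assms(2), of \<beta>] by (simp add: not_le)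
    qed
    finally show "sc (f - (\<Sum>\<alpha>\<in>partitions_le d. pscale (sc f \<alpha>) (schur \<alpha>))) \<beta> = 0"
      by (simp add: sc_diff)
  qed
  then show ?thesis by simp
qed

lemma independent_schur: "pser.independent schur_basis"
proof
  assume "pser.dependent schur_basis"
  then obtain S u v where S: "finite S" "S \<subseteq> schur_basis" "v \<in> S" "u v \<noteq> 0"
    and sum: "(\<Sum>v\<in>S. pscale (u v) v) = 0"
    unfolding pser.dependent_explicit by blast
  obtain \<alpha> where \<alpha>: "is_partition \<alpha>" "v = schur \<alpha>" using S by (auto simp: schur_basis_def)
  have "sc w \<alpha> = (if w = v then 1 else 0)" if "w \<in> S" for w
  proof -
    obtain \<beta> where \<beta>: "is_partition \<beta>" "w = schur \<beta>" using \<open>w \<in> S\<close> S(2) unfolding schur_basis_def by blast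
    show ?thesis using \<alpha> \<beta> sc_schur[OF \<alpha>(1) \<beta>(1)] sc_schur[OF \<alpha>(1) \<alpha>(1)] by auto
  qed
  then have "sc (\<Sum>v\<in>S. pscale (u v) v) \<alpha> = (\<Sum>w\<in>S. if w = v then u w else 0)"
    unfolding sc_sum sc_pscale by (intro sum.cong) auto
  also have "\<dots> = u v" using S by simp
  finally show False using S(4) sum by (simp add: sc_def alt_def)
qed

lemma schur_inj: "is_partition \<alpha> \<Longrightarrow> is_partition \<beta> \<Longrightarrow> schur \<alpha> = schur \<beta> \<Longrightarrow> \<alpha> = \<beta>"
  by (metis sc_schur zero_neq_one)

text \<open>Replaces the coordinates in \<open>hall\<close> and \<open>lr_coeff\<close>, which are
  given only through a basis representation, by an explicit coefficient.\<close>

lemma schur_coeff_eq: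
  assumes "f \<in> Sym" "is_partition \<alpha>" shows "schur_coeff f \<alpha> = sc f \<alpha>"
proof -
  obtain d where d: "bounded_by d f" using assms(1) by (rule Sym_boundedE)
  have in_span: "pscale c (schur \<beta>) \<in> pser.span schur_basis" if "\<beta> \<in> partitions_le d" for c \<beta>
    using that by (intro pser.span_scale pser.span_base) (auto simp: schur_basis_def partitions_le_def)
  have rep: "pser.representation schur_basis (pscale c (schur \<beta>)) (schur \<alpha>) =
      (if \<alpha> = \<beta> then c else 0)" if "\<beta> \<in> partitions_le d" for c \<beta>
  proof -
    have \<beta>: "is_partition \<beta>" using that by (simp add: partitions_le_def)
    then have "schur \<beta> \<in> schur_basis" by (simp add: schur_basis_def)
    then show ?thesis
      using schur_inj[OF assms(2) \<beta>]
      by (auto simp: pser.representation_scale[OF independent_schur] pser.span_base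
          pser.representation_basis[OF independent_schur])
  qed
  have "schur_coeff f \<alpha> = schur_coeff (\<Sum>\<beta>\<in>partitions_le d. pscale (sc f \<beta>) (schur \<beta>)) \<alpha>"
    using Sym_expansion[OF assms(1) d] by simp
  also have "\<dots> = (\<Sum>\<beta>\<in>partitions_le d. if \<alpha> = \<beta> then sc f \<beta> else 0)"
    unfolding schur_coeff_def
    by (subst pser.representation_sum[OF independent_schur]) (auto simp: in_span rep)
  also have "\<dots> = sc f \<alpha>"
  proof -
    have "\<alpha> \<in> partitions_le d \<longleftrightarrow> sum_list \<alpha> \<le> d" using assms(2) by (simp add: partitions_le_def)
    then show ?thesis using sc_eq_0[OF d, of \<alpha>] by (simp add: not_le)
  qed
  finally show ?thesis .
qed

section \<open>Skew Schur functions\<close>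

lemma sc_homogeneous:
  assumes "homogeneous d f" "d \<noteq> sum_list \<alpha>" shows "sc f \<alpha> = 0"
proof (rule ccontr)
  assume "sc f \<alpha> \<noteq> 0"
  then have "size (shifted (length \<alpha>) (part \<alpha>)) = size (staircase (length \<alpha>)) + d"
    using homogeneous_mult[OF homogeneous_vdm assms(1)]
    unfolding sc_def alt_def homogeneous_def by blast
  then show False using assms(2) by (simp add: size_mon sum_list_part)
qed

lemma sc_mult_expansion:
  assumes "f \<in> Sym" "bounded_by d f"
  shows "sc (g * f) \<alpha> = (\<Sum>\<beta>\<in>partitions_le d. sc f \<beta> * sc (g * schur \<beta>) \<alpha>)"
  by (subst Sym_expansion[OF assms]) (simp add: sum_distrib_left sc_sum sc_pscale)

lemma skew_schur_expansion:
  assumes \<alpha>: "is_partition \<alpha>" and \<kappa>: "is_partition \<kappa>" and "sum_list \<alpha> \<le> d"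
  shows "skew_schur (\<alpha>, \<kappa>) = (\<Sum>\<beta>\<in>partitions_le d. pscale (sc (schur \<kappa> * schur \<beta>) \<alpha>) (schur \<beta>))"
proof -
  have "skew_schur (\<alpha>, \<kappa>) =
      (\<Sum>\<beta> | is_partition \<beta> \<and> sum_list \<kappa> + sum_list \<beta> = sum_list \<alpha>.
        pscale (sc (schur \<kappa> * schur \<beta>) \<alpha>) (schur \<beta>))"
    unfolding skew_schur_def lr_coeff_def prod.case
    by (rule sum.cong) (auto simp: schur_coeff_eq \<alpha> \<kappa> Sym_mult)
  also have "\<dots> = (\<Sum>\<beta>\<in>partitions_le d. pscale (sc (schur \<kappa> * schur \<beta>) \<alpha>) (schur \<beta>))"
  proof (rule sum.mono_neutral_left)
    show "\<forall>\<beta>\<in>partitions_le d - {\<beta>. is_partition \<beta> \<and> sum_list \<kappa> + sum_list \<beta> = sum_list \<alpha>}.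
        pscale (sc (schur \<kappa> * schur \<beta>) \<alpha>) (schur \<beta>) = 0"
      using sc_homogeneous[OF homogeneous_mult[OF homogeneous_schur homogeneous_schur]]
      by (auto simp: partitions_le_def)
  qed (use assms(3) in simp, use assms(3) in \<open>auto simp: partitions_le_def\<close>)
  finally show ?thesis .
qed

lemma skew_schur_Sym:
  assumes "is_partition \<alpha>" "is_partition \<kappa>" shows "skew_schur (\<alpha>, \<kappa>) \<in> Sym"
  unfolding skew_schur_expansion[OF assms order_refl]
  by (intro Sym_sum Sym_pscale schur_Sym) (simp add: partitions_le_def)

lemma sc_skew_schur:
  assumes \<alpha>: "is_partition \<alpha>" and \<kappa>: "is_partition \<kappa>" and \<beta>: "is_partition \<beta>"
  shows "sc (skew_schur (\<alpha>, \<kappa>)) \<beta> = sc (schur \<kappa> * schur \<beta>) \<alpha>"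
proof -
  let ?d = "max (sum_list \<alpha>) (sum_list \<beta>)"
  have "sc (skew_schur (\<alpha>, \<kappa>)) \<beta> =
      (\<Sum>\<gamma>\<in>partitions_le ?d. if \<gamma> = \<beta> then sc (schur \<kappa> * schur \<beta>) \<alpha> else 0)"
    unfolding skew_schur_expansion[OF \<alpha> \<kappa>, of ?d, OF max.cobounded1] sc_sum sc_pscale
    by (rule sum.cong) (auto simp: sc_schur \<beta> partitions_le_def)
  moreover have "\<beta> \<in> partitions_le ?d" using \<beta> by (simp add: partitions_le_def)
  ultimately show ?thesis by simp
qed

text \<open>The coefficient at \<open>A\<close> is the pairing with h_A, and skewing by \<kappa> is
  adjoint to multiplication by its Schur function.\<close>

lemma coeff_skew_schur:
  assumes \<alpha>: "is_partition \<alpha>" and \<kappa>: "is_partition \<kappa>"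
  shows "coeff (skew_schur (\<alpha>, \<kappa>)) A = sc (schur \<kappa> * csprod False A) \<alpha>"
proof -
  obtain e where e: "bounded_by e (csprod False A)" using Sym_boundedE[OF csprod_Sym] by blast
  let ?d = "max (sum_list \<alpha>) e"
  have "coeff (skew_schur (\<alpha>, \<kappa>)) A =
      (\<Sum>\<beta>\<in>partitions_le ?d. sc (csprod False A) \<beta> * sc (schur \<kappa> * schur \<beta>) \<alpha>)"
    unfolding skew_schur_expansion[OF \<alpha> \<kappa>, of ?d, OF max.cobounded1]
    by (auto simp: sc_def alt_csprod_partition partitions_le_def intro!: sum.cong)
  also have "\<dots> = sc (schur \<kappa> * csprod False A) \<alpha>"
    by (rule sc_mult_expansion[symmetric]) (auto intro: bounded_by_mono[OF e])
  finally show ?thesis .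
qed

text \<open>By adjointness the inner shape becomes a fixed factor, and only the outer shape is left
  in the extraction.\<close>

lemma hall_skew_schur:
  assumes f: "f \<in> Sym" and \<alpha>: "is_partition \<alpha>" and \<kappa>: "is_partition \<kappa>"
  shows "hall f (skew_schur (\<alpha>, \<kappa>)) = sc (schur \<kappa> * f) \<alpha>"
proof -
  obtain d where d: "bounded_by d f" using f by (rule Sym_boundedE)
  have "hall f (skew_schur (\<alpha>, \<kappa>)) =
      (\<Sum>\<beta> | is_partition \<beta> \<and> sc f \<beta> \<noteq> 0. sc f \<beta> * sc (schur \<kappa> * schur \<beta>) \<alpha>)"
    unfolding hall_def
    by (rule sum.cong) (auto simp: schur_coeff_eq f skew_schur_Sym[OF \<alpha> \<kappa>] sc_skew_schur[OF \<alpha> \<kappa>])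
  also have "\<dots> = (\<Sum>\<beta>\<in>partitions_le d. sc f \<beta> * sc (schur \<kappa> * schur \<beta>) \<alpha>)"
    by (rule sum.mono_neutral_left)
      (simp, use sc_eq_0[OF d] in \<open>auto simp: partitions_le_def not_less[symmetric]\<close>)
  also have "\<dots> = sc (schur \<kappa> * f) \<alpha>"
    by (rule sc_mult_expansion[symmetric, OF f d])
  finally show ?thesis .
qed

section \<open>Conjugate partitions\<close>

definition conj_part :: "(nat \<Rightarrow> nat) \<Rightarrow> nat \<Rightarrow> nat" where
  "conj_part \<alpha> i = card {r. i < \<alpha> r}"

text \<open>The set counted is an initial segment because \<alpha> is decreasing. Inequalities
  between conjugates are later proved by comparing memberships through this equivalence.\<close>

lemma conj_part_iff:
  assumes "par N \<alpha>" shows "r < conj_part \<alpha> i \<longleftrightarrow> i < \<alpha> r"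
proof -
  define n where "n = (LEAST r. \<not> i < \<alpha> r)"
  have "\<not> i < \<alpha> N" using assms by (simp add: par_def)
  then have n: "\<not> i < \<alpha> n" unfolding n_def by (rule LeastI)
  have "i < \<alpha> r \<longleftrightarrow> r < n" for r
  proof
    show "r < n" if "i < \<alpha> r"
    proof (rule ccontr)
      assume "\<not> r < n"
      then have "\<alpha> r \<le> \<alpha> n" using par_antimono[OF assms, of n r] by simp
      then show False using n that by simp
    qed
    show "i < \<alpha> r" if "r < n" using not_less_Least[of r "\<lambda>r. \<not> i < \<alpha> r"] that by (simp add: n_def)
  qed
  moreover from this have "{r. i < \<alpha> r} = {..<n}" by auto
  ultimately show ?thesis by (simp add: conj_part_def)
qed

lemma par_conj_part:
  assumes "par N \<alpha>" "\<alpha> 0 \<le> M" shows "par M (conj_part \<alpha>)"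
  unfolding par_def decreasing_def
proof (intro conjI allI impI)
  fix i
  have "r < conj_part \<alpha> i" if "r < conj_part \<alpha> (Suc i)" for r
    using that by (simp add: conj_part_iff[OF assms(1)])
  then show "conj_part \<alpha> (Suc i) \<le> conj_part \<alpha> i" by (meson not_le order_less_irrefl)
next
  fix i assume i: "M \<le> i"
  have "\<not> 0 < conj_part \<alpha> i" using i assms(2) by (simp add: conj_part_iff[OF assms(1)])
  then show "conj_part \<alpha> i = 0" by simp
qed

lemma conj_conj_part:
  assumes "par N \<alpha>" shows "conj_part (conj_part \<alpha>) = \<alpha>"
proof
  fix i
  have "{r. i < conj_part \<alpha> r} = {..<\<alpha> i}" by (auto simp: conj_part_iff[OF assms])
  then show "conj_part (conj_part \<alpha>) i = \<alpha> i" by (subst conj_part_def) simp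
qed

lemma weight_conj_part:
  assumes "par N \<alpha>" shows "weight (conj_part \<alpha>) = weight \<alpha>"
proof -
  have "{(i, j). j < conj_part \<alpha> i} = prod.swap ` {(i, j). j < \<alpha> i}"
    by (auto simp: conj_part_iff[OF assms] image_iff)
  then show ?thesis unfolding weight_def by (simp add: card_image)
qed

lemma conj_part_vstrip:
  assumes \<alpha>: "par N \<alpha>" and \<mu>: "\<mu> \<in> vstrip \<alpha> c"
  shows "conj_part \<mu> \<in> hstrip (conj_part \<alpha>) c"
proof -
  note \<mu>' = vstrip_par[OF \<alpha> \<mu>]
  have le: "\<mu> i \<le> \<alpha> i" "\<alpha> i \<le> Suc (\<mu> i)" for i using \<mu> by (auto simp: vstrip_def)
  have "r < conj_part \<mu> i" if "r < conj_part \<alpha> (Suc i)" for r i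
    using that le(2)[of r] by (simp add: conj_part_iff[OF \<alpha>] conj_part_iff[OF \<mu>'])
  then have "conj_part \<alpha> (Suc i) \<le> conj_part \<mu> i" for i by (meson not_le order_less_irrefl)
  moreover have "r < conj_part \<alpha> i" if "r < conj_part \<mu> i" for r i
    using that le(1)[of r] by (simp add: conj_part_iff[OF \<alpha>] conj_part_iff[OF \<mu>'])
  then have "conj_part \<mu> i \<le> conj_part \<alpha> i" for i by (meson not_le order_less_irrefl)
  ultimately show ?thesis
    using \<mu> by (simp add: hstrip_def vstrip_def weight_conj_part[OF \<alpha>] weight_conj_part[OF \<mu>'])
qed

lemma conj_part_hstrip:
  assumes \<alpha>: "par N \<alpha>" and \<alpha>0: "\<alpha> 0 \<le> M" and \<nu>: "\<nu> \<in> hstrip (conj_part \<alpha>) c"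
  shows "conj_part \<nu> \<in> vstrip \<alpha> c"
proof -
  note \<alpha>' = par_conj_part[OF \<alpha> \<alpha>0]
  note \<nu>' = hstrip_par[OF \<alpha>' \<nu>]
  have le: "\<nu> i \<le> conj_part \<alpha> i" "conj_part \<alpha> (Suc i) \<le> \<nu> i" for i using \<nu> by (auto simp: hstrip_def)
  have "conj_part \<nu> i \<le> \<alpha> i" for i
  proof -
    have "r < \<alpha> i" if "r < conj_part \<nu> i" for r
      using that le(1)[of r] by (simp add: conj_part_iff[OF \<nu>'] flip: conj_part_iff[OF \<alpha>])
    then show ?thesis by (meson not_le order_less_irrefl)
  qed
  moreover have "\<alpha> i \<le> Suc (conj_part \<nu> i)" for i
  proof -
    have "r < Suc (conj_part \<nu> i)" if "r < \<alpha> i" for r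
    proof (cases r)
      case (Suc s)
      then have "i < \<nu> s" using that le(2)[of s] by (simp flip: conj_part_iff[OF \<alpha>])
      then show ?thesis using Suc by (simp add: conj_part_iff[OF \<nu>'])
    qed simp
    then show ?thesis by (meson not_le order_less_irrefl)
  qed
  moreover have "decreasing (conj_part \<nu>)"
    using par_conj_part[OF \<nu>' order_refl] by (simp add: par_def)
  ultimately show ?thesis
    using \<nu> by (simp add: hstrip_def vstrip_def weight_conj_part[OF \<alpha>] weight_conj_part[OF \<nu>'])
qed

text \<open>Conjugation exchanges vertical and horizontal strips, so \<open>alt_e_mult\<close> for
  \<alpha> and \<open>alt_h_mult\<close> for its conjugate are the same recursion. In substance this
  is the effect of \<open>omega\<close> on Schur functions, before \<open>omega\<close> is
  available.\<close>

lemma alt_conj_bounded: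
  assumes "par N \<alpha>" "\<alpha> 0 \<le> M" "set_mset A \<subseteq> {..<n}"
  shows "alt N \<alpha> (csprod True A) = alt M (conj_part \<alpha>) (csprod False A)"
  using assms
proof (induction n arbitrary: A \<alpha>)
  case 0
  then show ?case by (simp add: alt_one par_conj_part weight_conj_part)
next
  case (Suc n)
  define c where "c = count A n"
  define A' where "A' = filter_mset (\<lambda>i. i \<noteq> n) A"
  have A: "A = A' + replicate_mset c n"
    by (rule multiset_eqI) (simp add: A'_def c_def)
  have A': "set_mset A' \<subseteq> {..<n}" using Suc.prems by (auto simp: A'_def)
  have n: "n \<notin># A'" by (simp add: A'_def)
  have "alt N \<alpha> (csprod True A) = (\<Sum>\<mu>\<in>vstrip \<alpha> c. alt N \<mu> (csprod True A'))"
    unfolding A using Suc.prems by (simp add: csprod_add_replicate n alt_e_mult)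
  also have "\<dots> = (\<Sum>\<mu>\<in>vstrip \<alpha> c. alt M (conj_part \<mu>) (csprod False A'))"
  proof (rule sum.cong)
    fix \<mu> assume \<mu>: "\<mu> \<in> vstrip \<alpha> c"
    then have "\<mu> 0 \<le> \<alpha> 0" by (simp add: vstrip_def)
    then show "alt N \<mu> (csprod True A') = alt M (conj_part \<mu>) (csprod False A')"
      using Suc.IH[OF vstrip_par[OF Suc.prems(1) \<mu>] _ A'] Suc.prems(2) by simp
  qed simp
  also have "\<dots> = (\<Sum>\<nu>\<in>hstrip (conj_part \<alpha>) c. alt M \<nu> (csprod False A'))"
  proof (rule sum.reindex_bij_witness[where i = conj_part and j = conj_part])
    fix \<mu> assume \<mu>: "\<mu> \<in> vstrip \<alpha> c"
    show "conj_part (conj_part \<mu>) = \<mu>" by (rule conj_conj_part[OF vstrip_par[OF Suc.prems(1) \<mu>]])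
    show "conj_part \<mu> \<in> hstrip (conj_part \<alpha>) c" by (rule conj_part_vstrip[OF Suc.prems(1) \<mu>])
  next
    fix \<nu> assume \<nu>: "\<nu> \<in> hstrip (conj_part \<alpha>) c"
    show "conj_part \<nu> \<in> vstrip \<alpha> c" by (rule conj_part_hstrip[OF Suc.prems(1,2) \<nu>])
    show "conj_part (conj_part \<nu>) = \<nu>"
      by (rule conj_conj_part[OF hstrip_par[OF par_conj_part[OF Suc.prems(1,2)] \<nu>]])
  qed simp
  also have "\<dots> = alt M (conj_part \<alpha>) (csprod False A)"
    unfolding A using Suc.prems by (simp add: csprod_add_replicate n alt_h_mult par_conj_part)
  finally show ?case .
qed

lemma alt_conj:
  assumes "par N \<alpha>" "\<alpha> 0 \<le> M"
  shows "alt N \<alpha> (csprod True A) = alt M (conj_part \<alpha>) (csprod False A)"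
proof -
  have "set_mset A \<subseteq> {..<Suc (\<Sum>i\<in>#A. i)}"
    using sum_mset.remove by (fastforce simp: less_Suc_eq_le)
  then show ?thesis by (rule alt_conj_bounded[OF assms])
qed

section \<open>Removing the first row\<close>

definition efin :: "nat \<Rightarrow> nat \<Rightarrow> pser" where
  "efin N n = Pser (\<lambda>A. if size A = n \<and> (\<forall>i. count A i \<le> 1) \<and> set_mset A \<subseteq> {..<N} then 1 else 0)"

lemma efin_0 [simp]: "efin N 0 = 1"
  by (rule pser_eqI) (auto simp: efin_def)

lemma efin_eq_0: "N < n \<Longrightarrow> efin N n = 0"
proof (rule pser_eqI)
  fix A assume "N < n"
  have "size A \<le> N" if "\<forall>i. count A i \<le> 1" "set_mset A \<subseteq> {..<N}"
  proof -
    have "size A = (\<Sum>i\<in>set_mset A. count A i)" by (rule size_multiset_overloaded_eq)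
    also have "\<dots> \<le> (\<Sum>i\<in>set_mset A. 1)" using that by (intro sum_mono) simp
    also have "\<dots> \<le> N" using card_mono[OF _ that(2)] by simp
    finally show ?thesis .
  qed
  then show "coeff (efin N n) A = coeff 0 A" using \<open>N < n\<close> by (auto simp: efin_def)
qed

lemma efin_Suc: "efin (Suc N) (Suc n) = efin N (Suc n) + X N * efin N n"
proof (rule pser_eqI)
  fix A
  show "coeff (efin (Suc N) (Suc n)) A = coeff (efin N (Suc n) + X N * efin N n) A"
  proof (cases "N \<in># A")
    case True
    then obtain B where A: "A = add_mset N B" by (meson multi_member_split)
    have "(\<forall>i. count A i \<le> 1) \<and> set_mset A \<subseteq> {..<Suc N} \<longleftrightarrow>
        (\<forall>i. count B i \<le> 1) \<and> set_mset B \<subseteq> {..<N}"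
    proof
      assume *: "(\<forall>i. count A i \<le> 1) \<and> set_mset A \<subseteq> {..<Suc N}"
      then have c: "count A i \<le> 1" for i by blast
      have "count B i \<le> 1" for i using c[of i] by (simp add: A split: if_splits)
      moreover have "count B N = 0" using c[of N] by (simp add: A)
      then have "N \<notin># B" by (simp add: count_eq_zero_iff)
      then have "set_mset B \<subseteq> {..<N}" using * by (force simp: A less_Suc_eq)
      ultimately show "(\<forall>i. count B i \<le> 1) \<and> set_mset B \<subseteq> {..<N}" by blast
    next
      assume *: "(\<forall>i. count B i \<le> 1) \<and> set_mset B \<subseteq> {..<N}"
      then have "N \<notin># B" by blast
      then have "count B N = 0" by (simp add: count_eq_zero_iff)
      then show "(\<forall>i. count A i \<le> 1) \<and> set_mset A \<subseteq> {..<Suc N}" using * by (auto simp: A)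
    qed
    then show ?thesis by (auto simp: efin_def coeff_X_mult A)
  next
    case False
    then have "set_mset A \<subseteq> {..<Suc N} \<longleftrightarrow> set_mset A \<subseteq> {..<N}" by (auto simp: less_Suc_eq)
    then show ?thesis using False by (simp add: efin_def coeff_X_mult)
  qed
qed

lemma hperp_X0: "hperp a (X 0 * f) = (if a = 0 then 0 else hperp (a - 1) f)"
proof (rule pser_eqI)
  fix A
  have "0 \<in># mcons a A \<longleftrightarrow> a \<noteq> 0" by (simp flip: count_greater_zero_iff)
  moreover have "mcons a A - {#0#} = mcons (a - 1) A" by (rule sym, rule mcons_eqI) auto
  ultimately show "coeff (hperp a (X 0 * f)) A = coeff (if a = 0 then 0 else hperp (a - 1) f) A"
    by (simp add: coeff_X_mult)
qed

lemma hperp_X_Suc: "hperp a (X (Suc i) * f) = X i * hperp a f"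
proof (rule pser_eqI)
  fix A
  have "Suc i \<in># mcons a A \<longleftrightarrow> i \<in># A" by (simp flip: count_greater_zero_iff)
  moreover have "mcons a A - {#Suc i#} = mcons a (A - {#i#})" by (rule sym, rule mcons_eqI) auto
  ultimately show "coeff (hperp a (X (Suc i) * f)) A = coeff (X i * hperp a f) A"
    by (simp add: coeff_X_mult)
qed

text \<open>Vieta's formulas: the coefficients in \<open>x_0\<close> are signed elementary symmetric
  functions of the other \<open>N\<close> variables, renumbered from 0.\<close>

lemma hperp_vdm_factor:
  "hperp a (\<Prod>j<N. X 0 - X (Suc j)) =
    (if a \<le> N then pscale ((-1) ^ (N - a)) (efin N (N - a)) else 0)"
proof (induction N arbitrary: a)
  case 0
  then show ?case by (simp add: hperp_one)
next
  case (Suc N)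
  let ?W = "\<Prod>j<N. X 0 - X (Suc j)"
  have "hperp a (\<Prod>j<Suc N. X 0 - X (Suc j)) =
      (if a = 0 then 0 else hperp (a - 1) ?W) - X N * hperp a ?W"
    by (simp add: mult.commute[of ?W] left_diff_distrib hperp_diff hperp_X0 hperp_X_Suc)
  also have "\<dots> = (if a \<le> Suc N then pscale ((-1) ^ (Suc N - a)) (efin (Suc N) (Suc N - a)) else 0)"
  proof -
    consider "a = 0" | b where "a = Suc b" "b < N" | "a = Suc N" | "a > Suc N"
      by (metis less_Suc_eq linorder_neqE_nat not0_implies_Suc Suc_less_eq)
    then show ?thesis
    proof cases
      case 1
      then show ?thesis by (simp add: Suc.IH efin_Suc efin_eq_0)
    next
      case 2
      then have "N - b = Suc (N - Suc b)" by simp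
      then show ?thesis using 2
        by (simp add: Suc.IH efin_Suc pser.scale_right_distrib)
    next
      case 3
      then show ?thesis by (simp add: Suc.IH)
    next
      case 4
      then have "\<not> a - 1 \<le> N" "\<not> a \<le> N" "\<not> a \<le> Suc N" by auto
      then show ?thesis by (simp add: Suc.IH)
    qed
  qed
  finally show ?case .
qed

lemma vdm_Suc:
  "vdm (Suc N) = (\<Prod>(i, j) \<in> {(i, j). i < j \<and> j < N}. X (Suc i) - X (Suc j)) * (\<Prod>j<N. X 0 - X (Suc j))"
proof -
  let ?P = "map_prod Suc Suc ` {(i, j). i < j \<and> j < N}" and ?Q = "(\<lambda>j. (0, Suc j)) ` {..<N}"
  have "{(i, j). i < j \<and> j < Suc N} = ?P \<union> ?Q"
  proof (intro set_eqI iffI)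
    fix p assume "p \<in> {(i, j). i < j \<and> j < Suc N}"
    then obtain i j where "p = (i, Suc j)" "i < Suc j" "j < N"
      by (auto simp: less_Suc_eq_0_disj)
    then show "p \<in> ?P \<union> ?Q" by (cases i) auto
  qed auto
  moreover have "?P \<inter> ?Q = {}" by auto
  ultimately have "vdm (Suc N) = (\<Prod>(i, j)\<in>?P. X i - X j) * (\<Prod>(i, j)\<in>?Q. X i - X j)"
    unfolding vdm_def by (simp add: prod.union_disjoint)
  then show ?thesis
    by (simp add: prod.reindex inj_on_def map_prod_def case_prod_unfold)
qed

lemma hperp_vdm_shift:
  "finite S \<Longrightarrow> hperp a ((\<Prod>(i, j)\<in>S. X (Suc i) - X (Suc j)) * f) = (\<Prod>(i, j)\<in>S. X i - X j) * hperp a f"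
proof (induction S rule: finite_induct)
  case (insert p S)
  obtain i j where p: "p = (i, j)" by fastforce
  show ?case using insert
    by (simp add: p mult.assoc left_diff_distrib hperp_diff hperp_X_Suc)
qed simp

lemma coeff_mult_cong_left:
  assumes "\<And>B. B \<subseteq># E \<Longrightarrow> coeff f B = coeff f' B"
  shows "coeff (f * g) E = coeff (f' * g) E"
  unfolding coeff_mult by (rule sum.cong) (use assms in auto)

text \<open>The first variable of the Vandermonde product is separated. The operator applied to
  \<open>f\<close> is the adjoint of the Bernstein operator that puts a row of length
  \<open>\<eta> 0\<close> on top of a partition.\<close>

lemma alt_Suc:
  "alt (Suc N) \<eta> f = (\<Sum>i\<le>N. (-1) ^ i * alt N (\<eta> \<circ> Suc) (csym True i * hperp (\<eta> 0 + i) f))"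
proof -
  let ?E = "shifted N (\<eta> \<circ> Suc)" and ?W = "\<Prod>j<N. X 0 - X (Suc j)"
  \<comment> \<open>\<open>N\<close> is the first entry of the staircase for \<open>Suc N\<close>
    variables.\<close>
  have "mcons (\<eta> 0 + N) ?E = shifted (Suc N) \<eta>"
    by (rule mcons_eqI) auto
  then have "alt (Suc N) \<eta> f = coeff (hperp (\<eta> 0 + N) (vdm (Suc N) * f)) ?E"
    by (simp add: alt_def)
  also have "\<dots> = coeff (vdm N * hperp (\<eta> 0 + N) (?W * f)) ?E"
    unfolding vdm_Suc mult.assoc hperp_vdm_shift[OF finite_pairs] vdm_def[symmetric] ..
  also have "hperp (\<eta> 0 + N) (?W * f) =
      (\<Sum>a\<le>\<eta> 0 + N. hperp a ?W * hperp (\<eta> 0 + N - a) f)"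
    by (rule hperp_mult)
  also have "\<dots> = (\<Sum>a\<le>N. pscale ((-1) ^ (N - a)) (efin N (N - a)) * hperp (\<eta> 0 + N - a) f)"
    by (rule sum.mono_neutral_cong_right) (auto simp: hperp_vdm_factor)
  also have "\<dots> = (\<Sum>i\<le>N. pscale ((-1) ^ i) (efin N i * hperp (\<eta> 0 + i) f))"
    by (rule sum.reindex_bij_witness[where i = "\<lambda>i. N - i" and j = "\<lambda>i. N - i"]) auto
  also have "coeff (vdm N * (\<Sum>i\<le>N. pscale ((-1) ^ i) (efin N i * hperp (\<eta> 0 + i) f))) ?E =
      (\<Sum>i\<le>N. (-1) ^ i * coeff (efin N i * (vdm N * hperp (\<eta> 0 + i) f)) ?E)"
    by (simp add: sum_distrib_left mult.left_commute[of "vdm N"])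
  \<comment> \<open>Only the first \<open>N\<close> variables occur in \<open>?E\<close>, and there
    the finite and the infinite elementary symmetric function have the same coefficients.\<close>
  also have "\<dots> = (\<Sum>i\<le>N. (-1) ^ i * coeff (csym True i * (vdm N * hperp (\<eta> 0 + i) f)) ?E)"
  proof (rule sum.cong[OF refl], rule arg_cong[of _ _ "(*) _"], rule coeff_mult_cong_left)
    fix i B assume "B \<subseteq># ?E"
    then have "set_mset B \<subseteq> set_mset ?E" by (rule set_mset_mono)
    also have "\<dots> \<subseteq> {..<N}"
    proof
      fix k assume "k \<in># ?E"
      then have "count ?E k \<noteq> 0" by (simp only: count_eq_zero_iff) simp
      then show "k \<in> {..<N}" by (simp split: if_splits)
    qed
    finally show "coeff (efin N i) B = coeff (csym True i) B" by (simp add: efin_def coeff_hsym)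
  qed
  also have "\<dots> = (\<Sum>i\<le>N. (-1) ^ i * alt N (\<eta> \<circ> Suc) (csym True i * hperp (\<eta> 0 + i) f))"
    by (simp add: alt_def mult.left_commute[of "vdm N"])
  finally show ?thesis .
qed

section \<open>Newton's identities for a signed alphabet of monomials\<close>

text \<open>The letters are monomials, and those selected by \<open>\<theta>\<close> are fermionic: they must not be repeated
  and carry a sign in the power sums.\<close>

definition words :: "nat multiset set \<Rightarrow> (nat multiset \<Rightarrow> bool) \<Rightarrow> nat \<Rightarrow> nat multiset \<Rightarrow> nat multiset multiset set" where
  "words L \<theta> n A =
     {S. size S = n \<and> set_mset S \<subseteq> L \<and> sum_mset S = A \<and> (\<forall>M. \<theta> M \<longrightarrow> count S M \<le> 1)}"

definition asum :: "nat multiset set \<Rightarrow> (nat multiset \<Rightarrow> bool) \<Rightarrow> nat \<Rightarrow> pser" where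
  "asum L \<theta> n = Pser (\<lambda>A. of_nat (card (words L \<theta> n A)))"

definition apow :: "nat multiset set \<Rightarrow> (nat multiset \<Rightarrow> bool) \<Rightarrow> nat \<Rightarrow> pser" where
  "apow L \<theta> k =
     Pser (\<lambda>A. \<Sum>M | M \<in> L \<and> repeat_mset k M = A. (if \<theta> M then -1 else 1) ^ (k - 1))"

lemma coeff_asum: "coeff (asum L \<theta> n) A = of_nat (card (words L \<theta> n A))"
  by (simp add: asum_def)

lemma finite_multisets_of_size:
  assumes "finite Y" shows "finite {S. set_mset S \<subseteq> Y \<and> size S = n}"
proof (rule finite_subset)
  show "{S. set_mset S \<subseteq> Y \<and> size S = n} \<subseteq> mset ` {xs. set xs \<subseteq> Y \<and> length xs = n}"
  proof
    fix S assume S: "S \<in> {S. set_mset S \<subseteq> Y \<and> size S = n}"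
    obtain xs where "mset xs = S" using ex_mset by blast
    with S show "S \<in> mset ` {xs. set xs \<subseteq> Y \<and> length xs = n}" by auto
  qed
  show "finite (mset ` {xs. set xs \<subseteq> Y \<and> length xs = n})"
    using finite_lists_length_eq[OF assms] by simp
qed

lemma letter_subset: "M \<in># S \<Longrightarrow> M \<subseteq># sum_mset S"
  by (metis mset_subset_eq_add_left sum_mset.remove)

lemma finite_words [simp]: "finite (words L \<theta> n A)"
proof (rule finite_subset)
  show "words L \<theta> n A \<subseteq> {S. set_mset S \<subseteq> {B. B \<subseteq># A} \<and> size S = n}"
    using letter_subset by (auto simp: words_def)
qed (rule finite_multisets_of_size[OF finite_submultisets])

lemma repeat_mset_sum_replicate: "sum_mset (replicate_mset k M) = repeat_mset k M"
  by (induction k) auto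

text \<open>The words \<open>S\<close> such that \<open>S\<close> together with \<open>k\<close> copies of the letter \<open>M\<close> has length \<open>n\<close> and
  product \<open>A\<close>.\<close>

definition rest_words ::
    "nat multiset set \<Rightarrow> (nat multiset \<Rightarrow> bool) \<Rightarrow> nat \<Rightarrow> nat multiset \<Rightarrow> nat multiset \<Rightarrow> nat \<Rightarrow>
      nat multiset multiset set" where
  "rest_words L \<theta> n A M k =
     {S. size S + k = n \<and> set_mset S \<subseteq> L \<and> sum_mset S + repeat_mset k M = A \<and>
       (\<forall>M. \<theta> M \<longrightarrow> count S M \<le> 1)}"

lemma rest_words_eq:
  assumes "k \<le> n" "repeat_mset k M \<subseteq># A"
  shows "rest_words L \<theta> n A M k = words L \<theta> (n - k) (A - repeat_mset k M)"
proof -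
  have "size S + k = n \<longleftrightarrow> size S = n - k" for S :: "nat multiset multiset"
    using assms(1) by auto
  moreover have "B + repeat_mset k M = A \<longleftrightarrow> B = A - repeat_mset k M" for B
    using assms(2) by auto
  ultimately show ?thesis by (simp add: rest_words_def words_def)
qed

lemma rest_words_empty: "\<not> repeat_mset k M \<subseteq># A \<Longrightarrow> rest_words L \<theta> n A M k = {}"
  by (auto simp: rest_words_def)

lemma finite_rest_words [simp]: "finite (rest_words L \<theta> n A M k)"
proof (cases "k \<le> n \<and> repeat_mset k M \<subseteq># A")
  case True
  then have "rest_words L \<theta> n A M k = words L \<theta> (n - k) (A - repeat_mset k M)"
    by (intro rest_words_eq) auto
  then show ?thesis by simp
next
  case False
  then have "rest_words L \<theta> n A M k = {}" by (auto simp: rest_words_def)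
  then show ?thesis by simp
qed

lemma card_rest_words_bosonic:
  assumes "M \<in> L" "\<not> \<theta> M"
  shows "card (rest_words L \<theta> n A M k) = card {S \<in> words L \<theta> n A. k \<le> count S M}"
proof (rule bij_betw_same_card[OF bij_betw_byWitness[where f = "\<lambda>S. S + replicate_mset k M"
        and f' = "\<lambda>S. S - replicate_mset k M"]])
  let ?f = "\<lambda>S. S + replicate_mset k M" and ?g = "\<lambda>S. S - replicate_mset k M"
  show "\<forall>S\<in>{S \<in> words L \<theta> n A. k \<le> count S M}. ?f (?g S) = S"
    by (auto simp: count_le_replicate_mset_subset_eq)
  show "?f ` rest_words L \<theta> n A M k \<subseteq> {S \<in> words L \<theta> n A. k \<le> count S M}"
    using assms by (auto simp: rest_words_def words_def repeat_mset_sum_replicate split: if_splits)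
  show "?g ` {S \<in> words L \<theta> n A. k \<le> count S M} \<subseteq> rest_words L \<theta> n A M k"
  proof
    fix T assume "T \<in> ?g ` {S \<in> words L \<theta> n A. k \<le> count S M}"
    then obtain S where T: "T = ?g S" and S: "S \<in> words L \<theta> n A" "k \<le> count S M" by blast
    then have ST: "S = T + replicate_mset k M" by (auto simp: count_le_replicate_mset_subset_eq)
    have "count T N \<le> 1" if "\<theta> N" for N
    proof -
      have "count S N \<le> 1" using S(1) that by (simp add: words_def)
      then show ?thesis by (simp add: ST)
    qed
    then show "T \<in> rest_words L \<theta> n A M k"
      using S(1) by (auto simp: ST rest_words_def words_def repeat_mset_sum_replicate)
  qed
qed simp

lemma sum_card_ge:
  assumes "finite Z" "\<And>S. S \<in> Z \<Longrightarrow> f S \<le> n"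
  shows "(\<Sum>k = 1..n. card {S \<in> Z. k \<le> f S}) = (\<Sum>S\<in>Z. f S)"
proof -
  have "(\<Sum>k = 1..n. card {S \<in> Z. k \<le> f S}) = (\<Sum>k = 1..n. \<Sum>S\<in>Z. if k \<le> f S then 1 else 0)"
    using assms(1) by (simp add: sum.inter_filter[symmetric])
  also have "\<dots> = (\<Sum>S\<in>Z. \<Sum>k = 1..n. if k \<le> f S then 1 else 0)" by (rule sum.swap)
  also have "\<dots> = (\<Sum>S\<in>Z. f S)"
  proof (rule sum.cong)
    fix S assume "S \<in> Z"
    then have "{k \<in> {1..n}. k \<le> f S} = {1..f S}" using assms(2) by fastforce
    then show "(\<Sum>k = 1..n. if k \<le> f S then 1 else 0) = f S"
      by (simp add: sum.inter_filter[symmetric])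
  qed simp
  finally show ?thesis .
qed

lemma count_le_size: "count S M \<le> size S"
  by (metis count_le_replicate_mset_subset_eq order_refl size_mset_mono size_replicate_mset)

text \<open>If the rest still contains \<open>M\<close>, that one copy joins the \<open>k\<close>
  marked ones, which raises \<open>k\<close> by one. The alternating sum over \<open>k\<close>
  therefore telescopes.\<close>

lemma card_rest_words_fermionic:
  assumes "M \<in> L" "\<theta> M"
  shows "card (rest_words L \<theta> n A M k) =
    card {S \<in> rest_words L \<theta> n A M k. M \<notin># S} + card {S \<in> rest_words L \<theta> n A M (Suc k). M \<notin># S}"
proof -
  let ?R = "rest_words L \<theta> n A M"
  have "card {S \<in> ?R k. M \<in># S} = card {S \<in> ?R (Suc k). M \<notin># S}"
  proof (rule bij_betw_same_card[OF bij_betw_byWitness[where f = "\<lambda>S. S - {#M#}"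
          and f' = "add_mset M"]])
    show "\<forall>S\<in>{S \<in> ?R k. M \<in># S}. add_mset M (S - {#M#}) = S" by simp
    show "add_mset M ` {S \<in> ?R (Suc k). M \<notin># S} \<subseteq> {S \<in> ?R k. M \<in># S}"
      using assms by (auto simp: rest_words_def count_eq_zero_iff)
    show "(\<lambda>S. S - {#M#}) ` {S \<in> ?R k. M \<in># S} \<subseteq> {S \<in> ?R (Suc k). M \<notin># S}"
    proof
      fix T assume "T \<in> (\<lambda>S. S - {#M#}) ` {S \<in> ?R k. M \<in># S}"
      then obtain S where S: "S \<in> ?R k" "M \<in># S" and "T = S - {#M#}" by blast
      then have ST: "S = add_mset M T" by simp
      have c: "count S N \<le> 1" if "\<theta> N" for N using S(1) that by (simp add: rest_words_def)
      have "count T N \<le> 1" if "\<theta> N" for N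
        using c[OF that] unfolding ST by (simp split: if_splits)
      moreover have "count T M = 0" using c[OF assms(2)] unfolding ST by simp
      ultimately show "T \<in> {S \<in> ?R (Suc k). M \<notin># S}"
        using S(1) by (auto simp: ST rest_words_def count_eq_zero_iff)
    qed
  qed simp
  moreover have "?R k = {S \<in> ?R k. M \<notin># S} \<union> {S \<in> ?R k. M \<in># S}" by auto
  then have "card (?R k) = card {S \<in> ?R k. M \<notin># S} + card {S \<in> ?R k. M \<in># S}"
    by (metis (no_types, lifting) card_Un_disjoint disjoint_iff finite_Un finite_rest_words mem_Collect_eq)
  ultimately show ?thesis by simp
qed

lemma alternating_telescope:
  fixes a :: "nat \<Rightarrow> rat"
  shows "(\<Sum>k = 1..n. (-1) ^ (k - 1) * (a k + a (Suc k))) = a 1 - (-1) ^ n * a (Suc n)"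
  by (induction n) (auto simp: algebra_simps)

text \<open>In both parities a letter contributes its total multiplicity in all words: in the
  bosonic case a word is counted once for each \<open>k\<close> up to the multiplicity, in the
  fermionic case one boundary term survives the telescoping.\<close>

lemma sum_rest_words:
  assumes M: "M \<in> L"
  shows "(\<Sum>k = 1..n. (if \<theta> M then -1 else 1) ^ (k - 1) * of_nat (card (rest_words L \<theta> n A M k))) =
    (of_nat (\<Sum>S\<in>words L \<theta> n A. count S M) :: rat)"
proof (cases "\<theta> M")
  case False
  have "(\<Sum>k = 1..n. card (rest_words L \<theta> n A M k)) = (\<Sum>S\<in>words L \<theta> n A. count S M)"
    unfolding card_rest_words_bosonic[of M L \<theta>, OF M False]
  proof (rule sum_card_ge)
    show "count S M \<le> n" if "S \<in> words L \<theta> n A" for S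
      using that count_le_size[of S M] by (simp add: words_def)
  qed simp
  then show ?thesis using False by (simp flip: of_nat_sum)
next
  case True
  let ?a = "\<lambda>k. card {S \<in> rest_words L \<theta> n A M k. M \<notin># S}"
  have "(\<Sum>k = 1..n. (if \<theta> M then -1 else 1) ^ (k - 1) * of_nat (card (rest_words L \<theta> n A M k))) =
      (\<Sum>k = 1..n. (-1) ^ (k - 1) * (of_nat (?a k) + of_nat (?a (Suc k))) :: rat)"
    using True by (simp add: card_rest_words_fermionic[of M L \<theta>, OF M True])
  also have "\<dots> = of_nat (?a 1) - (-1) ^ n * of_nat (?a (Suc n))"
    by (rule alternating_telescope)
  also have "rest_words L \<theta> n A M (Suc n) = {}" by (auto simp: rest_words_def)
  also have "?a 1 = (\<Sum>S\<in>words L \<theta> n A. count S M)"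
  proof -
    have "rest_words L \<theta> n A M 0 = words L \<theta> n A" by (simp add: rest_words_def words_def)
    then have "card (words L \<theta> n A) = card {S \<in> words L \<theta> n A. M \<notin># S} + ?a 1"
      using card_rest_words_fermionic[of M L \<theta>, OF M True, of n A 0] by simp
    moreover have "words L \<theta> n A = {S \<in> words L \<theta> n A. M \<notin># S} \<union> {S \<in> words L \<theta> n A. M \<in># S}" by auto
    then have "card (words L \<theta> n A) = card {S \<in> words L \<theta> n A. M \<notin># S} + card {S \<in> words L \<theta> n A. M \<in># S}"
      by (metis (no_types, lifting) card_Un_disjoint disjoint_iff finite_Un finite_words mem_Collect_eq)
    moreover have "(\<Sum>S\<in>words L \<theta> n A. count S M) = (\<Sum>S\<in>words L \<theta> n A. if M \<in># S then 1 else 0)"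
    proof (rule sum.cong)
      fix S assume "S \<in> words L \<theta> n A"
      then have "count S M \<le> 1" using True by (simp add: words_def)
      then show "count S M = (if M \<in># S then 1 else 0)"
        by (metis One_nat_def Suc_leI count_greater_zero_iff le_antisym not_in_iff)
    qed simp
    moreover have "\<dots> = card {S \<in> words L \<theta> n A. M \<in># S}"
      by (simp add: sum.inter_filter[symmetric])
    ultimately show ?thesis by simp
  qed
  finally show ?thesis by simp
qed

text \<open>The factor \<open>n\<close> is the length of a word, hence the sum of the multiplicities
  of its letters; each letter is handled by \<open>sum_rest_words\<close>.\<close>

lemma newton_alphabet:
  "pscale (of_nat n) (asum L \<theta> n) = (\<Sum>k = 1..n. apow L \<theta> k * asum L \<theta> (n - k))"
proof (rule pser_eqI)
  fix A
  \<comment> \<open>\<open>L\<close> may be infinite, so the sum is restricted to letters dividing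
    \<open>A\<close>; since \<open>k\<close> is positive, this loses nothing.\<close>
  let ?F = "{M \<in> L. M \<subseteq># A}"
  have finF: "finite ?F" by (rule finite_subset[OF _ finite_submultisets[of A]]) auto
  have summand: "coeff (apow L \<theta> k * asum L \<theta> (n - k)) A =
      (\<Sum>M\<in>?F. (if \<theta> M then -1 else 1) ^ (k - 1) * of_nat (card (rest_words L \<theta> n A M k)))"
    if k: "1 \<le> k" "k \<le> n" for k
  proof -
    let ?s = "\<lambda>M. (if \<theta> M then -1 else 1 :: rat) ^ (k - 1)"
    let ?w = "\<lambda>B. of_nat (card (words L \<theta> (n - k) (A - B)))"
    have sub: "M \<subseteq># A" if "repeat_mset k M \<subseteq># A" for M
    proof -
      obtain k' where "k = Suc k'" using k by (cases k) auto
      then have "M \<subseteq># repeat_mset k M" by simp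
      then show ?thesis using that by (rule subset_mset.order_trans)
    qed
    have "coeff (apow L \<theta> k * asum L \<theta> (n - k)) A =
        (\<Sum>B | B \<subseteq># A. \<Sum>M | M \<in> L \<and> repeat_mset k M = B. ?s M * ?w B)"
      by (simp add: coeff_mult coeff_asum apow_def sum_distrib_right)
    also have "\<dots> = (\<Sum>B | B \<subseteq># A. \<Sum>M\<in>?F. if B = repeat_mset k M then ?s M * ?w B else 0)"
    proof (rule sum.cong[OF refl])
      fix B assume "B \<in> {B. B \<subseteq># A}"
      then have "{M. M \<in> L \<and> repeat_mset k M = B} = {M \<in> ?F. B = repeat_mset k M}"
        using sub by auto
      then show "(\<Sum>M | M \<in> L \<and> repeat_mset k M = B. ?s M * ?w B) =
          (\<Sum>M\<in>?F. if B = repeat_mset k M then ?s M * ?w B else 0)"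
        using sum.inter_filter[OF finF, of "\<lambda>M. ?s M * ?w B" "\<lambda>M. B = repeat_mset k M"] by simp
    qed
    also have "\<dots> = (\<Sum>M\<in>?F. \<Sum>B | B \<subseteq># A. if B = repeat_mset k M then ?s M * ?w B else 0)"
      by (rule sum.swap)
    also have "\<dots> = (\<Sum>M\<in>?F. ?s M * of_nat (card (rest_words L \<theta> n A M k)))"
    proof (rule sum.cong[OF refl])
      fix M
      show "(\<Sum>B | B \<subseteq># A. if B = repeat_mset k M then ?s M * ?w B else 0) =
          ?s M * of_nat (card (rest_words L \<theta> n A M k))"
        using rest_words_eq[OF k(2), of M A L \<theta>] rest_words_empty[of k M A L \<theta> n]
        by (simp add: sum.delta)
    qed
    finally show ?thesis .
  qed
  have "coeff (\<Sum>k = 1..n. apow L \<theta> k * asum L \<theta> (n - k)) A =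
      (\<Sum>k = 1..n. \<Sum>M\<in>?F. (if \<theta> M then -1 else 1) ^ (k - 1) * of_nat (card (rest_words L \<theta> n A M k)))"
    unfolding coeff_sum by (rule sum.cong[OF refl]) (rule summand, auto)
  also have "\<dots> = (\<Sum>M\<in>?F. \<Sum>k = 1..n. (if \<theta> M then -1 else 1) ^ (k - 1) * of_nat (card (rest_words L \<theta> n A M k)))"
    by (rule sum.swap)
  also have "\<dots> = of_nat (\<Sum>M\<in>?F. \<Sum>S\<in>words L \<theta> n A. count S M)"
    unfolding of_nat_sum[of _ ?F] by (rule sum.cong[OF refl]) (rule sum_rest_words, auto)
  also have "(\<Sum>M\<in>?F. \<Sum>S\<in>words L \<theta> n A. count S M) = (\<Sum>S\<in>words L \<theta> n A. \<Sum>M\<in>?F. count S M)"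
    by (rule sum.swap)
  also have "\<dots> = (\<Sum>S\<in>words L \<theta> n A. n)"
  proof (rule sum.cong[OF refl])
    fix S assume S: "S \<in> words L \<theta> n A"
    then have "set_mset S \<subseteq> ?F" using letter_subset by (auto simp: words_def)
    then have "(\<Sum>M\<in>?F. count S M) = (\<Sum>M\<in>set_mset S. count S M)"
      using finF by (intro sum.mono_neutral_right) (auto simp: count_eq_zero_iff)
    also have "\<dots> = size S" by (simp add: size_multiset_overloaded_eq)
    finally show "(\<Sum>M\<in>?F. count S M) = n" using S by (simp add: words_def)
  qed
  also have "of_nat \<dots> = coeff (pscale (of_nat n) (asum L \<theta> n)) A"
    by (simp add: coeff_asum)
  finally show "coeff (pscale (of_nat n) (asum L \<theta> n)) A =
      coeff (\<Sum>k = 1..n. apow L \<theta> k * asum L \<theta> (n - k)) A" ..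
qed

lemma asum_0 [simp]: "asum L \<theta> 0 = 1"
proof (rule pser_eqI)
  fix A
  have "words L \<theta> 0 A = (if A = {#} then {{#}} else {})" by (auto simp: words_def)
  then show "coeff (asum L \<theta> 0) A = coeff 1 A" by (simp add: coeff_asum)
qed

abbreviation letters :: "nat multiset set" where
  "letters \<equiv> range (\<lambda>i. {#i#})"

text \<open>A word in single variables is determined by its product.\<close>

lemma asum_letters:
  assumes "\<And>i. \<theta> {#i#} \<longleftrightarrow> \<epsilon> i"
  shows "asum letters \<theta> n = hsym \<epsilon> n"
proof (rule pser_eqI)
  fix A :: "nat multiset"
  let ?S = "image_mset (\<lambda>i. {#i#}) A"
  have inj: "inj (\<lambda>i :: nat. {#i#})" by (simp add: inj_on_def)
  have sum: "sum_mset (image_mset (\<lambda>i. {#i#}) B) = B" for B :: "nat multiset"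
    by (induction B) auto
  have uniq: "S = ?S" if "S \<in> words letters \<theta> n A" for S
  proof -
    have "\<exists>B. S = image_mset (\<lambda>i. {#i#}) B" if "set_mset S \<subseteq> letters" for S
      using that
    proof (induction S)
      case (add M S)
      then obtain i B where "M = {#i#}" "S = image_mset (\<lambda>i. {#i#}) B" by auto
      then show ?case by (intro exI[of _ "add_mset i B"]) simp
    qed simp
    moreover have S: "set_mset S \<subseteq> letters" "sum_mset S = A" using that by (simp_all add: words_def)
    ultimately obtain B where "S = image_mset (\<lambda>i. {#i#}) B" by blast
    then show ?thesis using S(2) sum[of B] by (simp only:)
  qed
  have iff: "?S \<in> words letters \<theta> n A \<longleftrightarrow> size A = n \<and> (\<forall>i. \<epsilon> i \<longrightarrow> count A i \<le> 1)"
  proof -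
    have "(\<forall>M. \<theta> M \<longrightarrow> count ?S M \<le> 1) \<longleftrightarrow> (\<forall>i. \<epsilon> i \<longrightarrow> count A i \<le> 1)"
    proof
      assume *: "\<forall>M. \<theta> M \<longrightarrow> count ?S M \<le> 1"
      show "\<forall>i. \<epsilon> i \<longrightarrow> count A i \<le> 1"
        using * assms count_image_mset_inj[OF inj, of A] by metis
    next
      assume *: "\<forall>i. \<epsilon> i \<longrightarrow> count A i \<le> 1"
      show "\<forall>M. \<theta> M \<longrightarrow> count ?S M \<le> 1"
      proof (intro allI impI)
        fix M assume "\<theta> M"
        show "count ?S M \<le> 1"
        proof (cases "M \<in> letters")
          case True
          then obtain i where "M = {#i#}" by blast
          then show ?thesis using * assms \<open>\<theta> M\<close> count_image_mset_inj[OF inj, of A i] by auto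
        next
          case False
          then have "M \<notin># ?S" by auto
          then have "count ?S M = 0" by (simp only: not_in_iff)
          then show ?thesis by simp
        qed
      qed
    qed
    then show ?thesis by (auto simp: words_def sum)
  qed
  have "words letters \<theta> n A = (if size A = n \<and> (\<forall>i. \<epsilon> i \<longrightarrow> count A i \<le> 1) then {?S} else {})"
    using iff uniq by auto
  then show "coeff (asum letters \<theta> n) A = coeff (hsym \<epsilon> n) A"
    by (simp add: coeff_asum coeff_hsym)
qed

lemma coeff_power_sum: "coeff (power_sum k) A = (if \<exists>i. A = replicate_mset k i then 1 else 0)"
  by (simp add: power_sum_def)

lemma apow_letters:
  assumes "k \<ge> 1" shows "apow letters (\<lambda>_. False) k = power_sum k"
proof (rule pser_eqI)
  fix A
  show "coeff (apow letters (\<lambda>_. False) k) A = coeff (power_sum k) A"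
  proof (cases "\<exists>i. A = replicate_mset k i")
    case True
    then obtain i where A: "A = replicate_mset k i" by blast
    have "{M. M \<in> letters \<and> repeat_mset k M = A} = {{#i#}}"
      using assms by (auto simp: A replicate_mset_eq_iff)
    then show ?thesis using True by (simp add: apow_def coeff_power_sum)
  next
    case False
    then have "{M. M \<in> letters \<and> repeat_mset k M = A} = {}" by auto
    from arg_cong[OF this, of card] show ?thesis using False by (simp add: apow_def coeff_power_sum)
  qed
qed

lemma newton:
  "pscale (of_nat n) (csym False n) = (\<Sum>k = 1..n. power_sum k * csym False (n - k))"
proof -
  have h: "asum letters (\<lambda>_. False) n = csym False n" for n
    by (rule asum_letters) simp_all
  show ?thesis
    using newton_alphabet[of n letters "\<lambda>_. False"] by (simp add: h apow_letters)
qed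

section \<open>The power sum basis\<close>

lemma power_sums_Cons: "power_sums (k # \<alpha>) = power_sum k * power_sums \<alpha>"
  by (simp add: power_sums_def)

lemma power_sums_Nil [simp]: "power_sums [] = 1"
  by (simp add: power_sums_def)

lemma power_sum_Sym [simp, intro]: "power_sum k \<in> Sym"
proof (rule SymI)
  show "bounded_by k (power_sum k)" by (auto simp: bounded_by_def coeff_power_sum split: if_splits)
  show "symf (power_sum k)"
  proof (rule symfI)
    fix \<pi> :: "nat \<Rightarrow> nat" and A assume \<pi>: "bij \<pi>"
    have "(\<exists>i. image_mset \<pi> A = replicate_mset k i) \<longleftrightarrow> (\<exists>i. A = replicate_mset k i)"
    proof
      assume "\<exists>i. image_mset \<pi> A = replicate_mset k i"
      then obtain i where "image_mset \<pi> A = replicate_mset k i" ..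
      then have "image_mset (inv \<pi>) (image_mset \<pi> A) = replicate_mset k (inv \<pi> i)" by simp
      then show "\<exists>i. A = replicate_mset k i" using \<pi> by auto
    qed auto
    then show "coeff (power_sum k) (image_mset \<pi> A) = coeff (power_sum k) A"
      by (simp add: coeff_power_sum)
  qed
qed

lemma power_sums_Sym [simp, intro]: "power_sums \<alpha> \<in> Sym"
  unfolding power_sums_def by (intro Sym_prod_list) simp

text \<open>The type of a monomial as a partition: its nonzero exponents, without the
  variables.\<close>

definition mtype :: "nat multiset \<Rightarrow> nat multiset" where
  "mtype A = image_mset (count A) (mset_set (set_mset A))"

lemma mtype_add:
  assumes "i \<notin># A" "k \<ge> 1" shows "mtype (replicate_mset k i + A) = add_mset k (mtype A)"
proof -
  have "mtype (replicate_mset k i + A) =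
      image_mset (count (replicate_mset k i + A)) (mset_set (insert i (set_mset A)))"
    using assms(2) by (simp add: mtype_def)
  also have "\<dots> = add_mset k (image_mset (count (replicate_mset k i + A)) (mset_set (set_mset A)))"
    using assms(1) by (simp add: not_in_iff)
  also have "image_mset (count (replicate_mset k i + A)) (mset_set (set_mset A)) = mtype A"
    unfolding mtype_def by (rule image_mset_cong) (use assms(1) in auto)
  finally show ?thesis .
qed

text \<open>A monomial of \<open>p\<^sub>\<alpha>\<close> arises from \<open>\<alpha>\<close> by merging parts, so it has at most as many distinct
  variables as \<open>\<alpha>\<close> has parts.\<close>

lemma coeff_power_sums:
  assumes "0 \<notin> set \<alpha>"
  shows "coeff (power_sums \<alpha>) A \<ge> 0 \<and>
    (coeff (power_sums \<alpha>) A \<noteq> 0 \<longrightarrow> card (set_mset A) \<le> length \<alpha> \<and>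
      (card (set_mset A) = length \<alpha> \<longrightarrow> mtype A = mset \<alpha>)) \<and>
    (mtype A = mset \<alpha> \<longrightarrow> coeff (power_sums \<alpha>) A > 0)"
  using assms
proof (induction \<alpha> arbitrary: A)
  case Nil
  have "mtype A = {#} \<longleftrightarrow> A = {#}"
    by (metis finite_set_mset image_mset_is_empty_iff mset_set_empty_iff mtype_def set_mset_eq_empty_iff)
  then show ?case by auto
next
  case (Cons k \<alpha>)
  then have k: "k \<ge> 1" and \<alpha>: "0 \<notin> set \<alpha>" by auto
  have nonneg: "coeff (power_sum k) B * coeff (power_sums \<alpha>) (A - B) \<ge> 0" for B
    using Cons.IH[OF \<alpha>] by (simp add: coeff_power_sum)
  have ge: "coeff (power_sums (k # \<alpha>)) A \<ge> coeff (power_sum k) B * coeff (power_sums \<alpha>) (A - B)"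
    if "B \<subseteq># A" for B
    unfolding power_sums_Cons coeff_mult
    by (rule member_le_sum[of B _ "\<lambda>B. coeff (power_sum k) B * coeff (power_sums \<alpha>) (A - B)"])
      (use that nonneg in auto)
  have "coeff (power_sums (k # \<alpha>)) A \<ge> 0"
    using nonneg by (simp add: power_sums_Cons coeff_mult sum_nonneg)
  moreover have "card (set_mset A) \<le> Suc (length \<alpha>) \<and>
      (card (set_mset A) = Suc (length \<alpha>) \<longrightarrow> mtype A = add_mset k (mset \<alpha>))"
    if nz: "coeff (power_sums (k # \<alpha>)) A \<noteq> 0"
  proof -
    obtain B C where A: "A = B + C" and B: "coeff (power_sum k) B \<noteq> 0"
      and C: "coeff (power_sums \<alpha>) C \<noteq> 0"
      using nz unfolding power_sums_Cons by (rule coeff_mult_nonzeroE)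
    obtain i where i: "B = replicate_mset k i" using B by (auto simp: coeff_power_sum split: if_splits)
    have set: "set_mset A = insert i (set_mset C)" using k by (simp add: A i)
    have cC: "card (set_mset C) \<le> length \<alpha>" "card (set_mset C) = length \<alpha> \<longrightarrow> mtype C = mset \<alpha>"
      using Cons.IH[OF \<alpha>, of C] C by auto
    show ?thesis
    proof (cases "i \<in># C")
      case True
      then show ?thesis using cC(1) by (simp add: set insert_absorb)
    next
      case False
      then show ?thesis using cC mtype_add[OF False k] by (simp add: set A i)
    qed
  qed
  moreover have "coeff (power_sums (k # \<alpha>)) A > 0" if "mtype A = add_mset k (mset \<alpha>)"
  proof -
    have "k \<in># mtype A" using that by simp
    then obtain i where i: "i \<in># A" "count A i = k" by (auto simp: mtype_def)
    define C where "C = filter_mset (\<lambda>j. j \<noteq> i) A"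
    have A: "A = replicate_mset k i + C" by (rule multiset_eqI) (auto simp: C_def i)
    have "i \<notin># C" by (simp add: C_def)
    then have "mtype C = mset \<alpha>" using that mtype_add[of i C k] k A by simp
    then have "coeff (power_sums \<alpha>) C > 0" using Cons.IH[OF \<alpha>] by blast
    then have "0 < coeff (power_sum k) (replicate_mset k i) * coeff (power_sums \<alpha>) (A - replicate_mset k i)"
      by (auto simp: A coeff_power_sum)
    also have "\<dots> \<le> coeff (power_sums (k # \<alpha>)) A" by (rule ge) (simp add: A)
    finally show ?thesis .
  qed
  ultimately show ?case by simp
qed

lemma ex_mtype: "0 \<notin> set \<alpha> \<Longrightarrow> \<exists>A. mtype A = mset \<alpha>"
proof (induction \<alpha>)
  case Nil
  then show ?case by (intro exI[of _ "{#}"]) (simp add: mtype_def)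
next
  case (Cons k \<alpha>)
  then obtain A where A: "mtype A = mset \<alpha>" by auto
  obtain i where "i \<notin># A" by (metis ex_new_if_finite finite_set_mset infinite_UNIV_nat)
  then show ?case using Cons.prems A mtype_add[of i A k] by (intro exI[of _ "replicate_mset k i + A"]) auto
qed

lemma partition_mset_inj:
  assumes "is_partition \<alpha>" "is_partition \<beta>" "mset \<alpha> = mset \<beta>" shows "\<alpha> = \<beta>"
proof -
  have "sorted (rev \<alpha>)" "sorted (rev \<beta>)" using assms by (auto simp: is_partition_def sorted_wrt_rev)
  moreover have "mset (rev \<alpha>) = mset (rev \<beta>)" using assms(3) by simp
  ultimately have "sort (rev \<beta>) = rev \<alpha>" by (intro properties_for_sort)
  moreover have "sort (rev \<beta>) = rev \<beta>"
    using \<open>sorted (rev \<beta>)\<close> by (rule sorted_sort_id)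
  ultimately show ?thesis by simp
qed

text \<open>Among the partitions with nonzero coefficient a longest one, \<beta>, is chosen. A
  monomial of type \<beta> has as many variables as \<beta> has parts, so by
  \<open>coeff_power_sums\<close> none of the other products contains it.\<close>

lemma power_sums_lin_indep:
  assumes "finite S" "\<And>\<alpha>. \<alpha> \<in> S \<Longrightarrow> is_partition \<alpha>" "(\<Sum>\<alpha>\<in>S. pscale (c \<alpha>) (power_sums \<alpha>)) = 0"
    "\<alpha> \<in> S"
  shows "c \<alpha> = 0"
proof (rule ccontr)
  assume "c \<alpha> \<noteq> 0"
  let ?T = "{\<alpha> \<in> S. c \<alpha> \<noteq> 0}"
  have "finite ?T" "?T \<noteq> {}" using assms(1,4) \<open>c \<alpha> \<noteq> 0\<close> by auto
  then have "Max (length ` ?T) \<in> length ` ?T" by (intro Max_in) auto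
  then obtain \<beta> where \<beta>: "\<beta> \<in> ?T" and "length \<beta> = Max (length ` ?T)" by force
  then have max: "\<And>\<gamma>. \<gamma> \<in> ?T \<Longrightarrow> length \<gamma> \<le> length \<beta>" using \<open>finite ?T\<close> by simp
  have \<beta>': "0 \<notin> set \<beta>" using \<beta> assms(2) by (simp add: is_partition_def)
  obtain A where A: "mtype A = mset \<beta>" using ex_mtype[OF \<beta>'] by blast
  have cA: "card (set_mset A) = length \<beta>"
    using arg_cong[OF A, of size] by (simp add: mtype_def)
  have "coeff (\<Sum>\<alpha>\<in>S. pscale (c \<alpha>) (power_sums \<alpha>)) A =
      (\<Sum>\<gamma>\<in>S. if \<gamma> = \<beta> then c \<beta> * coeff (power_sums \<beta>) A else 0)"
    unfolding coeff_sum
  proof (rule sum.cong[OF refl])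
    fix \<gamma> assume \<gamma>: "\<gamma> \<in> S"
    have "c \<gamma> = 0 \<or> coeff (power_sums \<gamma>) A = 0" if "\<gamma> \<noteq> \<beta>"
    proof (rule ccontr)
      assume *: "\<not> (c \<gamma> = 0 \<or> coeff (power_sums \<gamma>) A = 0)"
      then have "length \<gamma> \<le> length \<beta>" using max[of \<gamma>] \<gamma> by simp
      moreover have "0 \<notin> set \<gamma>" using \<gamma> assms(2) by (simp add: is_partition_def)
      ultimately have "mset \<gamma> = mset \<beta>" using coeff_power_sums[of \<gamma> A] * A cA by auto
      then show False using partition_mset_inj[of \<gamma> \<beta>] assms(2) \<gamma> \<beta> that by auto
    qed
    then show "coeff (pscale (c \<gamma>) (power_sums \<gamma>)) A =
        (if \<gamma> = \<beta> then c \<beta> * coeff (power_sums \<beta>) A else 0)" by auto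
  qed
  also have "\<dots> = c \<beta> * coeff (power_sums \<beta>) A" using assms(1) \<beta> by simp
  also have "\<dots> \<noteq> 0" using \<beta> coeff_power_sums[OF \<beta>', of A] A by auto
  finally show False using assms(3) by simp
qed

lemma power_sums_inj:
  assumes "is_partition \<alpha>" "is_partition \<beta>" "power_sums \<alpha> = power_sums \<beta>" shows "\<alpha> = \<beta>"
proof (rule ccontr)
  assume "\<alpha> \<noteq> \<beta>"
  then have "(\<Sum>\<gamma>\<in>{\<alpha>, \<beta>}. pscale (if \<gamma> = \<alpha> then 1 else -1) (power_sums \<gamma>)) = 0"
    using assms(3) by auto
  from power_sums_lin_indep[OF _ _ this, of \<alpha>] show False using assms by auto
qed

lemma independent_power_sums: "pser.independent power_sum_basis"
proof
  assume "pser.dependent power_sum_basis"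
  then obtain S u v where S: "finite S" "S \<subseteq> power_sum_basis" "v \<in> S" "u v \<noteq> 0"
    and sum: "(\<Sum>v\<in>S. pscale (u v) v) = 0"
    unfolding pser.dependent_explicit by blast
  obtain T where T: "finite T" "T \<subseteq> {\<alpha>. is_partition \<alpha>}" "S = power_sums ` T"
    using S unfolding power_sum_basis_def by (meson finite_subset_image)
  have "inj_on power_sums T" using power_sums_inj T(2) by (auto simp: inj_on_def)
  then have "(\<Sum>\<alpha>\<in>T. pscale (u (power_sums \<alpha>)) (power_sums \<alpha>)) = 0"
    using sum unfolding T(3) by (simp add: sum.reindex)
  moreover obtain \<alpha> where "\<alpha> \<in> T" "v = power_sums \<alpha>" using S(3) T(3) by blast
  ultimately show False
    using power_sums_lin_indep[OF T(1), of "\<lambda>\<alpha>. u (power_sums \<alpha>)" \<alpha>] T(2) S(4) by auto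
qed

lemma is_partition_sort: "0 \<notin> set xs \<Longrightarrow> is_partition (rev (sort xs))"
  by (simp add: is_partition_def sorted_wrt_rev)

lemma prod_list_sort: "(\<Prod>k\<leftarrow>rev (sort xs). f k) = (\<Prod>k\<leftarrow>xs. f k)" for f :: "nat \<Rightarrow> 'a :: comm_monoid_mult"
proof -
  have "mset (map f (rev (sort xs))) = mset (map f xs)" by simp
  then show ?thesis by (metis prod_mset_prod_list)
qed

lemma power_sums_span: "0 \<notin> set xs \<Longrightarrow> power_sums xs \<in> pser.span power_sum_basis"
proof (rule pser.span_base)
  assume "0 \<notin> set xs"
  moreover have "power_sums xs = power_sums (rev (sort xs))"
    by (simp only: power_sums_def prod_list_sort)
  ultimately show "power_sums xs \<in> power_sum_basis"
    unfolding power_sum_basis_def using is_partition_sort by blast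
qed

lemma power_sums_append: "power_sums (\<alpha> @ \<beta>) = power_sums \<alpha> * power_sums \<beta>"
  by (simp add: power_sums_def)

lemma span_power_sums_mult:
  assumes "f \<in> pser.span power_sum_basis" "g \<in> pser.span power_sum_basis"
  shows "f * g \<in> pser.span power_sum_basis"
  using assms(1)
proof (induction rule: pser.span_induct_alt)
  case base
  then show ?case by (simp add: pser.span_zero)
next
  case (step c x y)
  from step(1) obtain \<alpha> where \<alpha>: "is_partition \<alpha>" "x = power_sums \<alpha>" by (auto simp: power_sum_basis_def)
  have "x * g \<in> pser.span power_sum_basis"
    using assms(2)
  proof (induction rule: pser.span_induct_alt)
    case base
    then show ?case by (simp add: pser.span_zero)
  next
    case (step d u v)
    from step(1) obtain \<beta> where \<beta>: "is_partition \<beta>" "u = power_sums \<beta>" by (auto simp: power_sum_basis_def)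
    have "x * u \<in> pser.span power_sum_basis"
      unfolding \<alpha> \<beta> power_sums_append[symmetric]
      using \<alpha> \<beta> by (intro power_sums_span) (auto simp: is_partition_def)
    then show ?case using step by (simp add: distrib_left pser.span_add pser.span_scale)
  qed
  then show ?case using step by (simp add: distrib_right pser.span_add pser.span_scale)
qed

lemma pscale_of_nat_cancel:
  assumes "pscale (of_nat n) f = g" "n \<noteq> 0" shows "f = pscale (1 / of_nat n) g"
  using assms by auto

text \<open>Newton's identity is divided by \<open>n\<close>, for which rational coefficients are
  essential.\<close>

lemma csym_span: "csym False n \<in> pser.span power_sum_basis"
proof (induction n rule: less_induct)
  case (less n)
  have one: "1 \<in> pser.span power_sum_basis" using power_sums_span[of "[]"] by simp
  show ?case
  proof (cases "n = 0")
    case False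
    have "power_sum k * csym False (n - k) \<in> pser.span power_sum_basis" if "k \<in> {1..n}" for k
    proof (rule span_power_sums_mult)
      show "power_sum k \<in> pser.span power_sum_basis"
        using power_sums_span[of "[k]"] that by (simp add: power_sums_def)
      show "csym False (n - k) \<in> pser.span power_sum_basis" using less that False by simp
    qed
    then show ?thesis
      unfolding pscale_of_nat_cancel[OF newton False] by (intro pser.span_scale pser.span_sum)
  qed (simp add: one)
qed

text \<open>Schur functions are polynomials in the complete functions by
  \<open>jacobi_trudi\<close>, and these are polynomials in the power sums.\<close>

lemma Sym_eq_span: "Sym = pser.span power_sum_basis"
proof
  show "pser.span power_sum_basis \<subseteq> Sym"
  proof
    fix f assume "f \<in> pser.span power_sum_basis"
    then show "f \<in> Sym"
      by (induction rule: pser.span_induct_alt) (auto simp: power_sum_basis_def)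
  qed
  have prod: "prod f S \<in> pser.span power_sum_basis"
    if "finite S" "\<And>x. x \<in> S \<Longrightarrow> f x \<in> pser.span power_sum_basis" for f :: "nat \<Rightarrow> pser" and S
    using that
  proof (induction S rule: finite_induct)
    case empty
    then show ?case using power_sums_span[of "[]"] by simp
  qed (simp add: span_power_sums_mult)
  have schur: "schur \<alpha> \<in> pser.span power_sum_basis" if "is_partition \<alpha>" for \<alpha>
    unfolding jacobi_trudi[OF that] csprod_def
    by (intro pser.span_sum pser.span_scale prod csym_span) simp
  show "Sym \<subseteq> pser.span power_sum_basis"
  proof
    fix f assume f: "f \<in> Sym"
    then obtain d where d: "bounded_by d f" by (rule Sym_boundedE)
    show "f \<in> pser.span power_sum_basis"
      by (subst Sym_expansion[OF f d], intro pser.span_sum pser.span_scale schur)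
        (simp add: partitions_le_def)
  qed
qed

section \<open>Algebra homomorphisms on symmetric functions\<close>

text \<open>The maps are total on power series but constrained on \<open>Sym\<close> only:
  substitutions are defined through coordinates, which are meaningful only on the span of the
  basis.\<close>

definition sym_hom :: "(pser \<Rightarrow> pser) \<Rightarrow> bool" where
  "sym_hom F \<longleftrightarrow> F 1 = 1 \<and> (\<forall>f\<in>Sym. \<forall>g\<in>Sym. F (f + g) = F f + F g \<and> F (f * g) = F f * F g) \<and>
     (\<forall>c. \<forall>f\<in>Sym. F (pscale c f) = pscale c (F f))"

lemma sym_homD:
  assumes "sym_hom F"
  shows "F 1 = 1" "f \<in> Sym \<Longrightarrow> g \<in> Sym \<Longrightarrow> F (f + g) = F f + F g"
    "f \<in> Sym \<Longrightarrow> g \<in> Sym \<Longrightarrow> F (f * g) = F f * F g" "f \<in> Sym \<Longrightarrow> F (pscale c f) = pscale c (F f)"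
  using assms by (auto simp: sym_hom_def)

lemma sym_hom_0: assumes "sym_hom F" shows "F 0 = 0"
  using sym_homD(4)[OF assms Sym_one, of 0] by simp

lemma sym_hom_sum:
  assumes "sym_hom F" "\<And>x. x \<in> S \<Longrightarrow> f x \<in> Sym" shows "F (sum f S) = (\<Sum>x\<in>S. F (f x))"
  using assms(2)
proof (induction S rule: infinite_finite_induct)
  case (insert x S)
  then show ?case using sym_homD(2)[OF assms(1), of "f x" "sum f S"] by (simp add: Sym_sum)
qed (simp_all add: sym_hom_0[OF assms(1)])

lemma sym_hom_prod:
  assumes "sym_hom F" "\<And>x. x \<in> S \<Longrightarrow> f x \<in> Sym" shows "F (prod f S) = (\<Prod>x\<in>S. F (f x))"
  using assms(2)
proof (induction S rule: infinite_finite_induct)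
  case (insert x S)
  then show ?case using sym_homD(3)[OF assms(1), of "f x" "prod f S"] by (simp add: Sym_prod)
qed (simp_all add: sym_homD[OF assms(1)])

lemma sym_hom_comp:
  assumes "sym_hom F" "\<And>f. f \<in> Sym \<Longrightarrow> F f \<in> Sym" "sym_hom G"
  shows "sym_hom (\<lambda>f. G (F f))"
  unfolding sym_hom_def
  using assms(2) by (auto simp: sym_homD[OF assms(1)] sym_homD[OF assms(3)])

lemma Sym_induct [consumes 1, case_names zero step]:
  assumes "f \<in> Sym" "P 0"
    "\<And>c \<alpha> g. 0 \<notin> set \<alpha> \<Longrightarrow> g \<in> Sym \<Longrightarrow> P g \<Longrightarrow> P (pscale c (power_sums \<alpha>) + g)"
  shows "P f"
proof -
  have "f \<in> Sym \<and> P f"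
    using assms(1) unfolding Sym_eq_span
  proof (induction rule: pser.span_induct_alt)
    case base
    then show ?case using assms(2) by (simp add: pser.span_zero)
  next
    case (step c x y)
    then obtain \<alpha> where \<alpha>: "is_partition \<alpha>" "x = power_sums \<alpha>" by (auto simp: power_sum_basis_def)
    then have "0 \<notin> set \<alpha>" by (simp add: is_partition_def)
    then show ?case
      using step assms(3)[of \<alpha> y c] \<alpha> power_sums_Sym unfolding Sym_eq_span
      by (auto intro: pser.span_add pser.span_scale)
  qed
  then show ?thesis ..
qed

lemma sym_hom_eqI:
  assumes F: "sym_hom F" and G: "sym_hom G"
    and eq: "\<And>k. 1 \<le> k \<Longrightarrow> F (power_sum k) = G (power_sum k)" and "f \<in> Sym"
  shows "F f = G f"
  using assms(4)
proof (induction rule: Sym_induct)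
  case zero
  then show ?case by (simp add: sym_hom_0 F G)
next
  case (step c \<alpha> g)
  have "F (power_sums \<alpha>) = G (power_sums \<alpha>)"
    using step(1)
  proof (induction \<alpha>)
    case (Cons k \<alpha>)
    then show ?case using eq[of k]
      by (simp add: power_sums_Cons sym_homD(3)[OF F] sym_homD(3)[OF G] Suc_le_eq)
  qed (simp add: sym_homD(1)[OF F] sym_homD(1)[OF G])
  then show ?case
    using step by (simp add: sym_homD(2,4)[OF F] sym_homD(2,4)[OF G] Sym_pscale)
qed

text \<open>The images of the complete functions satisfy the recursion of
  \<open>newton_alphabet\<close>, which determines them from the images of the power sums.\<close>

lemma sym_hom_newton:
  assumes F: "sym_hom F" and P: "\<And>k. 1 \<le> k \<Longrightarrow> F (power_sum k) = apow L \<theta> k"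
  shows "F (csym False n) = asum L \<theta> n"
proof (induction n rule: less_induct)
  case (less n)
  show ?case
  proof (cases "n = 0")
    case False
    have "pscale (of_nat n) (F (csym False n)) = F (\<Sum>k = 1..n. power_sum k * csym False (n - k))"
      unfolding sym_homD(4)[OF F csym_Sym, symmetric] newton ..
    also have "\<dots> = (\<Sum>k = 1..n. F (power_sum k * csym False (n - k)))"
      by (rule sym_hom_sum[OF F]) auto
    also have "\<dots> = (\<Sum>k = 1..n. apow L \<theta> k * asum L \<theta> (n - k))"
      using less False by (intro sum.cong) (auto simp: sym_homD(3)[OF F] P)
    also have "\<dots> = pscale (of_nat n) (asum L \<theta> n)" by (rule newton_alphabet[symmetric])
    finally show ?thesis
      using pscale_of_nat_cancel[OF _ False] by metis
  qed (simp add: sym_homD(1)[OF F])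
qed

subsection \<open>Substitutions\<close>

text \<open>Common form of \<open>plethysm\<close> and of the super evaluation \<open>Phi\<close>:
  the homomorphism prescribed on power sums.\<close>

definition subst_power :: "(nat \<Rightarrow> pser) \<Rightarrow> pser \<Rightarrow> pser" where
  "subst_power P f = (\<Sum>\<alpha> | is_partition \<alpha> \<and> power_sum_coeff f \<alpha> \<noteq> 0.
     pscale (power_sum_coeff f \<alpha>) (\<Prod>k\<leftarrow>\<alpha>. P k))"

lemma finite_power_support: "finite {\<alpha>. is_partition \<alpha> \<and> power_sum_coeff f \<alpha> \<noteq> 0}"
proof (rule inj_on_finite)
  show "inj_on power_sums {\<alpha>. is_partition \<alpha> \<and> power_sum_coeff f \<alpha> \<noteq> 0}"
    using power_sums_inj by (auto simp: inj_on_def)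
  show "power_sums ` {\<alpha>. is_partition \<alpha> \<and> power_sum_coeff f \<alpha> \<noteq> 0} \<subseteq>
      {b. pser.representation power_sum_basis f b \<noteq> 0}"
    by (auto simp: power_sum_coeff_def)
qed (rule pser.finite_representation)

lemma subst_power_superset:
  assumes "finite S" "\<And>\<alpha>. \<alpha> \<in> S \<Longrightarrow> is_partition \<alpha>"
    "\<And>\<alpha>. is_partition \<alpha> \<Longrightarrow> power_sum_coeff f \<alpha> \<noteq> 0 \<Longrightarrow> \<alpha> \<in> S"
  shows "subst_power P f = (\<Sum>\<alpha>\<in>S. pscale (power_sum_coeff f \<alpha>) (\<Prod>k\<leftarrow>\<alpha>. P k))"
  unfolding subst_power_def by (rule sum.mono_neutral_left) (use assms in auto)

lemma power_sum_coeff_add: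
  "f \<in> Sym \<Longrightarrow> g \<in> Sym \<Longrightarrow> power_sum_coeff (f + g) \<alpha> = power_sum_coeff f \<alpha> + power_sum_coeff g \<alpha>"
  unfolding power_sum_coeff_def Sym_eq_span
  by (simp add: pser.representation_add[OF independent_power_sums])

lemma power_sum_coeff_pscale:
  "f \<in> Sym \<Longrightarrow> power_sum_coeff (pscale c f) \<alpha> = c * power_sum_coeff f \<alpha>"
  unfolding power_sum_coeff_def Sym_eq_span
  by (simp add: pser.representation_scale[OF independent_power_sums])

lemma power_sum_coeff_power_sums:
  assumes "is_partition \<alpha>" "is_partition \<beta>"
  shows "power_sum_coeff (power_sums \<alpha>) \<beta> = (if \<alpha> = \<beta> then 1 else 0)"
proof -
  have "power_sums \<alpha> \<in> power_sum_basis" using assms by (simp add: power_sum_basis_def)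
  then show ?thesis
    using assms power_sums_inj[of \<alpha> \<beta>]
    by (auto simp: power_sum_coeff_def pser.representation_basis[OF independent_power_sums])
qed

lemma subst_power_add:
  assumes "f \<in> Sym" "g \<in> Sym"
  shows "subst_power P (f + g) = subst_power P f + subst_power P g"
proof -
  let ?S = "{\<alpha>. is_partition \<alpha> \<and> power_sum_coeff f \<alpha> \<noteq> 0} \<union> {\<alpha>. is_partition \<alpha> \<and> power_sum_coeff g \<alpha> \<noteq> 0}"
  have fin: "finite ?S" by (simp add: finite_power_support)
  have 1: "subst_power P f = (\<Sum>\<alpha>\<in>?S. pscale (power_sum_coeff f \<alpha>) (\<Prod>k\<leftarrow>\<alpha>. P k))"
    by (rule subst_power_superset[OF fin]) auto
  have 2: "subst_power P g = (\<Sum>\<alpha>\<in>?S. pscale (power_sum_coeff g \<alpha>) (\<Prod>k\<leftarrow>\<alpha>. P k))"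
    by (rule subst_power_superset[OF fin]) auto
  have "subst_power P (f + g) = (\<Sum>\<alpha>\<in>?S. pscale (power_sum_coeff (f + g) \<alpha>) (\<Prod>k\<leftarrow>\<alpha>. P k))"
    by (rule subst_power_superset[OF fin]) (auto simp: power_sum_coeff_add assms)
  then show ?thesis
    unfolding 1 2 by (simp add: power_sum_coeff_add assms pser.scale_left_distrib sum.distrib)
qed

lemma subst_power_pscale:
  assumes "f \<in> Sym" shows "subst_power P (pscale c f) = pscale c (subst_power P f)"
proof -
  have "subst_power P (pscale c f) =
      (\<Sum>\<alpha> | is_partition \<alpha> \<and> power_sum_coeff f \<alpha> \<noteq> 0. pscale (power_sum_coeff (pscale c f) \<alpha>) (\<Prod>k\<leftarrow>\<alpha>. P k))"
    by (rule subst_power_superset[OF finite_power_support]) (auto simp: power_sum_coeff_pscale assms)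
  then show ?thesis
    by (simp add: power_sum_coeff_pscale assms subst_power_def pscale_sum)
qed

lemma subst_power_power_sums:
  assumes "0 \<notin> set \<alpha>" shows "subst_power P (power_sums \<alpha>) = (\<Prod>k\<leftarrow>\<alpha>. P k)"
proof -
  let ?\<beta> = "rev (sort \<alpha>)"
  have \<beta>: "is_partition ?\<beta>" using assms by (rule is_partition_sort)
  have "power_sums \<alpha> = power_sums ?\<beta>" by (simp only: power_sums_def prod_list_sort)
  moreover have "subst_power P (power_sums ?\<beta>) =
      (\<Sum>\<alpha>\<in>{?\<beta>}. pscale (power_sum_coeff (power_sums ?\<beta>) \<alpha>) (\<Prod>k\<leftarrow>\<alpha>. P k))"
    by (rule subst_power_superset)
      (use \<beta> in \<open>auto simp: power_sum_coeff_power_sums split: if_splits\<close>)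
  moreover have "\<dots> = (\<Prod>k\<leftarrow>?\<beta>. P k)"
    by (simp add: power_sum_coeff_power_sums \<beta>)
  ultimately show ?thesis by (simp only: prod_list_sort)
qed

lemma subst_power_mult:
  assumes "f \<in> Sym" "g \<in> Sym"
  shows "subst_power P (f * g) = subst_power P f * subst_power P g"
  using assms(1)
proof (induction rule: Sym_induct)
  case zero
  then show ?case using subst_power_pscale[OF Sym_one, of P 0] by simp
next
  case (step c \<alpha> f)
  note outer = step
  have "subst_power P (power_sums \<alpha> * g) = subst_power P (power_sums \<alpha>) * subst_power P g"
    using assms(2)
  proof (induction rule: Sym_induct)
    case zero
    then show ?case using subst_power_pscale[OF Sym_one, of P 0] by simp
  next
    case (step d \<beta> g)
    have "subst_power P (power_sums \<alpha> * power_sums \<beta>) =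
        subst_power P (power_sums \<alpha>) * subst_power P (power_sums \<beta>)"
      using outer(1) step(1) by (simp add: subst_power_power_sums flip: power_sums_append)
    then show ?case
      using step by (simp add: distrib_left subst_power_add subst_power_pscale Sym_mult Sym_pscale)
  qed
  then show ?case
    using step assms(2)
    by (simp add: distrib_right subst_power_add subst_power_pscale Sym_mult Sym_pscale)
qed

lemma sym_hom_subst_power [simp]: "sym_hom (subst_power P)"
proof -
  have "subst_power P 1 = 1" using subst_power_power_sums[of "[]" P] by simp
  then show ?thesis
    unfolding sym_hom_def by (simp add: subst_power_add subst_power_mult subst_power_pscale)
qed

lemma subst_power_power_sum: "1 \<le> k \<Longrightarrow> subst_power P (power_sum k) = P k"
  using subst_power_power_sums[of "[k]" P] by (simp add: power_sums_def)

lemma subst_power_Sym: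
  assumes "\<And>k. 1 \<le> k \<Longrightarrow> P k \<in> Sym" shows "subst_power P f \<in> Sym"
  unfolding subst_power_def
proof (intro Sym_sum Sym_pscale Sym_prod_list)
  fix \<alpha> k assume "\<alpha> \<in> {\<alpha>. is_partition \<alpha> \<and> power_sum_coeff f \<alpha> \<noteq> 0}" "k \<in> set \<alpha>"
  then have "k \<noteq> 0" unfolding is_partition_def by (metis mem_Collect_eq)
  then show "P k \<in> Sym" using assms by simp
qed

subsection \<open>Signed Adams operations\<close>

definition sgm :: "(nat \<Rightarrow> bool) \<Rightarrow> nat multiset \<Rightarrow> rat" where
  "sgm \<epsilon> M = (\<Prod>i\<in>#M. if \<epsilon> i then -1 else 1)"

lemma sgm_empty [simp]: "sgm \<epsilon> {#} = 1"
  by (simp add: sgm_def)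

lemma sgm_add_mset [simp]: "sgm \<epsilon> (add_mset i M) = (if \<epsilon> i then -1 else 1) * sgm \<epsilon> M"
  by (simp add: sgm_def)

lemma sgm_union [simp]: "sgm \<epsilon> (A + B) = sgm \<epsilon> A * sgm \<epsilon> B"
  by (simp add: sgm_def)

lemma sgm_repeat: "sgm \<epsilon> (repeat_mset k A) = sgm \<epsilon> A ^ k"
  by (induction k) simp_all

lemma sgm_cases: "sgm \<epsilon> A = 1 \<or> sgm \<epsilon> A = -1"
  by (induction A) auto

lemma sgm_False [simp]: "sgm (\<lambda>_. False) A = 1"
  by (induction A) auto

text \<open>A signed Adams operation. A fermionic variable contributes (-1)^(k-1) times its k-th
  power to the k-th power sum; taking this sign for every variable of \<open>B\<close> gives the
  exponent \<open>k - 1\<close> of \<open>sgm\<close> and keeps the operation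
  multiplicative.\<close>

definition tau :: "(nat \<Rightarrow> bool) \<Rightarrow> nat \<Rightarrow> pser \<Rightarrow> pser" where
  "tau \<epsilon> k g = Pser (\<lambda>A. \<Sum>B | repeat_mset k B = A. sgm \<epsilon> B ^ (k - 1) * coeff g B)"

lemma adams_eq_tau: "adams k g = tau (\<lambda>_. False) k g"
  by (simp add: adams_def tau_def)

lemma coeff_tau_repeat:
  assumes "1 \<le> k"
  shows "coeff (tau \<epsilon> k g) (repeat_mset k B) = sgm \<epsilon> B ^ (k - 1) * coeff g B"
proof -
  have "{C. repeat_mset k C = repeat_mset k B} = {B}"
    using assms by (auto simp: repeat_mset_cancel1)
  then show ?thesis by (simp add: tau_def)
qed

lemma coeff_tau_0: "\<nexists>B. A = repeat_mset k B \<Longrightarrow> coeff (tau \<epsilon> k g) A = 0"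
proof -
  assume "\<nexists>B. A = repeat_mset k B"
  then have "{B. repeat_mset k B = A} = {}" by auto
  then show ?thesis unfolding tau_def coeff_Pser by (simp only: sum.empty)
qed

lemma tau_add: "tau \<epsilon> k (f + g) = tau \<epsilon> k f + tau \<epsilon> k g"
  by (rule pser_eqI) (simp add: tau_def distrib_left sum.distrib)

lemma tau_pscale: "tau \<epsilon> k (pscale c f) = pscale c (tau \<epsilon> k f)"
  by (rule pser_eqI) (simp add: tau_def sum_distrib_left mult.left_commute)

lemma repeat_subset_iff:
  assumes "1 \<le> k" shows "repeat_mset k C \<subseteq># repeat_mset k B \<longleftrightarrow> C \<subseteq># B"
  using assms by (auto simp: subseteq_mset_def)

lemma tau_mult:
  assumes k: "1 \<le> k" shows "tau \<epsilon> k (f * g) = tau \<epsilon> k f * tau \<epsilon> k g"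
proof (rule pser_eqI)
  fix A
  show "coeff (tau \<epsilon> k (f * g)) A = coeff (tau \<epsilon> k f * tau \<epsilon> k g) A"
  proof (cases "\<exists>B. A = repeat_mset k B")
    case True
    then obtain B where A: "A = repeat_mset k B" ..
    have inj: "inj_on (repeat_mset k) {C. C \<subseteq># B}"
      using k by (auto simp: inj_on_def repeat_mset_cancel1)
    have "coeff (tau \<epsilon> k f * tau \<epsilon> k g) A =
        (\<Sum>D\<in>repeat_mset k ` {C. C \<subseteq># B}. coeff (tau \<epsilon> k f) D * coeff (tau \<epsilon> k g) (A - D))"
      unfolding coeff_mult
    proof (rule sum.mono_neutral_right)
      show "repeat_mset k ` {C. C \<subseteq># B} \<subseteq> {D. D \<subseteq># A}"
        using k by (auto simp: A repeat_subset_iff)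
      show "\<forall>D\<in>{D. D \<subseteq># A} - repeat_mset k ` {C. C \<subseteq># B}.
          coeff (tau \<epsilon> k f) D * coeff (tau \<epsilon> k g) (A - D) = 0"
      proof
        fix D assume D: "D \<in> {D. D \<subseteq># A} - repeat_mset k ` {C. C \<subseteq># B}"
        then have "\<nexists>C. D = repeat_mset k C" using repeat_subset_iff[OF k] by (auto simp: A)
        then show "coeff (tau \<epsilon> k f) D * coeff (tau \<epsilon> k g) (A - D) = 0"
          by (simp add: coeff_tau_0)
      qed
    qed simp
    also have "\<dots> = (\<Sum>C | C \<subseteq># B. coeff (tau \<epsilon> k f) (repeat_mset k C) *
        coeff (tau \<epsilon> k g) (repeat_mset k (B - C)))"
      unfolding sum.reindex[OF inj] o_def
    proof (rule sum.cong[OF refl])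
      fix C
      have "A - repeat_mset k C = repeat_mset k (B - C)"
        unfolding A by (rule multiset_eqI) (simp add: right_diff_distrib')
      then show "coeff (tau \<epsilon> k f) (repeat_mset k C) * coeff (tau \<epsilon> k g) (A - repeat_mset k C) =
          coeff (tau \<epsilon> k f) (repeat_mset k C) * coeff (tau \<epsilon> k g) (repeat_mset k (B - C))" by simp
    qed
    also have "\<dots> = (\<Sum>C | C \<subseteq># B. sgm \<epsilon> B ^ (k - 1) * (coeff f C * coeff g (B - C)))"
    proof (rule sum.cong[OF refl])
      fix C assume "C \<in> {C. C \<subseteq># B}"
      then have "sgm \<epsilon> B = sgm \<epsilon> C * sgm \<epsilon> (B - C)" by (simp flip: sgm_union)
      then show "coeff (tau \<epsilon> k f) (repeat_mset k C) * coeff (tau \<epsilon> k g) (repeat_mset k (B - C)) =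
          sgm \<epsilon> B ^ (k - 1) * (coeff f C * coeff g (B - C))"
        by (simp add: coeff_tau_repeat[OF k] power_mult_distrib algebra_simps)
    qed
    also have "\<dots> = coeff (tau \<epsilon> k (f * g)) A"
      by (simp add: A coeff_tau_repeat[OF k] coeff_mult sum_distrib_left)
    finally show ?thesis ..
  next
    case False
    have "coeff (tau \<epsilon> k f * tau \<epsilon> k g) A = 0"
    proof (rule ccontr)
      assume "coeff (tau \<epsilon> k f * tau \<epsilon> k g) A \<noteq> 0"
      then obtain B C where A: "A = B + C" "coeff (tau \<epsilon> k f) B \<noteq> 0" "coeff (tau \<epsilon> k g) C \<noteq> 0"
        by (rule coeff_mult_nonzeroE)
      then obtain B' C' where "B = repeat_mset k B'" "C = repeat_mset k C'"
        using coeff_tau_0 by meson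
      then have "A = repeat_mset k (B' + C')" using A by simp
      then show False using False by blast
    qed
    then show ?thesis using False by (simp add: coeff_tau_0)
  qed
qed

lemma tau_one:
  assumes "1 \<le> k" shows "tau \<epsilon> k 1 = 1"
proof (rule pser_eqI)
  fix A
  show "coeff (tau \<epsilon> k 1) A = coeff 1 A"
  proof (cases "\<exists>B. A = repeat_mset k B")
    case True
    then obtain B where "A = repeat_mset k B" ..
    then show ?thesis using assms by (simp add: coeff_tau_repeat repeat_mset_eq_empty_iff)
  next
    case False
    then have "A \<noteq> {#}" by (metis repeat_mset_empty)
    then show ?thesis using False by (simp add: coeff_tau_0)
  qed
qed

lemma sym_hom_tau: "1 \<le> k \<Longrightarrow> sym_hom (tau \<epsilon> k)"
  by (simp add: sym_hom_def tau_one tau_add tau_mult tau_pscale)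

lemma tau_tau:
  assumes k: "1 \<le> k" and j: "1 \<le> j" shows "tau \<epsilon> k (tau \<epsilon> j g) = tau \<epsilon> (k * j) g"
proof (rule pser_eqI)
  fix A
  have kj: "1 \<le> k * j" using k j by simp
  show "coeff (tau \<epsilon> k (tau \<epsilon> j g)) A = coeff (tau \<epsilon> (k * j) g) A"
  proof (cases "\<exists>B. A = repeat_mset (k * j) B")
    case True
    then obtain B where B: "A = repeat_mset (k * j) B" ..
    have "coeff (tau \<epsilon> k (tau \<epsilon> j g)) A = sgm \<epsilon> (repeat_mset j B) ^ (k - 1) * (sgm \<epsilon> B ^ (j - 1) * coeff g B)"
      using coeff_tau_repeat[OF k, of \<epsilon> "tau \<epsilon> j g" "repeat_mset j B"] coeff_tau_repeat[OF j, of \<epsilon> g B]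
      by (simp add: B)
    also have "sgm \<epsilon> (repeat_mset j B) ^ (k - 1) * (sgm \<epsilon> B ^ (j - 1) * coeff g B) =
        sgm \<epsilon> B ^ (j * (k - 1) + (j - 1)) * coeff g B"
      by (simp add: sgm_repeat power_add flip: power_mult)
    also have "j * (k - 1) + (j - 1) = k * j - 1"
      using k j by (cases k) (simp_all add: algebra_simps)
    finally show ?thesis by (simp add: B coeff_tau_repeat[OF kj])
  next
    case False
    have "coeff (tau \<epsilon> k (tau \<epsilon> j g)) A = 0"
    proof (cases "\<exists>C. A = repeat_mset k C")
      case True
      then obtain C where C: "A = repeat_mset k C" ..
      then have "\<nexists>B. C = repeat_mset j B" using False by auto
      then show ?thesis by (simp add: C coeff_tau_repeat[OF k] coeff_tau_0)
    qed (simp add: coeff_tau_0)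
    then show ?thesis using False by (simp add: coeff_tau_0)
  qed
qed

lemma adams_Sym [intro]:
  assumes k: "1 \<le> k" and g: "g \<in> Sym" shows "tau (\<lambda>_. False) k g \<in> Sym"
proof -
  obtain d where d: "bounded_by d g" using g by (rule Sym_boundedE)
  have "bounded_by (k * d) (tau (\<lambda>_. False) k g)"
    unfolding bounded_by_def
  proof (intro allI impI)
    fix A assume *: "coeff (tau (\<lambda>_. False) k g) A \<noteq> 0"
    then obtain B where "A = repeat_mset k B" using coeff_tau_0 by metis
    then show "size A \<le> k * d" using * k d by (simp add: coeff_tau_repeat bounded_by_def)
  qed
  moreover have "symf (tau (\<lambda>_. False) k g)"
  proof (rule symfI)
    fix \<pi> :: "nat \<Rightarrow> nat" and A assume \<pi>: "bij \<pi>"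
    have img: "image_mset \<rho> (repeat_mset k B) = repeat_mset k (image_mset \<rho> B)"
      for \<rho> :: "nat \<Rightarrow> nat" and B by (induction k) auto
    show "coeff (tau (\<lambda>_. False) k g) (image_mset \<pi> A) = coeff (tau (\<lambda>_. False) k g) A"
    proof (cases "\<exists>B. A = repeat_mset k B")
      case True
      then obtain B where "A = repeat_mset k B" ..
      then show ?thesis using k \<pi> Sym_symf[OF g]
        by (simp add: img coeff_tau_repeat symf_coeff)
    next
      case False
      have "\<nexists>B. image_mset \<pi> A = repeat_mset k B"
      proof
        assume "\<exists>B. image_mset \<pi> A = repeat_mset k B"
        then obtain B where "image_mset \<pi> A = repeat_mset k B" ..
        then have "image_mset (inv \<pi>) (image_mset \<pi> A) = repeat_mset k (image_mset (inv \<pi>) B)"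
          by (simp only: img)
        then show False using False \<pi> by auto
      qed
      then show ?thesis using False by (simp add: coeff_tau_0)
    qed
  qed
  ultimately show ?thesis by (rule SymI[rotated])
qed

lemma coeff_power_sum_1: "coeff (power_sum 1) A = (if A \<in> letters then 1 else 0)"
  by (auto simp: coeff_power_sum)

lemma apow_eq_tau:
  assumes "\<And>A. coeff g A = (if A \<in> L then 1 else 0)" "1 \<le> k"
  shows "apow L (\<lambda>M. sgm \<epsilon> M = -1) k = tau \<epsilon> k g"
proof (rule pser_eqI)
  fix A
  have s: "(if sgm \<epsilon> M = -1 then -1 else 1) = sgm \<epsilon> M" for M
    using sgm_cases[of \<epsilon> M] by auto
  show "coeff (apow L (\<lambda>M. sgm \<epsilon> M = -1) k) A = coeff (tau \<epsilon> k g) A"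
  proof (cases "\<exists>B. A = repeat_mset k B")
    case True
    then obtain B where A: "A = repeat_mset k B" ..
    have "{M. M \<in> L \<and> repeat_mset k M = A} = (if B \<in> L then {B} else {})"
      using assms(2) by (auto simp: A repeat_mset_cancel1)
    then show ?thesis using assms(2) by (simp add: A apow_def s coeff_tau_repeat assms(1))
  next
    case False
    then have "{M. M \<in> L \<and> repeat_mset k M = A} = {}" by auto
    then have "coeff (apow L (\<lambda>M. sgm \<epsilon> M = -1) k) A = 0"
      unfolding apow_def coeff_Pser by (simp only: sum.empty)
    then show ?thesis using False by (simp add: coeff_tau_0)
  qed
qed

section \<open>Super evaluation\<close>

text \<open>Evaluation at an alphabet in which the variables selected by \<open>\<epsilon>\<close> are fermionic.\<close>

definition Phi :: "(nat \<Rightarrow> bool) \<Rightarrow> pser \<Rightarrow> pser" where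
  "Phi \<epsilon> = subst_power (\<lambda>k. tau \<epsilon> k (power_sum 1))"

abbreviation omega :: "pser \<Rightarrow> pser" where
  "omega \<equiv> Phi (\<lambda>_. True)"

lemma sym_hom_Phi [simp]: "sym_hom (Phi \<epsilon>)"
  by (simp add: Phi_def)

lemma Phi_power_sum: "1 \<le> k \<Longrightarrow> Phi \<epsilon> (power_sum k) = tau \<epsilon> k (power_sum 1)"
  by (simp add: Phi_def subst_power_power_sum)

lemma power_sum_eq_tau: "1 \<le> k \<Longrightarrow> power_sum k = tau (\<lambda>_. False) k (power_sum 1)"
  using apow_letters[of k] apow_eq_tau[OF coeff_power_sum_1, of k "\<lambda>_. False"] by simp

lemma tau_True_power_sum:
  assumes "1 \<le> k" shows "tau (\<lambda>_. True) k (power_sum 1) = pscale ((-1) ^ (k - 1)) (power_sum k)"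
proof (rule pser_eqI)
  fix A
  show "coeff (tau (\<lambda>_. True) k (power_sum 1)) A = coeff (pscale ((-1) ^ (k - 1)) (power_sum k)) A"
    unfolding power_sum_eq_tau[OF assms]
  proof (cases "\<exists>B. A = repeat_mset k B")
    case True
    then obtain B where "A = repeat_mset k B" ..
    then show "coeff (tau (\<lambda>_. True) k (power_sum 1)) A =
        coeff (pscale ((-1) ^ (k - 1)) (tau (\<lambda>_. False) k (power_sum 1))) A"
      using assms by (auto simp: coeff_tau_repeat coeff_power_sum)
  qed (simp add: coeff_tau_0)
qed

lemma omega_power_sum:
  "1 \<le> k \<Longrightarrow> omega (power_sum k) = pscale ((-1) ^ (k - 1)) (power_sum k)"
  by (simp only: Phi_power_sum tau_True_power_sum)

lemma omega_Sym [simp, intro]: "omega f \<in> Sym"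
  unfolding Phi_def by (rule subst_power_Sym) (simp only: tau_True_power_sum Sym_pscale power_sum_Sym)

lemma omega_omega:
  assumes "f \<in> Sym" shows "omega (omega f) = f"
proof (rule sym_hom_eqI[of "\<lambda>f. omega (omega f)" "\<lambda>f. f"])
  show "sym_hom (\<lambda>f. omega (omega f))" by (rule sym_hom_comp) simp_all
  show "sym_hom (\<lambda>f. f)" by (simp add: sym_hom_def)
  show "omega (omega (power_sum k)) = power_sum k" if "1 \<le> k" for k
    using that by (simp add: omega_power_sum sym_homD(4)[OF sym_hom_Phi])
qed (rule assms)

lemma Phi_False:
  assumes "f \<in> Sym" shows "Phi (\<lambda>_. False) f = f"
proof (rule sym_hom_eqI[of "Phi (\<lambda>_. False)" "\<lambda>f. f"])
  show "sym_hom (\<lambda>f. f)" by (simp add: sym_hom_def)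
  show "Phi (\<lambda>_. False) (power_sum k) = power_sum k" if "1 \<le> k" for k
    using that by (simp only: Phi_power_sum power_sum_eq_tau[symmetric])
qed (simp_all add: assms)

lemma Phi_csym: "Phi \<epsilon> (csym False n) = hsym \<epsilon> n"
proof -
  have "Phi \<epsilon> (csym False n) = asum letters (\<lambda>M. sgm \<epsilon> M = -1) n"
    by (rule sym_hom_newton) (simp_all only: sym_hom_Phi Phi_power_sum apow_eq_tau[OF coeff_power_sum_1])
  also have "\<dots> = hsym \<epsilon> n" by (rule asum_letters) simp
  finally show ?thesis .
qed

lemma omega_csym: "omega (csym b n) = csym (\<not> b) n"
  using omega_omega[of "csym False n"] by (cases b) (simp_all add: Phi_csym)

lemma omega_csprod: "omega (csprod False A) = csprod True A"
  unfolding csprod_def by (simp add: sym_hom_prod Phi_csym)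

text \<open>By linearity and \<open>jacobi_trudi\<close> the claim reduces to the products h_A, for
  which it is \<open>alt_conj\<close>. In effect \<open>omega\<close> conjugates Schur
  functions.\<close>

lemma alt_omega:
  assumes f: "f \<in> Sym" and \<beta>: "par N \<beta>" "\<beta> 0 \<le> M"
  shows "alt N \<beta> (omega f) = alt M (conj_part \<beta>) f"
proof -
  have lin: "alt N \<beta> (omega (\<Sum>x\<in>S. pscale (c x) (F x))) = alt M (conj_part \<beta>) (\<Sum>x\<in>S. pscale (c x) (F x))"
    if "\<And>x. x \<in> S \<Longrightarrow> F x \<in> Sym \<and> alt N \<beta> (omega (F x)) = alt M (conj_part \<beta>) (F x)"
    for S :: "'b set" and c F
  proof -
    have "omega (\<Sum>x\<in>S. pscale (c x) (F x)) = (\<Sum>x\<in>S. omega (pscale (c x) (F x)))"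
      using that by (intro sym_hom_sum) auto
    also have "\<dots> = (\<Sum>x\<in>S. pscale (c x) (omega (F x)))"
      using that by (intro sum.cong sym_homD(4)) auto
    finally show ?thesis using that by (simp add: alt_sum alt_pscale)
  qed
  have schur: "alt N \<beta> (omega (schur \<alpha>)) = alt M (conj_part \<beta>) (schur \<alpha>)" if "is_partition \<alpha>" for \<alpha>
    unfolding jacobi_trudi[OF that] by (rule lin) (simp add: omega_csprod alt_conj[OF \<beta>])
  obtain d where d: "bounded_by d f" using f by (rule Sym_boundedE)
  show ?thesis
    by (subst (1 2) Sym_expansion[OF f d], rule lin) (auto simp: schur partitions_le_def)
qed

section \<open>Skewing by elementary symmetric functions\<close>

lemma hperp_power_sum:
  assumes "1 \<le> k"
  shows "hperp a (power_sum k) = (if a = 0 then power_sum k else if a = k then 1 else 0)"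
proof (rule pser_eqI)
  fix A
  have rep: "replicate_mset k (Suc j) = mcons 0 (replicate_mset k j)"
    "replicate_mset k 0 = mcons k {#}" for j by (simp_all add: mcons_def)
  have "(\<exists>i. mcons a A = replicate_mset k i) \<longleftrightarrow>
      a = 0 \<and> (\<exists>j. A = replicate_mset k j) \<or> a = k \<and> A = {#}"
  proof
    assume "\<exists>i. mcons a A = replicate_mset k i"
    then obtain i where "mcons a A = replicate_mset k i" ..
    then show "a = 0 \<and> (\<exists>j. A = replicate_mset k j) \<or> a = k \<and> A = {#}"
      by (cases i) (auto simp: rep)
  next
    assume "a = 0 \<and> (\<exists>j. A = replicate_mset k j) \<or> a = k \<and> A = {#}"
    then show "\<exists>i. mcons a A = replicate_mset k i"
      using rep by metis
  qed
  then show "coeff (hperp a (power_sum k)) A = coeff (if a = 0 then power_sum k else if a = k then 1 else 0) A"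
    using assms by (auto simp: coeff_power_sum)
qed

text \<open>The adjoint of the multiplication by \<open>e\<^sub>c\<close>, since \<open>omega\<close> is an isometry that exchanges \<open>e\<^sub>c\<close> and
  \<open>h\<^sub>c\<close>.\<close>

definition eperp :: "nat \<Rightarrow> pser \<Rightarrow> pser" where
  "eperp c f = omega (hperp c (omega f))"

lemma eperp_Sym [simp, intro]: "eperp c f \<in> Sym"
  by (simp add: eperp_def)

lemma eperp_mult:
  assumes "f \<in> Sym" "g \<in> Sym"
  shows "eperp c (f * g) = (\<Sum>a\<le>c. eperp a f * eperp (c - a) g)"
proof -
  have "eperp c (f * g) = omega (\<Sum>a\<le>c. hperp a (omega f) * hperp (c - a) (omega g))"
    using assms by (simp add: eperp_def sym_homD(3)[OF sym_hom_Phi] hperp_mult)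
  also have "\<dots> = (\<Sum>a\<le>c. omega (hperp a (omega f) * hperp (c - a) (omega g)))"
    by (rule sym_hom_sum) auto
  also have "\<dots> = (\<Sum>a\<le>c. eperp a f * eperp (c - a) g)"
    by (simp add: eperp_def sym_homD(3)[OF sym_hom_Phi] hperp_Sym)
  finally show ?thesis .
qed

lemma eperp_add: "f \<in> Sym \<Longrightarrow> g \<in> Sym \<Longrightarrow> eperp c (f + g) = eperp c f + eperp c g"
  by (simp add: eperp_def sym_homD(2)[OF sym_hom_Phi] hperp_add hperp_Sym)

lemma eperp_pscale: "f \<in> Sym \<Longrightarrow> eperp c (pscale a f) = pscale a (eperp c f)"
  by (simp add: eperp_def sym_homD(4)[OF sym_hom_Phi] hperp_pscale hperp_Sym)

lemma eperp_one: "eperp c 1 = (if c = 0 then 1 else 0)"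
  by (simp add: eperp_def sym_homD(1)[OF sym_hom_Phi] hperp_one sym_hom_0)

lemma eperp_power_sum:
  assumes "1 \<le> k"
  shows "eperp a (power_sum k) =
    (if a = 0 then power_sum k else if a = k then pscale ((-1) ^ (k - 1)) 1 else 0)"
  using assms
  by (auto simp: eperp_def omega_power_sum hperp_pscale hperp_power_sum
      sym_homD(1,4)[OF sym_hom_Phi] sym_hom_0)

lemma sgm_mcons: "sgm \<epsilon> (mcons c A) = (if \<epsilon> 0 then -1 else 1) ^ c * sgm (\<epsilon> \<circ> Suc) A"
proof -
  have "sgm \<epsilon> (image_mset Suc A) = sgm (\<epsilon> \<circ> Suc) A" by (induction A) auto
  moreover have "sgm \<epsilon> (replicate_mset c 0) = (if \<epsilon> 0 then -1 else 1) ^ c" by (induction c) auto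
  ultimately show ?thesis by (simp add: mcons_def)
qed

text \<open>The signed power sum is (-1)^(k-1) times the k-th power of the first variable, plus the
  signed power sum of the others. The values are modelled on \<open>eperp_power_sum\<close>.\<close>

lemma hperp_tau_power_sum:
  assumes k: "1 \<le> k" and \<epsilon>: "\<epsilon> 0"
  shows "hperp a (tau \<epsilon> k (power_sum 1)) =
    (if a = 0 then tau (\<epsilon> \<circ> Suc) k (power_sum 1) else if a = k then pscale ((-1) ^ (k - 1)) 1 else 0)"
proof (rule pser_eqI)
  fix A
  have rep: "repeat_mset k (mcons c B) = mcons (k * c) (repeat_mset k B)" for c B
    by (rule sym, rule mcons_eqI) auto
  have p1: "coeff (power_sum 1) (mcons c B) =
      (if c = 0 then coeff (power_sum 1) B else if c = 1 \<and> B = {#} then 1 else 0)" for c B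
    using arg_cong[OF hperp_power_sum[OF order_refl, of c], of "\<lambda>f. coeff f B"] by auto
  show "coeff (hperp a (tau \<epsilon> k (power_sum 1))) A = coeff (if a = 0 then tau (\<epsilon> \<circ> Suc) k (power_sum 1)
      else if a = k then pscale ((-1) ^ (k - 1)) 1 else 0) A"
  proof (cases "\<exists>D. mcons a A = repeat_mset k D")
    case True
    then obtain D where D: "mcons a A = repeat_mset k D" ..
    obtain c B where cB: "D = mcons c B" by (rule mconsE)
    then have aA: "a = k * c" "A = repeat_mset k B" using D by (auto simp: rep)
    have "coeff (hperp a (tau \<epsilon> k (power_sum 1))) A = sgm \<epsilon> (mcons c B) ^ (k - 1) * coeff (power_sum 1) (mcons c B)"
      using coeff_tau_repeat[OF k, of \<epsilon> "power_sum 1" D] D cB by simp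
    also have "\<dots> = coeff (if a = 0 then tau (\<epsilon> \<circ> Suc) k (power_sum 1)
        else if a = k then pscale ((-1) ^ (k - 1)) 1 else 0) A"
      using k \<epsilon> by (auto simp: p1[simplified] aA sgm_mcons coeff_tau_repeat repeat_mset_eq_empty_iff)
    finally show ?thesis .
  next
    case False
    then have "coeff (hperp a (tau \<epsilon> k (power_sum 1))) A = 0" by (simp add: coeff_tau_0)
    moreover have "\<nexists>B. A = repeat_mset k B" if "a = 0"
      using False that rep[of 0] by (metis mult_0_right)
    moreover have "A \<noteq> {#}" if "a = k"
      using False that rep[of 1 "{#}"] by (metis mult_1_right repeat_mset_empty)
    ultimately show ?thesis by (auto simp: coeff_tau_0)
  qed
qed

text \<open>Makes precise that a fermionic variable records skewing by e_c. Both sides obey the same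
  product rule in \<open>c\<close> and agree on power sums.\<close>

lemma hperp_Phi:
  assumes \<epsilon>: "\<epsilon> 0" and f: "f \<in> Sym"
  shows "hperp c (Phi \<epsilon> f) = Phi (\<epsilon> \<circ> Suc) (eperp c f)"
proof -
  define \<delta> where "\<delta> = \<epsilon> \<circ> Suc"
  have "hperp c (Phi \<epsilon> f) = Phi \<delta> (eperp c f)"
  using f
proof (induction arbitrary: c rule: Sym_induct)
  case zero
  show ?case
    using eperp_pscale[OF Sym_one, of c 0] by (simp add: sym_hom_0)
next
  case (step b \<alpha> g)
  have "hperp c (Phi \<epsilon> (power_sums \<alpha>)) = Phi \<delta> (eperp c (power_sums \<alpha>))" for c
    using step(1)
  proof (induction \<alpha> arbitrary: c)
    case Nil
    then show ?case
      by (simp add: sym_homD(1)[OF sym_hom_Phi] hperp_one eperp_one sym_hom_0)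
  next
    case (Cons k \<alpha>)
    then have k: "1 \<le> k" by auto
    have p: "hperp a (Phi \<epsilon> (power_sum k)) = Phi \<delta> (eperp a (power_sum k))" for a
      using k \<epsilon>
      by (simp only: Phi_power_sum hperp_tau_power_sum[of _ \<epsilon>, folded \<delta>_def] eperp_power_sum if_distrib[of "Phi \<delta>"]
          sym_homD(1)[OF sym_hom_Phi] sym_homD(4)[OF sym_hom_Phi Sym_one] sym_hom_0[OF sym_hom_Phi])
    have "hperp c (Phi \<epsilon> (power_sums (k # \<alpha>))) =
        (\<Sum>a\<le>c. Phi \<delta> (eperp a (power_sum k)) * Phi \<delta> (eperp (c - a) (power_sums \<alpha>)))"
      using Cons by (simp add: power_sums_Cons sym_homD(3)[OF sym_hom_Phi] hperp_mult p)
    also have "\<dots> = (\<Sum>a\<le>c. Phi \<delta> (eperp a (power_sum k) * eperp (c - a) (power_sums \<alpha>)))"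
      by (simp add: sym_homD(3)[OF sym_hom_Phi])
    also have "\<dots> = Phi \<delta> (\<Sum>a\<le>c. eperp a (power_sum k) * eperp (c - a) (power_sums \<alpha>))"
      by (rule sym_hom_sum[symmetric]) auto
    also have "\<dots> = Phi \<delta> (eperp c (power_sums (k # \<alpha>)))"
      by (simp add: power_sums_Cons eperp_mult)
    finally show ?case .
  qed
  then show ?case
    using step(2,3)
    by (simp add: sym_homD(2,4)[OF sym_hom_Phi] Sym_pscale hperp_add hperp_pscale eperp_add eperp_pscale)
qed
  then show ?thesis by (simp only: \<delta>_def)
qed

text \<open>Super evaluation turns ordinary Adams operations into signed ones, so it can be carried
  through a plethysm. On the j-th power sum both sides are the signed operation of index
  \<open>k * j\<close>.\<close>

lemma Phi_tau:
  assumes k: "1 \<le> k" and f: "f \<in> Sym"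
  shows "Phi \<epsilon> (tau (\<lambda>_. False) k f) = tau \<epsilon> k (Phi \<epsilon> f)"
proof (rule sym_hom_eqI[of "\<lambda>f. Phi \<epsilon> (tau (\<lambda>_. False) k f)" "\<lambda>f. tau \<epsilon> k (Phi \<epsilon> f)", OF _ _ _ f])
  show "sym_hom (\<lambda>f. Phi \<epsilon> (tau (\<lambda>_. False) k f))"
    by (rule sym_hom_comp[OF sym_hom_tau[OF k]]) (use k in auto)
  show "sym_hom (\<lambda>f. tau \<epsilon> k (Phi \<epsilon> f))"
    unfolding sym_hom_def
    using k by (simp add: sym_homD[OF sym_hom_Phi] tau_add tau_mult tau_pscale tau_one)
  fix j :: nat assume j: "1 \<le> j"
  have kj: "1 \<le> k * j" using k j by simp
  have "tau (\<lambda>_. False) k (power_sum j) = power_sum (k * j)"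
    by (simp only: power_sum_eq_tau[OF j] power_sum_eq_tau[OF kj] tau_tau[OF k j])
  then show "Phi \<epsilon> (tau (\<lambda>_. False) k (power_sum j)) = tau \<epsilon> k (Phi \<epsilon> (power_sum j))"
    by (simp only: Phi_power_sum[OF j] Phi_power_sum[OF kj] tau_tau[OF k j])
qed

section \<open>Plethysm\<close>

lemma plethysm_eq: "plethysm f g = subst_power (\<lambda>k. tau (\<lambda>_. False) k g) f"
  by (simp add: plethysm_def subst_power_def adams_eq_tau)

lemma sym_hom_plethysm: "sym_hom (\<lambda>f. plethysm f g)"
  unfolding plethysm_eq by simp

lemma plethysm_Sym [intro]: "g \<in> Sym \<Longrightarrow> plethysm f g \<in> Sym"
  unfolding plethysm_eq by (rule subst_power_Sym) auto

text \<open>Exchanging bosonic and fermionic letters has the effect of \<open>omega\<close> on power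
  sums. Negation is written \<open>\<noteq> True\<close> to fit the pattern
  \<open>\<noteq> b\<close> of \<open>Phi_plethysm\<close>.\<close>

lemma apow_flip:
  "1 \<le> k \<Longrightarrow> apow L (\<lambda>M. \<theta> M \<noteq> True) k = pscale ((-1) ^ (k - 1)) (apow L \<theta> k)"
  by (rule pser_eqI)
    (auto simp: apow_def sum_distrib_left intro!: sum.cong)

text \<open>The monomials of h_m at the super alphabet, each of which has coefficient 1
  there.\<close>

definition alphabet :: "(nat \<Rightarrow> bool) \<Rightarrow> nat \<Rightarrow> nat multiset set" where
  "alphabet \<epsilon> m = {M. size M = m \<and> (\<forall>i. \<epsilon> i \<longrightarrow> count M i \<le> 1)}"

text \<open>The composite sends the k-th power sum to that of the alphabet of monomials of degree
  \<open>m\<close>, so by Newton's recursion it counts words. For elementary functions, precomposing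
  with \<open>omega\<close> reverses the parity of every letter.\<close>

lemma Phi_plethysm:
  "Phi \<epsilon> (plethysm (csym b n) (csym False m)) =
    asum (alphabet \<epsilon> m) (\<lambda>M. (sgm \<epsilon> M = -1) \<noteq> b) n"
proof -
  let ?F = "\<lambda>f. Phi \<epsilon> (plethysm f (csym False m))"
  let ?\<theta> = "\<lambda>M. sgm \<epsilon> M = -1"
  have F: "sym_hom ?F"
    by (rule sym_hom_comp[OF sym_hom_plethysm]) auto
  have Fp: "?F (power_sum k) = apow (alphabet \<epsilon> m) ?\<theta> k" if "1 \<le> k" for k
  proof -
    have "?F (power_sum k) = tau \<epsilon> k (hsym \<epsilon> m)"
      using that by (simp add: plethysm_eq subst_power_power_sum Phi_tau Phi_csym)
    also have "\<dots> = apow (alphabet \<epsilon> m) ?\<theta> k"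
      using that by (intro apow_eq_tau[symmetric]) (simp_all add: coeff_hsym alphabet_def)
    finally show ?thesis .
  qed
  show ?thesis
  proof (cases b)
    case False
    then show ?thesis using sym_hom_newton[OF F Fp] by simp
  next
    case True
    have "sym_hom (\<lambda>f. ?F (omega f))" by (rule sym_hom_comp[OF _ _ F]) simp_all
    moreover have "?F (omega (power_sum k)) = apow (alphabet \<epsilon> m) (\<lambda>M. ?\<theta> M \<noteq> True) k"
      if "1 \<le> k" for k
      using that by (simp only: omega_power_sum sym_homD(4)[OF F power_sum_Sym] Fp apow_flip)
    ultimately have "?F (omega (csym False n)) = asum (alphabet \<epsilon> m) (\<lambda>M. ?\<theta> M \<noteq> True) n"
      by (rule sym_hom_newton)
    then show ?thesis using True by (simp add: omega_csym)
  qed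
qed

section \<open>Eventually constant sequences\<close>

definition stable :: "(nat \<Rightarrow> rat) \<Rightarrow> bool" where
  "stable a \<longleftrightarrow> (\<exists>c. \<forall>\<^sub>F i in sequentially. a i = c)"

lemma stable_shift: "stable (\<lambda>i. a (i + n)) \<longleftrightarrow> stable a"
  unfolding stable_def using eventually_sequentially_seg[of "\<lambda>i. a i = _" n] by simp

lemma stable_const [simp]: "stable (\<lambda>_. c)"
  by (auto simp: stable_def)

lemma stable_add:
  assumes "stable a" "stable b" shows "stable (\<lambda>i. a i + b i)"
proof -
  obtain c d where "\<forall>\<^sub>F i in sequentially. a i = c" "\<forall>\<^sub>F i in sequentially. b i = d"
    using assms by (auto simp: stable_def)
  then have "\<forall>\<^sub>F i in sequentially. a i + b i = c + d" by eventually_elim simp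
  then show ?thesis unfolding stable_def by blast
qed

lemma stable_cmult:
  assumes "stable a" shows "stable (\<lambda>i. c * a i)"
proof -
  obtain d where "\<forall>\<^sub>F i in sequentially. a i = d" using assms by (auto simp: stable_def)
  then have "\<forall>\<^sub>F i in sequentially. c * a i = c * d" by eventually_elim simp
  then show ?thesis unfolding stable_def by blast
qed

lemma stable_sum: "(\<And>x. x \<in> S \<Longrightarrow> stable (a x)) \<Longrightarrow> stable (\<lambda>i. \<Sum>x\<in>S. a x i)"
  by (induction S rule: infinite_finite_induct) (auto intro: stable_add)

lemma stable_SucI:
  assumes "\<And>i. i \<ge> n \<Longrightarrow> a (Suc i) = a i" shows "stable a"
proof -
  have "a (n + i) = a n" for i by (induction i) (simp_all add: assms)
  then have "a i = a n" if "i \<ge> n" for i using le_Suc_ex[OF that] by auto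
  then have "\<forall>\<^sub>F i in sequentially. a i = a n" using eventually_sequentially by blast
  then show ?thesis unfolding stable_def by blast
qed

text \<open>A submultiset of bounded size does not notice the multiplicity of \<open>M\<close> once it is large.\<close>

lemma bounded_submultisets:
  assumes "size B \<le> d"
  shows "B \<subseteq># A + repeat_mset (i + d) M \<longleftrightarrow> B \<subseteq># A + repeat_mset d M"
proof -
  have "count B v \<le> count A v + (i + d) * count M v \<longleftrightarrow> count B v \<le> count A v + d * count M v" for v
  proof (cases "count M v = 0")
    case False
    have "count B v \<le> d" using count_le_size[of B v] assms by simp
    also have "d \<le> d * count M v" using False by simp
    finally have "count B v \<le> d * count M v" .
    moreover have "d * count M v \<le> (i + d) * count M v" by simp
    ultimately show ?thesis by linarith
  qed simp
  then show ?thesis by (simp add: subseteq_mset_def)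
qed

text \<open>The point is that the index set does not depend on \<open>i\<close>; only the argument
  of \<open>f\<close> moves along multiples of \<open>M\<close>.\<close>

lemma coeff_mult_bounded:
  assumes "bounded_by d g"
  shows "coeff (g * f) (A + repeat_mset (i + d) M) =
    (\<Sum>B | B \<subseteq># A + repeat_mset d M \<and> size B \<le> d.
      coeff g B * coeff f ((A + repeat_mset d M - B) + repeat_mset i M))"
proof -
  have "coeff (g * f) (A + repeat_mset (i + d) M) =
      (\<Sum>B | B \<subseteq># A + repeat_mset (i + d) M \<and> size B \<le> d.
        coeff g B * coeff f (A + repeat_mset (i + d) M - B))"
    unfolding coeff_mult
    by (rule sum.mono_neutral_right) (use assms in \<open>auto simp: bounded_by_def\<close>)
  also have "\<dots> = (\<Sum>B | B \<subseteq># A + repeat_mset d M \<and> size B \<le> d.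
      coeff g B * coeff f ((A + repeat_mset d M - B) + repeat_mset i M))"
  proof (rule sum.cong)
    fix B assume "B \<in> {B. B \<subseteq># A + repeat_mset d M \<and> size B \<le> d}"
    then have "(A + repeat_mset d M) + repeat_mset i M - B = (A + repeat_mset d M - B) + repeat_mset i M"
      by (intro subset_mset.diff_add_assoc2) simp
    moreover have "A + repeat_mset (i + d) M = (A + repeat_mset d M) + repeat_mset i M"
      by (rule multiset_eqI) (simp add: algebra_simps)
    ultimately show "coeff g B * coeff f (A + repeat_mset (i + d) M - B) =
        coeff g B * coeff f ((A + repeat_mset d M - B) + repeat_mset i M)"
      by (simp only:)
  qed (use bounded_submultisets in blast)
  finally show ?thesis .
qed

text \<open>All offsets \<open>j\<close> are needed in the hypothesis, because replacing
  \<open>i\<close> by \<open>i + d\<close> also shifts the index of \<open>f\<close>.\<close>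

lemma stable_coeff_mult:
  assumes g: "bounded_by d g"
    and f: "\<And>A j. stable (\<lambda>i. coeff (f (i + j)) (A + repeat_mset i M))"
  shows "stable (\<lambda>i. coeff (g * f (i + j)) (A + repeat_mset i M))"
proof -
  have "stable (\<lambda>i. coeff (g * f (i + d + j)) (A + repeat_mset (i + d) M))"
    unfolding coeff_mult_bounded[OF g] add.assoc[of _ d j]
    by (intro stable_sum stable_cmult f)
  then show ?thesis by (rule stable_shift[THEN iffD1])
qed

section \<open>Good sequences\<close>

abbreviation (input) ferm :: "nat \<Rightarrow> nat \<Rightarrow> bool" where
  "ferm k \<equiv> \<lambda>v. v < k"

text \<open>The monomial \<open>x\<^sub>0 \<cdots> x\<^sub>k\<^sub>-\<^sub>1 x\<^sub>k\<^sup>l\<close>: one factor for each of the first \<open>k\<close> columns, \<open>l\<close> for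
  the first row. By the choice of parity it is always a bosonic letter of the relevant alphabet.\<close>

definition frame :: "nat \<Rightarrow> nat \<Rightarrow> nat multiset" where
  "frame k l = mset [0..<k] + replicate_mset l k"

lemma count_frame: "count (frame k l) v = (if v < k then 1 else if v = k then l else 0)"
  by (auto simp: frame_def count_mset_0_iff count_mset_set(1) simp flip: mset_set_upto_eq_mset_upto atLeast0LessThan)

lemma frame_Suc: "frame (Suc k) l = mcons 1 (frame k l)"
proof (rule multiset_eqI)
  fix v show "count (frame (Suc k) l) v = count (mcons 1 (frame k l)) v"
    by (cases v) (simp_all add: count_frame)
qed

lemma frame_0: "frame 0 l = replicate_mset l 0"
  by (simp add: frame_def)

text \<open>The second condition bounds the columns of the Schur functions in \<open>f i\<close>, so that few terms of the
  column expansion are nonzero.\<close>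

definition good :: "nat \<Rightarrow> nat \<Rightarrow> (nat \<Rightarrow> pser) \<Rightarrow> bool" where
  "good k l f \<longleftrightarrow> (\<forall>i. f i \<in> Sym) \<and>
     (\<forall>A j. stable (\<lambda>i. coeff (Phi (ferm k) (f (i + j))) (A + repeat_mset i (frame k l)))) \<and>
     (\<exists>C. \<forall>i A v. coeff (omega (f i)) A \<noteq> 0 \<longrightarrow> count A v \<le> i + C)"

lemma goodD:
  assumes "good k l f"
  shows "f i \<in> Sym" "stable (\<lambda>i. coeff (Phi (ferm k) (f (i + j))) (A + repeat_mset i (frame k l)))"
  using assms by (auto simp: good_def)

lemma good_boundE:
  assumes "good k l f"
  obtains C where "\<And>i A v. coeff (omega (f i)) A \<noteq> 0 \<Longrightarrow> count A v \<le> i + C"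
  using assms unfolding good_def by blast

lemma good_shift:
  assumes "good k l f" shows "good k l (\<lambda>i. f (i + n))"
proof -
  obtain C where C: "\<And>i A v. coeff (omega (f i)) A \<noteq> 0 \<Longrightarrow> count A v \<le> i + C"
    using assms by (rule good_boundE) blast
  have "\<forall>i A v. coeff (omega (f (i + n))) A \<noteq> 0 \<longrightarrow> count A v \<le> i + (n + C)"
    using C by (metis add.assoc)
  moreover have "stable (\<lambda>i. coeff (Phi (ferm k) (f (i + j + n))) (A + repeat_mset i (frame k l)))" for j A
    using goodD(2)[OF assms, of "j + n" A] by (simp add: add.assoc)
  ultimately show ?thesis unfolding good_def using goodD(1)[OF assms] by blast
qed

lemma bounded_by_tau_power_sum:
  assumes "1 \<le> k" shows "bounded_by k (tau \<epsilon> k (power_sum 1))"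
  unfolding bounded_by_def
proof (intro allI impI)
  fix A assume *: "coeff (tau \<epsilon> k (power_sum 1)) A \<noteq> 0"
  then obtain B where B: "A = repeat_mset k B" using coeff_tau_0 by metis
  then have "coeff (power_sum 1) B \<noteq> 0" using * assms by (auto simp: coeff_tau_repeat)
  then have "size B = 1" by (auto simp: coeff_power_sum split: if_splits)
  then show "size A \<le> k" by (simp add: B)
qed

lemma bounded_by_add: "bounded_by d f \<Longrightarrow> bounded_by e g \<Longrightarrow> bounded_by (d + e) (f + g)"
  unfolding bounded_by_def by (metis add_0 plus_pser.rep_eq trans_le_add1 trans_le_add2)

text \<open>The image is in general not symmetric, so its degree bound is derived from the images of
  the power sums.\<close>

lemma Phi_bounded:
  assumes "f \<in> Sym" obtains d where "bounded_by d (Phi \<epsilon> f)"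
proof -
  have "\<exists>d. bounded_by d (Phi \<epsilon> f)"
    using assms
  proof (induction rule: Sym_induct)
    case zero
    have "bounded_by 0 (Phi \<epsilon> 0)" by (simp add: sym_hom_0 bounded_by_def)
    then show ?case ..
  next
    case (step c \<alpha> g)
    have "\<exists>d. bounded_by d (Phi \<epsilon> (power_sums \<alpha>))"
      using step(1)
    proof (induction \<alpha>)
      case Nil
      have "bounded_by 0 (Phi \<epsilon> (power_sums []))"
        by (simp add: sym_homD(1)[OF sym_hom_Phi] bounded_by_def)
      then show ?case ..
    next
      case (Cons k \<alpha>)
      then obtain d where "bounded_by d (Phi \<epsilon> (power_sums \<alpha>))" by auto
      moreover have k: "1 \<le> k" using Cons.prems by auto
      moreover have "Phi \<epsilon> (power_sums (k # \<alpha>)) = tau \<epsilon> k (power_sum 1) * Phi \<epsilon> (power_sums \<alpha>)"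
        unfolding power_sums_Cons sym_homD(3)[OF sym_hom_Phi power_sum_Sym power_sums_Sym] Phi_power_sum[OF k] ..
      ultimately show ?case using bounded_by_mult bounded_by_tau_power_sum by metis
    qed
    then obtain d where d: "bounded_by d (Phi \<epsilon> (power_sums \<alpha>))" ..
    obtain e where e: "bounded_by e (Phi \<epsilon> g)" using step by auto
    have "Phi \<epsilon> (pscale c (power_sums \<alpha>) + g) = pscale c (Phi \<epsilon> (power_sums \<alpha>)) + Phi \<epsilon> g"
      using step(2) by (simp add: sym_homD(2,4)[OF sym_hom_Phi] Sym_pscale)
    moreover have "bounded_by d (pscale c (Phi \<epsilon> (power_sums \<alpha>)))"
      using d by (simp add: bounded_by_def)
    ultimately show ?case using bounded_by_add e by metis
  qed
  then show ?thesis using that by blast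
qed

lemma good_mult:
  assumes f: "good k l f" and g: "g \<in> Sym" shows "good k l (\<lambda>i. g * f i)"
proof -
  have mult: "Phi \<epsilon> (g * f i) = Phi \<epsilon> g * Phi \<epsilon> (f i)" for \<epsilon> i
    by (rule sym_homD(3)[OF sym_hom_Phi g goodD(1)[OF f]])
  obtain d where d: "bounded_by d (Phi (ferm k) g)" using g by (rule Phi_bounded)
  obtain e where e: "bounded_by e (omega g)" using g by (rule Phi_bounded)
  obtain C where C: "\<And>i A v. coeff (omega (f i)) A \<noteq> 0 \<Longrightarrow> count A v \<le> i + C"
    using f by (rule good_boundE) blast
  have "stable (\<lambda>i. coeff (Phi (ferm k) (g * f (i + j))) (A + repeat_mset i (frame k l)))" for j A
    unfolding mult using stable_coeff_mult[where f = "\<lambda>i. Phi (ferm k) (f i)", OF d goodD(2)[OF f]] .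
  moreover have "count A v \<le> i + (C + e)" if nz: "coeff (omega (g * f i)) A \<noteq> 0" for i A v
  proof -
    obtain B D where A: "A = B + D" and B: "coeff (omega g) B \<noteq> 0" and D: "coeff (omega (f i)) D \<noteq> 0"
      using nz unfolding mult by (rule coeff_mult_nonzeroE)
    have "count B v \<le> size B" by (rule count_le_size)
    also have "size B \<le> e" using e B by (simp add: bounded_by_def)
    finally show ?thesis using C[OF D, of v] by (simp add: A)
  qed
  ultimately show ?thesis unfolding good_def using goodD(1)[OF f] g by blast
qed

lemma omega_eperp: "omega (eperp c f) = hperp c (omega f)"
  by (simp add: eperp_def omega_omega hperp_Sym)

text \<open>By \<open>hperp_Phi\<close> the index \<open>i + c\<close> is the exponent of one more
  fermionic variable. The frame contains this variable once, so its i-th power accounts for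
  \<open>i\<close>, and \<open>c\<close> is absorbed into the fixed monomial.\<close>

lemma good_eperp:
  assumes f: "good (Suc k) l f" shows "good k l (\<lambda>i. eperp (i + c) (f i))"
proof -
  obtain C where C: "\<And>i A v. coeff (omega (f i)) A \<noteq> 0 \<Longrightarrow> count A v \<le> i + C"
    using f by (rule good_boundE) blast
  have "count A v \<le> i + C" if "coeff (omega (eperp (i + c) (f i))) A \<noteq> 0" for i A v
    using C[of i "mcons (i + c) A" "Suc v"] that by (simp add: omega_eperp)
  moreover have "stable (\<lambda>i. coeff (Phi (ferm k) (eperp (i + j + c) (f (i + j)))) (A + repeat_mset i (frame k l)))" for A j
  proof -
    have "mcons (i + j + c) (A + repeat_mset i (frame k l)) =
        mcons (j + c) A + repeat_mset i (frame (Suc k) l)" for i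
      by (rule mcons_eqI) (simp_all add: frame_Suc)
    moreover have "coeff (Phi (ferm k) (eperp (i + j + c) (f (i + j)))) B =
        coeff (Phi (ferm (Suc k)) (f (i + j))) (mcons (i + j + c) B)" for i B
    proof -
      have "ferm (Suc k) \<circ> Suc = ferm k" by (simp add: fun_eq_iff)
      then show ?thesis
        using hperp_Phi[of "ferm (Suc k)" "f (i + j)" "i + j + c"] goodD(1)[OF f]
        by (metis coeff_hperp zero_less_Suc)
    qed
    ultimately show ?thesis using goodD(2)[OF f, of j "mcons (j + c) A"] by simp
  qed
  ultimately show ?thesis unfolding good_def by blast
qed

subsection \<open>The basic good sequence\<close>

lemma sgm_frame: "sgm (ferm k) (frame k l) = (-1) ^ k"
proof (induction k)
  case 0
  then show ?case by (simp add: frame_0 sgm_def)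
next
  case (Suc k)
  have "ferm (Suc k) \<circ> Suc = ferm k" by (simp add: fun_eq_iff)
  then show ?case using Suc by (simp add: frame_Suc sgm_mcons)
qed

text \<open>The degree in the fermionic variables; \<open>high\<close> is the degree in the bosonic
  variables beyond \<open>x_k\<close>. Both are additive, so the defects of single letters add up
  over a word.\<close>

definition low :: "nat \<Rightarrow> nat multiset \<Rightarrow> nat" where
  "low k N = (\<Sum>v<k. count N v)"

definition high :: "nat \<Rightarrow> nat multiset \<Rightarrow> nat" where
  "high k N = size (filter_mset (\<lambda>v. k < v) N)"

lemma low_high_add [simp]:
  "low k (A + B) = low k A + low k B" "high k (A + B) = high k A + high k B"
  "low k {#} = 0" "high k {#} = 0"
  by (simp_all add: low_def high_def sum.distrib)

lemma low_high_repeat [simp]: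
  "low k (repeat_mset n A) = n * low k A" "high k (repeat_mset n A) = n * high k A"
  by (induction n) simp_all

lemma size_low_high: "size N = low k N + count N k + high k N"
proof (induction N)
  case (add x N)
  have "low k {#x#} = (\<Sum>v<k. if v = x then 1 else 0)"
    unfolding low_def by (rule sum.cong) auto
  then have "low k {#x#} = (if x < k then 1 else 0)" by simp
  then have "low k (add_mset x N) = low k N + (if x < k then 1 else 0)"
    using low_high_add(1)[of k N "{#x#}"] by simp
  then show ?case using add by (auto simp: high_def)
qed simp

lemma low_frame [simp]: "low k (frame k l) = k" "high k (frame k l) = 0"
  by (simp_all add: low_def high_def count_frame size_eq_0_iff_empty multiset_eq_iff)

text \<open>A letter other than the frame misses one of the first \<open>k\<close> variables or contains a variable
  beyond \<open>x\<^sub>k\<close>.\<close>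

lemma letter_defect:
  assumes N: "N \<in> alphabet (ferm k) (k + l)" "N \<noteq> frame k l"
  shows "1 + low k N \<le> k + high k N"
proof (rule ccontr)
  assume "\<not> ?thesis"
  then have *: "k + high k N \<le> low k N" by simp
  have le: "count N v \<le> 1" if "v < k" for v using N(1) that by (simp add: alphabet_def)
  have "low k N \<le> (\<Sum>v<k. 1)" unfolding low_def by (rule sum_mono) (use le in simp)
  then have eq: "low k N = k" "high k N = 0" using * by simp_all
  have 1: "count N v = 1" if "v < k" for v
  proof (rule ccontr)
    assume "count N v \<noteq> 1"
    then have "count N v < 1" using le[OF that] by simp
    then have "low k N < (\<Sum>v<k. 1)"
      unfolding low_def by (intro sum_strict_mono_ex1) (use le that in auto)
    then show False using eq by simp
  qed
  have none: "filter_mset (\<lambda>v. k < v) N = {#}" using eq(2) by (simp add: high_def)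
  have 2: "count N v = 0" if "k < v" for v
    using arg_cong[OF none, of "\<lambda>M. count M v"] that by simp
  have "size N = k + l" using N(1) by (simp add: alphabet_def)
  then have "count N k = l" using size_low_high[of N k] eq by simp
  then have "N = frame k l"
    using 1 2 by (intro multiset_eqI) (metis count_frame linorder_neqE_nat)
  then show False using N(2) by simp
qed

lemma words_without_frame:
  assumes "set_mset S \<subseteq> alphabet (ferm k) (k + l)" "frame k l \<notin># S"
  shows "size S + low k (sum_mset S) \<le> k * size S + high k (sum_mset S)"
  using assms
proof (induction S)
  case (add N S)
  then have "1 + low k N \<le> k + high k N" by (intro letter_defect) auto
  then show ?case using add by simp
qed simp

lemma card_words_stable:
  assumes \<theta>: "\<not> \<theta> (frame k l)" and i: "k * n + high k A \<le> i"
  shows "card (words (alphabet (ferm k) (k + l)) \<theta> (Suc i + n) (A + repeat_mset (Suc i) (frame k l))) =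
    card (words (alphabet (ferm k) (k + l)) \<theta> (i + n) (A + repeat_mset i (frame k l)))"
proof -
  let ?W = "\<lambda>i. words (alphabet (ferm k) (k + l)) \<theta> (i + n) (A + repeat_mset i (frame k l))"
  have letter: "frame k l \<in> alphabet (ferm k) (k + l)"
    by (simp add: alphabet_def count_frame) (simp add: frame_def)
  \<comment> \<open>Without the frame every letter has a defect of at least one, while the defect of
    the whole product is bounded independently of \<open>i\<close>.\<close>
  have mem: "frame k l \<in># S" if S: "S \<in> ?W (Suc i)" for S
  proof (rule ccontr)
    assume "frame k l \<notin># S"
    then have "size S + low k (sum_mset S) \<le> k * size S + high k (sum_mset S)"
      using S by (intro words_without_frame[where l = l]) (auto simp: words_def)
    moreover have "size S = Suc i + n" "sum_mset S = A + repeat_mset (Suc i) (frame k l)"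
      using S by (simp_all only: words_def mem_Collect_eq)
    \<comment> \<open>Cancelling \<open>k * Suc i\<close> leaves
      \<open>Suc i + n + low k A \<le> k * n + high k A\<close>, which the threshold on
      \<open>i\<close> excludes.\<close>
    ultimately have "Suc i + n + (low k A + Suc i * k) \<le> k * (Suc i + n) + high k A"
      by (simp only: low_high_add low_high_repeat low_frame)
    then show False using i by (simp add: algebra_simps)
  qed
  have "bij_betw (add_mset (frame k l)) (?W i) (?W (Suc i))"
  proof (rule bij_betwI')
    show "add_mset (frame k l) S \<in> ?W (Suc i)" if "S \<in> ?W i" for S
      using that letter \<theta> by (auto simp: words_def ac_simps)
    show "\<exists>T\<in>?W i. S = add_mset (frame k l) T" if S: "S \<in> ?W (Suc i)" for S
    proof -
      obtain T where T: "S = add_mset (frame k l) T" using mem[OF S] by (meson multi_member_split)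
      have "count T N \<le> 1" if "\<theta> N" for N
      proof -
        have "count S N \<le> 1" using S that by (simp only: words_def mem_Collect_eq)
        then show ?thesis by (simp add: T split: if_splits)
      qed
      moreover have "frame k l + sum_mset T = A + repeat_mset (Suc i) (frame k l)"
        using S unfolding T words_def by simp
      then have "sum_mset T = A + repeat_mset i (frame k l)"
        by (simp add: add.left_commute)
      ultimately have "T \<in> ?W i" using S by (simp add: T words_def)
      then show ?thesis using T by blast
    qed
  qed simp
  then show ?thesis by (rule bij_betw_same_card[symmetric])
qed

lemma count_word:
  assumes "\<And>N. N \<in># S \<Longrightarrow> count N v \<le> 1" shows "count (sum_mset S) v \<le> size S"
  using assms
proof (induction S)
  case (add N S)
  have "count N v \<le> 1" using add.prems by simp
  moreover have "count (sum_mset S) v \<le> size S" using add by simp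
  ultimately show ?case by simp
qed simp

text \<open>\<open>b\<close> reverses parities exactly when the frame has sign -1, so the frame is
  always bosonic. The second condition of \<open>good\<close> is \<open>count_word\<close> at the
  all-fermionic alphabet.\<close>

lemma good_plethysm:
  assumes b: "b \<longleftrightarrow> odd k"
  shows "good k l (\<lambda>i. plethysm (csym b (i + a)) (csym False (k + l)))"
proof -
  have "stable (\<lambda>i. coeff (Phi (ferm k) (plethysm (csym b (i + j + a)) (csym False (k + l)))) (A + repeat_mset i (frame k l)))"
    for j A
  proof (rule stable_SucI)
    let ?\<theta> = "\<lambda>M. (sgm (ferm k) M = -1) \<noteq> b"
    fix i assume i: "k * (j + a) + high k A \<le> i"
    have "\<not> ?\<theta> (frame k l)" by (cases "odd k") (simp_all add: sgm_frame b)
    from card_words_stable[of ?\<theta>, OF this i]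
    show "coeff (Phi (ferm k) (plethysm (csym b (Suc i + j + a)) (csym False (k + l)))) (A + repeat_mset (Suc i) (frame k l)) =
        coeff (Phi (ferm k) (plethysm (csym b (i + j + a)) (csym False (k + l)))) (A + repeat_mset i (frame k l))"
      unfolding Phi_plethysm coeff_asum add.assoc by simp
  qed
  moreover have "count A v \<le> i + a"
    if nz: "coeff (omega (plethysm (csym b (i + a)) (csym False (k + l)))) A \<noteq> 0" for i A v
  proof -
    obtain S where S: "S \<in> words (alphabet (\<lambda>_. True) (k + l)) (\<lambda>M. (sgm (\<lambda>_. True) M = -1) \<noteq> b) (i + a) A"
      using nz unfolding Phi_plethysm coeff_asum by (metis card.empty ex_in_conv of_nat_0)
    have "count (sum_mset S) v \<le> size S"
      using S by (intro count_word) (auto simp: words_def alphabet_def)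
    then show ?thesis using S by (simp add: words_def)
  qed
  ultimately show ?thesis unfolding good_def by blast
qed

section \<open>Removing the first column\<close>

definition remove_column :: "nat list \<Rightarrow> nat list" where
  "remove_column \<alpha> = filter (\<lambda>x. x \<noteq> 0) (map (\<lambda>x. x - 1) \<alpha>)"

lemma is_partition_Cons:
  "is_partition (x # xs) \<longleftrightarrow> x \<noteq> 0 \<and> (\<forall>y\<in>set xs. y \<le> x) \<and> is_partition xs"
  by (auto simp: is_partition_def)

lemma remove_column_partition: "is_partition \<alpha> \<Longrightarrow> is_partition (remove_column \<alpha>)"
  by (induction \<alpha>) (auto simp: is_partition_Cons remove_column_def is_partition_def)

lemma part_Cons: "part (x # xs) r = (case r of 0 \<Rightarrow> x | Suc s \<Rightarrow> part xs s)"
  by (simp add: part_def split: nat.split)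

lemma part_remove_column:
  assumes "is_partition \<alpha>" shows "part (remove_column \<alpha>) r = part \<alpha> r - 1"
  using assms
proof (induction \<alpha> arbitrary: r)
  case Nil
  then show ?case by (simp add: remove_column_def part_def)
next
  case (Cons x xs)
  then have xs: "is_partition xs" and le: "\<forall>y\<in>set xs. y \<le> x" and x: "x \<noteq> 0"
    by (simp_all add: is_partition_Cons)
  show ?case
  proof (cases "x = 1")
    case True
    then have "remove_column (x # xs) = []" using le by (auto simp: remove_column_def filter_empty_conv)
    moreover have "part (x # xs) r \<le> 1" using le True by (auto simp: part_def nth_Cons split: nat.splits)
    ultimately show ?thesis by (simp add: part_def)
  next
    case False
    then have "remove_column (x # xs) = (x - 1) # remove_column xs" using x by (simp add: remove_column_def)
    then show ?thesis using Cons.IH[OF xs] by (simp add: part_Cons split: nat.split)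
  qed
qed

text \<open>\<open>alt_omega\<close> expresses both sides by the conjugate partition in
  \<open>\<alpha> 0\<close> variables, where neither \<open>N\<close> nor \<open>M\<close>
  occurs.\<close>

lemma alt_pad:
  assumes "f \<in> Sym" "par N \<alpha>" "par M \<alpha>" shows "alt N \<alpha> f = alt M \<alpha> f"
proof -
  have "alt N \<alpha> (omega (omega f)) = alt M \<alpha> (omega (omega f))"
    using alt_omega[OF omega_Sym assms(2) order_refl] alt_omega[OF omega_Sym assms(3) order_refl] by simp
  then show ?thesis by (simp add: omega_omega assms(1))
qed

lemma par_mono: "par N \<alpha> \<Longrightarrow> N \<le> M \<Longrightarrow> par M \<alpha>"
  by (simp add: par_def)

lemma sc_eq_alt:
  assumes "f \<in> Sym" "is_partition \<alpha>" "length \<alpha> \<le> N" shows "sc f \<alpha> = alt N (part \<alpha>) f"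
  unfolding sc_def
  by (rule alt_pad[OF assms(1)]) (use partition_par[OF assms(2)] par_mono assms(3) in blast)+

lemma sc_eq_alt_conj:
  assumes "f \<in> Sym" "is_partition \<alpha>" "part \<alpha> 0 \<le> M"
  shows "sc f \<alpha> = alt M (conj_part (part \<alpha>)) (omega f)"
  using alt_omega[OF omega_Sym partition_par[OF assms(2)] assms(3), of f]
  by (simp add: sc_def omega_omega assms(1))

lemma conj_part_0: "is_partition \<alpha> \<Longrightarrow> conj_part (part \<alpha>) 0 = length \<alpha>"
proof -
  assume "is_partition \<alpha>"
  then have "{r. 0 < part \<alpha> r} = {..<length \<alpha>}"
    by (auto simp: part_def is_partition_def) (metis gr0I nth_mem)
  then show ?thesis by (simp add: conj_part_def)
qed

text \<open>\<open>alt_Suc\<close> for the conjugate partition, whose first row is the first column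
  of \<alpha>; \<open>omega\<close> turns its e_i and \<open>hperp\<close> into h_i and
  \<open>eperp\<close>. The raw sum runs up to a number of variables that depends on the width of
  \<alpha>; \<open>vanish\<close> cuts it at \<open>C\<close>.\<close>

lemma sc_remove_column:
  assumes f: "f \<in> Sym" and \<alpha>: "is_partition \<alpha>"
    and vanish: "\<And>i. C < i \<Longrightarrow> hperp (length \<alpha> + i) (omega f) = 0"
  shows "sc f \<alpha> = (\<Sum>i\<le>C. (-1) ^ i * sc (csym False i * eperp (length \<alpha> + i) f) (remove_column \<alpha>))"
proof -
  let ?\<beta> = "remove_column \<alpha>"
  \<comment> \<open>At least the number of columns, as conjugation requires, and at least
    \<open>C\<close>, so that the full sum contains the truncated one.\<close>
  let ?K = "max C (part \<alpha> 0)"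
  have \<beta>: "is_partition ?\<beta>" using \<alpha> by (rule remove_column_partition)
  have conj: "conj_part (part \<alpha>) \<circ> Suc = conj_part (part ?\<beta>)"
    by (rule ext) (auto simp: conj_part_def part_remove_column[OF \<alpha>] intro!: arg_cong[of _ _ card])
  have \<beta>0: "part ?\<beta> 0 \<le> ?K" by (simp add: part_remove_column[OF \<alpha>])
  have summand: "alt ?K (conj_part (part ?\<beta>)) (csym True i * hperp (length \<alpha> + i) (omega f)) =
      sc (csym False i * eperp (length \<alpha> + i) f) ?\<beta>" for i
  proof -
    have "omega (csym False i * eperp (length \<alpha> + i) f) = csym True i * hperp (length \<alpha> + i) (omega f)"
      by (simp add: sym_homD(3)[OF sym_hom_Phi] omega_csym omega_eperp)
    moreover have "csym False i * eperp (length \<alpha> + i) f \<in> Sym" by auto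
    ultimately show ?thesis using sc_eq_alt_conj[OF _ \<beta> \<beta>0] by metis
  qed
  have "sc f \<alpha> = alt (Suc ?K) (conj_part (part \<alpha>)) (omega f)"
    by (rule sc_eq_alt_conj[OF f \<alpha>]) simp
  also have "\<dots> = (\<Sum>i\<le>?K. (-1) ^ i * sc (csym False i * eperp (length \<alpha> + i) f) ?\<beta>)"
    unfolding alt_Suc conj conj_part_0[OF \<alpha>] summand ..
  also have "\<dots> = (\<Sum>i\<le>C. (-1) ^ i * sc (csym False i * eperp (length \<alpha> + i) f) ?\<beta>)"
  proof (rule sum.mono_neutral_right)
    show "\<forall>i\<in>{..?K} - {..C}. (-1) ^ i * sc (csym False i * eperp (length \<alpha> + i) f) ?\<beta> = 0"
      using vanish by (auto simp: eperp_def sym_hom_0 sc_def alt_def)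
  qed auto
  finally show ?thesis .
qed

section \<open>Stability along the growing shapes\<close>

definition add_first :: "nat \<Rightarrow> nat list \<Rightarrow> nat list" where
  "add_first c \<alpha> = (if c = 0 then \<alpha> else case \<alpha> of [] \<Rightarrow> [c] | x # xs \<Rightarrow> (x + c) # xs)"

lemma partition_add_one_part: "partition_add \<alpha> (one_part c) = add_first c \<alpha>"
proof (cases "c = 0")
  case True
  have "partition_add \<alpha> [] = \<alpha>"
    by (rule nth_equalityI) (simp_all add: partition_add_def part_def)
  then show ?thesis using True by (simp add: rect_def add_first_def)
next
  case False
  show ?thesis
    by (rule nth_equalityI)
      (use False in \<open>auto simp: partition_add_def rect_def add_first_def part_def nth_Cons split: list.split nat.split\<close>)
qed

lemma add_first_partition:
  assumes "is_partition \<alpha>" shows "is_partition (add_first c \<alpha>)"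
proof (cases \<alpha>)
  case (Cons x xs)
  then show ?thesis using assms by (auto simp: add_first_def is_partition_Cons le_add1 intro: le_trans)
qed (auto simp: add_first_def is_partition_def)

text \<open>With \<open>k = m - l\<close> this is \<open>curly l m j \<alpha>\<close>; the column removal below varies \<open>k\<close> for fixed \<open>l\<close>.\<close>

definition grow :: "nat \<Rightarrow> nat \<Rightarrow> nat \<Rightarrow> nat list \<Rightarrow> nat list" where
  "grow l k j \<alpha> = partition_join (partition_add \<alpha> (one_part (l * j))) (rect k j)"

lemma mset_rect: "mset (rect k j) = (if k = 0 then {#} else replicate_mset j k)"
  by (simp add: rect_def)

lemma mset_grow: "mset (grow l k j \<alpha>) = mset (add_first (l * j) \<alpha>) + mset (rect k j)"
  unfolding grow_def partition_join_def partition_add_one_part by simp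

lemma join_partition:
  assumes "is_partition \<alpha>" "0 \<notin> set \<beta>" shows "is_partition (partition_join \<alpha> \<beta>)"
  unfolding partition_join_def using assms by (intro is_partition_sort) (auto simp: is_partition_def)

lemma grow_partition: "is_partition \<alpha> \<Longrightarrow> is_partition (grow l k j \<alpha>)"
  unfolding grow_def partition_add_one_part
  by (rule join_partition) (auto simp: add_first_partition rect_def)

lemma grow_0: "is_partition \<alpha> \<Longrightarrow> grow l 0 j \<alpha> = add_first (l * j) \<alpha>"
  by (rule partition_mset_inj) (simp_all add: grow_partition add_first_partition mset_grow mset_rect)

text \<open>After \<open>n\<close> steps the first row has length at least \<open>k\<close>, so rows
  of length \<open>k\<close> added later do not overtake it and growth can restart from there. For
  \<open>l = 0\<close> no row is lengthened at all.\<close>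

lemma grow_add:
  assumes \<alpha>: "is_partition \<alpha>" and n: "l = 0 \<or> k \<le> l * n"
  shows "grow l k (i + n) \<alpha> = grow l k i (grow l k n \<alpha>)"
proof (cases "l * n = 0")
  case True
  then consider "l = 0" | "n = 0" "k = 0" using n by auto
  then show ?thesis
  proof cases
    case 1
    then show ?thesis
      by (intro partition_mset_inj)
        (auto simp: \<alpha> grow_partition mset_grow mset_rect add_first_def intro: multiset_eqI)
  next
    case 2
    then show ?thesis using \<alpha> by (simp add: grow_0 add_first_def)
  qed
next
  case False
  then have k: "k \<le> l * n" using n by auto
  obtain y ys where y: "add_first (l * n) \<alpha> = y # ys" "l * n \<le> y"
    "\<And>c. add_first (c + l * n) \<alpha> = (y + c) # ys"
    using False by (cases \<alpha>) (auto simp: add_first_def)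
  have ys: "is_partition (y # ys)" using add_first_partition[OF \<alpha>, of "l * n"] y by simp
  then have y0: "y \<noteq> 0" "\<forall>z\<in>set ys. z \<le> y" "0 \<notin> set ys" by (auto simp: is_partition_def)
  define zs where "zs = rev (sort (ys @ rect k n))"
  have "grow l k n \<alpha> = y # zs"
  proof (rule partition_mset_inj)
    have "is_partition zs" unfolding zs_def using y0 by (intro is_partition_sort) (auto simp: rect_def)
    moreover have "\<forall>z\<in>set zs. z \<le> y" unfolding zs_def using y0 y(2) k by (auto simp: rect_def)
    ultimately show "is_partition (y # zs)" using y0 by (simp add: is_partition_Cons)
    show "mset (grow l k n \<alpha>) = mset (y # zs)" by (simp add: mset_grow y zs_def)
  qed (rule grow_partition[OF \<alpha>])
  then have "mset (add_first (l * i) (grow l k n \<alpha>)) = add_mset (y + l * i) (mset zs)"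
    by (simp add: add_first_def)
  moreover have "mset zs = mset ys + mset (rect k n)" by (simp add: zs_def)
  moreover have "add_first (l * (i + n)) \<alpha> = (y + l * i) # ys"
    using y(3)[of "l * i"] by (simp add: distrib_left)
  ultimately have "mset (grow l k (i + n) \<alpha>) = mset (grow l k i (grow l k n \<alpha>))"
    unfolding mset_grow[of l k i] mset_grow[of l k "i + n"]
    by (auto simp: mset_rect intro: multiset_eqI)
  then show ?thesis by (intro partition_mset_inj grow_partition \<alpha>)
qed

lemma mset_remove_column:
  "mset (remove_column \<alpha>) = filter_mset (\<lambda>x. x \<noteq> 0) (image_mset (\<lambda>x. x - 1) (mset \<alpha>))"
  by (simp add: remove_column_def)

text \<open>For empty \<alpha> and positive \<open>l\<close> the added cells form a new first row,
  which itself loses a cell with the first column. That case is excluded here and handled in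
  \<open>stable_sc_grow\<close> by a shift.\<close>

lemma remove_column_grow:
  assumes \<alpha>: "is_partition \<alpha>" and ne: "\<alpha> \<noteq> [] \<or> l = 0"
  shows "remove_column (grow l (Suc k) j \<alpha>) = grow l k j (remove_column \<alpha>)"
proof (rule partition_mset_inj)
  have "remove_column (add_first c \<alpha>) = add_first c (remove_column \<alpha>)" if nonempty: "\<alpha> \<noteq> []" for c
  proof -
    obtain x xs where x: "\<alpha> = x # xs" using nonempty by (cases \<alpha>) auto
    have x0: "x \<noteq> 0" "\<forall>y\<in>set xs. y \<le> x" using \<alpha> by (auto simp: x is_partition_Cons)
    show ?thesis
    proof (cases "x = 1")
      case True
      then have "filter (\<lambda>x. x \<noteq> 0) (map (\<lambda>x. x - 1) xs) = []"
        using x0 by (auto simp: filter_empty_conv)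
      then show ?thesis using True by (simp add: x add_first_def remove_column_def)
    next
      case False
      then show ?thesis using x0 by (simp add: x add_first_def remove_column_def)
    qed
  qed
  then have "remove_column (add_first (l * j) \<alpha>) = add_first (l * j) (remove_column \<alpha>)"
  proof (cases "\<alpha> = []")
    case True
    then show ?thesis using ne by (simp add: add_first_def remove_column_def)
  qed blast
  moreover have "filter_mset (\<lambda>x. x \<noteq> 0) (image_mset (\<lambda>x. x - 1) (mset (rect (Suc k) j))) = mset (rect k j)"
    by (rule multiset_eqI) (simp add: mset_rect)
  ultimately show "mset (remove_column (grow l (Suc k) j \<alpha>)) = mset (grow l k j (remove_column \<alpha>))"
    unfolding mset_remove_column mset_grow image_mset_union filter_union_mset
    by (simp only: mset_remove_column[symmetric])
qed (use \<alpha> in \<open>simp_all add: remove_column_partition grow_partition\<close>)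

lemma length_grow:
  assumes "\<alpha> \<noteq> [] \<or> l = 0" shows "length (grow l (Suc k) j \<alpha>) = length \<alpha> + j"
proof -
  have "length (add_first (l * j) \<alpha>) = length \<alpha>" using assms by (auto simp: add_first_def split: list.split)
  then show ?thesis using arg_cong[OF mset_grow[of l "Suc k" j \<alpha>], of size] by (simp add: mset_rect)
qed

lemma part_add_first: "part (add_first c \<alpha>) r = part \<alpha> r + (if r = 0 then c else 0)"
  by (auto simp: add_first_def part_def nth_Cons split: list.split nat.split)

text \<open>Induction on the number \<open>k\<close> of growing columns. For \<open>k = 0\<close>
  only the first row grows, no variable is fermionic, and the Vandermonde product is a fixed factor
  of bounded degree. In the step, removing the first column gives finitely many sequences that are
  good for \<open>k\<close>.\<close>

lemma stable_sc_grow: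
  assumes "good k l f" "is_partition \<alpha>"
  shows "stable (\<lambda>i. sc (f i) (grow l k i \<alpha>))"
  using assms
proof (induction k arbitrary: f \<alpha>)
  case 0
  \<comment> \<open>At least one variable, since an empty \<alpha> may acquire a first row.\<close>
  let ?N = "max 1 (length \<alpha>)"
  have sym: "f i \<in> Sym" for i using goodD(1)[OF "0.prems"(1)] .
  have "sc (f i) (grow l 0 i \<alpha>) = coeff (vdm ?N * f i) (shifted ?N (part \<alpha>) + repeat_mset i (frame 0 l))" for i
  proof -
    have "length (add_first (l * i) \<alpha>) \<le> ?N" by (auto simp: add_first_def split: list.split)
    then have "sc (f i) (grow l 0 i \<alpha>) = alt ?N (part (add_first (l * i) \<alpha>)) (f i)"
      unfolding grow_0[OF "0.prems"(2)] using "0.prems"(2) by (intro sc_eq_alt sym add_first_partition)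
    also have "shifted ?N (part (add_first (l * i) \<alpha>)) = shifted ?N (part \<alpha>) + repeat_mset i (frame 0 l)"
      by (rule multiset_eqI) (simp add: part_add_first frame_0)
    then have "alt ?N (part (add_first (l * i) \<alpha>)) (f i) =
        coeff (vdm ?N * f i) (shifted ?N (part \<alpha>) + repeat_mset i (frame 0 l))"
      unfolding alt_def by (simp only:)
    finally show ?thesis .
  qed
  moreover have "stable (\<lambda>i. coeff (vdm ?N * f (i + 0)) (shifted ?N (part \<alpha>) + repeat_mset i (frame 0 l)))"
  proof (rule stable_coeff_mult[OF homogeneous_bounded_by[OF homogeneous_vdm]])
    show "stable (\<lambda>i. coeff (f (i + j)) (A + repeat_mset i (frame 0 l)))" for A j
      using goodD(2)[OF "0.prems"(1), of j A] by (simp add: Phi_False sym)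
  qed
  ultimately show ?case by simp
next
  case (Suc k)
  have step: "stable (\<lambda>i. sc (f i) (grow l (Suc k) i \<alpha>))"
    if f: "good (Suc k) l f" and \<alpha>: "is_partition \<alpha>" and ne: "\<alpha> \<noteq> [] \<or> l = 0" for f \<alpha>
  proof -
    obtain C where C: "\<And>i A v. coeff (omega (f i)) A \<noteq> 0 \<Longrightarrow> count A v \<le> i + C"
      using f by (rule good_boundE) blast
    \<comment> \<open>The column length contains the same \<open>j\<close> as the exponent bound
      \<open>j + C\<close>, so the cut at \<open>C\<close> is uniform in \<open>j\<close>.\<close>
    have vanish: "hperp (length \<alpha> + j + i) (omega (f j)) = 0" if "C < i" for i j
    proof (rule pser_eqI, rule ccontr)
      fix A assume "coeff (hperp (length \<alpha> + j + i) (omega (f j))) A \<noteq> coeff 0 A"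
      then show False using C[of j "mcons (length \<alpha> + j + i) A" 0] that by simp
    qed
    have "sc (f j) (grow l (Suc k) j \<alpha>) = (\<Sum>i\<le>C. (-1) ^ i *
        sc (csym False i * eperp (j + (length \<alpha> + i)) (f j)) (grow l k j (remove_column \<alpha>)))" for j
    proof -
      have "sc (f j) (grow l (Suc k) j \<alpha>) = (\<Sum>i\<le>C. (-1) ^ i *
          sc (csym False i * eperp (length (grow l (Suc k) j \<alpha>) + i) (f j)) (remove_column (grow l (Suc k) j \<alpha>)))"
        by (rule sc_remove_column[OF goodD(1)[OF f] grow_partition[OF \<alpha>]])
          (simp only: length_grow[OF ne] vanish)
      moreover have "length (grow l (Suc k) j \<alpha>) + i = j + (length \<alpha> + i)" for i
        by (simp add: length_grow[OF ne])
      ultimately show ?thesis by (simp only: remove_column_grow[OF \<alpha> ne])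
    qed
    moreover have "stable (\<lambda>j. \<Sum>i\<le>C. (-1) ^ i *
        sc (csym False i * eperp (j + (length \<alpha> + i)) (f j)) (grow l k j (remove_column \<alpha>)))"
      by (intro stable_sum stable_cmult Suc.IH good_mult good_eperp f remove_column_partition \<alpha> csym_Sym)
    ultimately show ?thesis by simp
  qed
  show ?case
  proof (cases "\<alpha> \<noteq> [] \<or> l = 0")
    case True
    then show ?thesis using step Suc.prems by blast
  next
    case False
    \<comment> \<open>The empty shape is first grown by \<open>Suc k\<close> steps. As
      \<open>l\<close> is positive, this meets the condition of \<open>grow_add\<close>, and the
      result is nonempty.\<close>
    let ?\<beta> = "grow l (Suc k) (Suc k) \<alpha>"
    have "1 * Suc k \<le> l * Suc k" using False by (intro mult_le_mono1) simp
    then have n: "Suc k \<le> l * Suc k" by simp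
    have "mset ?\<beta> \<noteq> {#}" by (simp add: mset_grow mset_rect)
    then have "?\<beta> \<noteq> []" by auto
    then have "stable (\<lambda>i. sc (f (i + Suc k)) (grow l (Suc k) i ?\<beta>))"
      using step[OF good_shift[OF Suc.prems(1)] grow_partition[OF Suc.prems(2)]] by blast
    then have "stable (\<lambda>i. sc (f (i + Suc k)) (grow l (Suc k) (i + Suc k) \<alpha>))"
      using grow_add[OF Suc.prems(2), of l "Suc k" "Suc k"] n by simp
    then show ?thesis by (rule stable_shift[THEN iffD1])
  qed
qed

section \<open>Growing skew Schur functions\<close>

lemma square_partition:
  assumes "is_partition \<rho>" shows "is_partition (square l m j \<rho>)"
  unfolding square_def partition_add_one_part
  using assms by (auto simp: rect_def intro: add_first_partition join_partition)

lemma bounded_by_Sym_mult: "bounded_by d f \<Longrightarrow> g \<in> Sym \<Longrightarrow> \<exists>e. bounded_by e (f * g)"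
  using bounded_by_mult Sym_boundedE by metis

lemma conj_part_join_ones:
  assumes \<rho>: "is_partition \<rho>"
  shows "conj_part (part (partition_join \<rho> (rect 1 j))) i = conj_part (part \<rho>) i + (if i = 0 then j else 0)"
proof -
  let ?\<beta> = "partition_join \<rho> (rect 1 j)"
  have \<rho>': "sorted_wrt (\<ge>) \<rho>" "\<forall>x\<in>set \<rho>. 1 \<le> x" using \<rho>
    unfolding is_partition_def by (auto simp: Suc_le_eq intro: gr0I)
  have \<beta>: "?\<beta> = \<rho> @ replicate j 1"
  proof (rule partition_mset_inj)
    show "is_partition ?\<beta>" by (rule join_partition[OF \<rho>]) (simp add: rect_def)
    have "sorted_wrt (\<ge>) (replicate j (1 :: nat))" by (simp add: sorted_wrt_iff_nth_less)
    then show "is_partition (\<rho> @ replicate j 1)"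
      using \<rho>' by (auto simp: is_partition_def sorted_wrt_append)
  qed (simp add: partition_join_def rect_def)
  show ?thesis
  proof (cases "i = 0")
    case True
    have "is_partition ?\<beta>" by (rule join_partition[OF \<rho>]) (simp add: rect_def)
    then show ?thesis using True \<rho> \<beta> by (simp add: conj_part_0)
  next
    case False
    then have "{r. i < part ?\<beta> r} = {r. i < part \<rho> r}"
      unfolding \<beta> by (auto simp: part_def nth_append split: if_splits)
    then show ?thesis using False by (simp add: conj_part_def)
  qed
qed

text \<open>In both cases the \<open>j\<close> new cells multiply the extracted monomial by the j-th
  power of \<open>x_0\<close>: directly if they lengthen the first row, after conjugation if they
  lengthen the first column. The conjugation is what replaces h_A by e_A.\<close>

lemma coeff_skew_square:
  assumes \<rho>: "is_partition \<rho>" and \<kappa>: "is_partition \<kappa>"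
  obtains g E d where "bounded_by d g"
    "\<And>j A. coeff (skew_schur (square l m j \<rho>, \<kappa>)) A =
      coeff (g * csprod (odd (m + l)) A) (E + repeat_mset j {#0#})"
proof (cases "odd (m + l)")
  case False
  let ?N = "max 1 (length \<rho>)"
  obtain d where d: "bounded_by d (vdm ?N * schur \<kappa>)"
    using bounded_by_Sym_mult[OF homogeneous_bounded_by[OF homogeneous_vdm] schur_Sym[OF \<kappa>]] by blast
  have "coeff (skew_schur (square l m j \<rho>, \<kappa>)) A =
      coeff (vdm ?N * schur \<kappa> * csprod (odd (m + l)) A) (shifted ?N (part \<rho>) + repeat_mset j {#0#})" for j A
  proof -
    have sq: "square l m j \<rho> = add_first j \<rho>"
      unfolding square_def partition_add_one_part using False by simp
    have len: "length (add_first j \<rho>) \<le> ?N" by (auto simp: add_first_def split: list.split)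
    have "coeff (skew_schur (square l m j \<rho>, \<kappa>)) A = sc (schur \<kappa> * csprod False A) (square l m j \<rho>)"
      by (rule coeff_skew_schur[OF square_partition[OF \<rho>] \<kappa>])
    also have "\<dots> = alt ?N (part (add_first j \<rho>)) (schur \<kappa> * csprod False A)"
      unfolding sq by (rule sc_eq_alt[OF _ add_first_partition[OF \<rho>] len]) (use \<kappa> in auto)
    also have "\<dots> = coeff (vdm ?N * schur \<kappa> * csprod False A) (shifted ?N (part (add_first j \<rho>)))"
      by (simp add: alt_def mult.assoc)
    also have "shifted ?N (part (add_first j \<rho>)) = shifted ?N (part \<rho>) + repeat_mset j {#0#}"
      by (rule multiset_eqI) (simp add: part_add_first)
    finally show ?thesis using False by simp
  qed
  then show ?thesis by (rule that[OF d])
next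
  case True
  let ?M = "max 1 (part \<rho> 0)"
  obtain d where d: "bounded_by d (vdm ?M * omega (schur \<kappa>))"
    using bounded_by_Sym_mult[OF homogeneous_bounded_by[OF homogeneous_vdm] omega_Sym] by blast
  have "coeff (skew_schur (square l m j \<rho>, \<kappa>)) A =
      coeff (vdm ?M * omega (schur \<kappa>) * csprod (odd (m + l)) A)
        (shifted ?M (conj_part (part \<rho>)) + repeat_mset j {#0#})" for j A
  proof -
    have sq: "square l m j \<rho> = partition_join \<rho> (rect 1 j)" using True by (simp add: square_def)
    have par: "is_partition (square l m j \<rho>)" by (rule square_partition[OF \<rho>])
    \<comment> \<open>Parts equal to one create no column beyond the first.\<close>
    have "part (square l m j \<rho>) 0 \<le> ?M"
    proof (rule ccontr)
      assume "\<not> part (square l m j \<rho>) 0 \<le> ?M"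
      then have "0 < conj_part (part (square l m j \<rho>)) ?M"
        by (simp only: conj_part_iff[OF partition_par[OF par]] not_le)
      then have "0 < conj_part (part \<rho>) ?M" unfolding sq conj_part_join_ones[OF \<rho>] by simp
      then show False by (simp add: conj_part_iff[OF partition_par[OF \<rho>]])
    qed
    then have "sc (schur \<kappa> * csprod False A) (square l m j \<rho>) =
        alt ?M (conj_part (part (square l m j \<rho>))) (omega (schur \<kappa> * csprod False A))"
      using \<kappa> by (intro sc_eq_alt_conj par) auto
    also have "\<dots> = coeff (vdm ?M * omega (schur \<kappa>) * csprod True A) (shifted ?M (conj_part (part (square l m j \<rho>))))"
      using \<kappa> by (simp add: alt_def sym_homD(3)[OF sym_hom_Phi] omega_csprod mult.assoc)
    also have "shifted ?M (conj_part (part (square l m j \<rho>))) = shifted ?M (conj_part (part \<rho>)) + repeat_mset j {#0#}"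
      unfolding sq by (rule multiset_eqI) (simp add: conj_part_join_ones[OF \<rho>, unfolded One_nat_def])
    finally show ?thesis using True coeff_skew_schur[OF par \<kappa>] by simp
  qed
  then show ?thesis by (rule that[OF d])
qed

text \<open>As in \<open>csprod_expansion\<close>, commutation exchanges \<open>A\<close> with the
  growing monomial. The degree bound on \<open>g\<close> makes the index set independent of
  \<open>i\<close>, and the growing exponent of \<open>x_0\<close> becomes a single factor h or e of
  index \<open>i + a B\<close>. All large \<open>n\<close> are allowed, so that \<open>n\<close> can
  also satisfy the condition of \<open>grow_add\<close>.\<close>

lemma skew_square_expansion:
  assumes \<rho>: "is_partition \<rho>" and \<kappa>: "is_partition \<kappa>"
  obtains d where "\<And>n. d \<le> n \<Longrightarrow> \<exists>(S :: nat multiset set) c a g. finite S \<and> (\<forall>B\<in>S. g B \<in> Sym) \<and>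
    (\<forall>i. skew_schur (square l m (i + n) \<rho>, \<kappa>) =
      (\<Sum>B\<in>S. pscale (c B) (csym (odd (m + l)) (i + a B) * g B)))"
proof -
  let ?b = "odd (m + l)"
  obtain g E d where d: "bounded_by d g" and coeff: "\<And>j A. coeff (skew_schur (square l m j \<rho>, \<kappa>)) A =
      coeff (g * csprod ?b A) (E + repeat_mset j {#0#})"
    using coeff_skew_square[OF \<rho> \<kappa>] by metis
  show ?thesis
  proof (rule that)
    fix n assume "d \<le> n"
    then have n: "bounded_by n g" using d bounded_by_mono by blast
    let ?E = "E + repeat_mset n {#0#}"
    let ?S = "{B. B \<subseteq># ?E \<and> size B \<le> n}"
    let ?h = "\<lambda>B. csprod ?b (filter_mset (\<lambda>v. v \<noteq> 0) (?E - B))"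
    have fin: "finite ?S" by (rule finite_subset[OF _ finite_submultisets[of ?E]]) auto
    have split: "csprod ?b (?E - B + repeat_mset i {#0#}) = csym ?b (i + count (?E - B) 0) * ?h B" for B i
    proof -
      have "C + repeat_mset i {#0#} = filter_mset (\<lambda>v. v \<noteq> 0) C + replicate_mset (i + count C 0) 0"
        for C :: "nat multiset" by (rule multiset_eqI) simp
      moreover have "0 \<notin># filter_mset (\<lambda>v. v \<noteq> 0) C" for C :: "nat multiset" by simp
      ultimately show ?thesis by (metis csprod_add_replicate)
    qed
    have "skew_schur (square l m (i + n) \<rho>, \<kappa>) =
        (\<Sum>B\<in>?S. pscale (coeff g B) (csym ?b (i + count (?E - B) 0) * ?h B))" for i
    proof (rule pser_eqI)
      fix A
      have "coeff (skew_schur (square l m (i + n) \<rho>, \<kappa>)) A =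
          (\<Sum>B\<in>?S. coeff g B * coeff (csprod ?b A) ((?E - B) + repeat_mset i {#0#}))"
        unfolding coeff coeff_mult_bounded[OF n] ..
      also have "\<dots> = (\<Sum>B\<in>?S. coeff g B * coeff (csym ?b (i + count (?E - B) 0) * ?h B) A)"
        unfolding coeff_csprod_commute[of ?b A] split ..
      finally show "coeff (skew_schur (square l m (i + n) \<rho>, \<kappa>)) A =
          coeff (\<Sum>B\<in>?S. pscale (coeff g B) (csym ?b (i + count (?E - B) 0) * ?h B)) A"
        by (simp del: count_diff count_union)
    qed
    then show "\<exists>(S :: nat multiset set) c a g. finite S \<and> (\<forall>B\<in>S. g B \<in> Sym) \<and>
        (\<forall>i. skew_schur (square l m (i + n) \<rho>, \<kappa>) =
          (\<Sum>B\<in>S. pscale (c B) (csym ?b (i + a B) * g B)))"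
      by (intro exI[of _ ?S] exI[of _ "coeff g"] exI[of _ "\<lambda>B. count (?E - B) 0"] exI[of _ ?h] conjI fin)
        auto
  qed
qed

text \<open>Jacobi-Trudi in one variable, where the Vandermonde product is empty.\<close>

lemma schur_one_part:
  assumes "1 \<le> m" shows "schur (one_part m) = csym False m"
proof -
  have one: "one_part m = [m]" using assms by (simp add: rect_def)
  have p: "is_partition [m]" using assms by (simp add: is_partition_def)
  have none: "{(i, j). i < j \<and> j < Suc 0} = ({} :: (nat \<times> nat) set)" by auto
  have v: "vdm (Suc 0) = 1" unfolding vdm_def none by simp
  have E: "shifted (Suc 0) (part [m]) = replicate_mset m 0"
    by (rule multiset_eqI) (simp add: part_def)
  have "schur [m] = (\<Sum>B | B \<subseteq># replicate_mset m 0. pscale (coeff 1 B) (csprod False (replicate_mset m 0 - B)))"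
    using jacobi_trudi[OF p] unfolding list.size add_0 v E by simp
  also have "\<dots> = (\<Sum>B | B \<subseteq># replicate_mset m (0 :: nat). if B = {#} then csprod False (replicate_mset m 0) else 0)"
  proof (rule sum.cong[OF refl])
    fix B :: "nat multiset"
    show "pscale (coeff 1 B) (csprod False (replicate_mset m 0 - B)) =
        (if B = {#} then csprod False (replicate_mset m 0) else 0)" by simp
  qed
  also have "\<dots> = csprod False (replicate_mset m 0)" by simp
  also have "\<dots> = csym False m" using csprod_add_replicate[of 0 "{#}" False m] by simp
  finally show ?thesis by (simp only: one)
qed

theorem theorem1p3:
  fixes \<mu> \<nu> \<rho> \<kappa> :: "nat list" and \<sigma> \<tau> :: skew_shape and l m :: nat
  assumes "is_partition \<mu>" and "is_partition \<nu>" and "is_partition \<rho>" and "is_partition \<kappa>"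
    and "\<sigma> = (\<mu>, \<nu>)" and "\<tau> = (\<rho>, \<kappa>)"
    and "m \<ge> 1" and "l \<in> {0..m}"
  shows "\<exists>c. \<forall>\<^sub>F j in sequentially.
    plethysm_coeff (skew_square l m j \<tau>) (one_part m) (skew_curly l m j \<sigma>) = c"
proof -
  note \<mu> = assms(1) and \<nu> = assms(2) and \<rho> = assms(3) and \<kappa> = assms(4)
  define k where "k = m - l"
  have kl: "k + l = m" using assms(8) by (simp add: k_def)
  have odd: "odd (m + l) \<longleftrightarrow> odd k" using kl by auto
  let ?h = "csym False m"
  let ?X = "\<lambda>j. skew_schur (square l m j \<rho>, \<kappa>)"
  let ?a = "\<lambda>j. sc (schur \<nu> * plethysm (?X j) ?h) (grow l k j \<mu>)"
  have eq: "plethysm_coeff (skew_square l m j \<tau>) (one_part m) (skew_curly l m j \<sigma>) = ?a j" for j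
  proof -
    have curly: "curly l m j \<mu> = grow l k j \<mu>" by (simp add: curly_def grow_def k_def)
    show ?thesis
      unfolding plethysm_coeff_def skew_square_def skew_curly_def assms(5,6) fst_conv snd_conv
        schur_one_part[OF assms(7)] curly
      by (rule hall_skew_schur[OF plethysm_Sym[OF csym_Sym] grow_partition[OF \<mu>] \<nu>])
  qed
  obtain d where d: "\<And>n. d \<le> n \<Longrightarrow> \<exists>(S :: nat multiset set) c a g. finite S \<and> (\<forall>B\<in>S. g B \<in> Sym) \<and>
      (\<forall>i. ?X (i + n) = (\<Sum>B\<in>S. pscale (c B) (csym (odd (m + l)) (i + a B) * g B)))"
    by (rule skew_square_expansion[OF \<rho> \<kappa>]) blast
  \<comment> \<open>\<open>d\<close> serves the expansion of the skew Schur function, and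
    \<open>k\<close> serves \<open>grow_add\<close>, since \<open>k \<le> l * n\<close> for positive
    \<open>l\<close>.\<close>
  define n where "n = d + k"
  have n: "l = 0 \<or> k \<le> l * n" by (cases l) (auto simp: n_def)
  have "d \<le> n" by (simp add: n_def)
  from d[OF this, unfolded odd] obtain S c a g
    where S: "finite (S :: nat multiset set)" "\<And>B. B \<in> S \<Longrightarrow> g B \<in> Sym"
      and X: "\<And>i. ?X (i + n) = (\<Sum>B\<in>S. pscale (c B) (csym (odd k) (i + a B) * g B))"
    by blast
  \<comment> \<open>The plethysm is multiplicative in its first argument, so each term is a fixed
    symmetric function times the basic good sequence.\<close>
  let ?F = "\<lambda>B i. (schur \<nu> * plethysm (g B) ?h) * plethysm (csym (odd k) (i + a B)) ?h"
  have "?a (i + n) = (\<Sum>B\<in>S. c B * sc (?F B i) (grow l k i (grow l k n \<mu>)))" for i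
  proof -
    have "plethysm (?X (i + n)) ?h = (\<Sum>B\<in>S. plethysm (pscale (c B) (csym (odd k) (i + a B) * g B)) ?h)"
      unfolding X by (rule sym_hom_sum[OF sym_hom_plethysm]) (use S(2) in auto)
    also have "\<dots> = (\<Sum>B\<in>S. pscale (c B) (plethysm (csym (odd k) (i + a B)) ?h * plethysm (g B) ?h))"
      using S(2)
      by (intro sum.cong) (simp_all add: sym_homD(3,4)[OF sym_hom_plethysm] Sym_mult)
    finally show ?thesis
      unfolding grow_add[OF \<mu> n]
      by (simp add: sum_distrib_left sc_sum sc_pscale mult.assoc mult.commute[of "plethysm (csym _ _) _"])
  qed
  moreover have "stable (\<lambda>i. \<Sum>B\<in>S. c B * sc (?F B i) (grow l k i (grow l k n \<mu>)))"
  proof (intro stable_sum stable_cmult stable_sc_grow grow_partition \<mu>)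
    fix B assume "B \<in> S"
    then have "schur \<nu> * plethysm (g B) ?h \<in> Sym" using \<nu> by auto
    then show "good k l (?F B)"
      using good_plethysm[OF refl, of k l "a B"] unfolding kl by (intro good_mult)
  qed
  ultimately have "stable (\<lambda>i. ?a (i + n))" by simp
  then have "stable ?a" by (rule stable_shift[THEN iffD1])
  then show ?thesis unfolding eq stable_def .
qed

end
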